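(* Let $(R,\mathfrak m)$ be a (one-dimensional) almost Gorenstein local ring, let $I$ be a canonical ideal of $R$, and let $a,b\in R$. Let $\nu(R)$ and $t(R)$ denote the embedding dimension and the Cohen-Macaulay type of $R$ respectively. Then the Hilbert function of $R(I)_{a,b}$ is $$H_{R(I)_{a,b}}(0)=1,\qquad H_{R(I)_{a,b}}(1)=\nu(R)+t(R),\qquad H_{R(I)_{a,b}}(h)=H_R(h)+H_R(h-1)\ \text{ for all } h\ge2.$$
   Context: For a local ring $(A,\mathfrak n)$, $H_A(h)=\dim_{A/\mathfrak n}(\mathfrak n^h/\mathfrak n^{h+1})$ is its Hilbert function. For a commutative ring $R$ with identity, a proper ideal $I$ and $a,b\in R$, let $\mathcal R_+=\bigoplus_{n\ge0}I^nt^n\subseteq R[t]$ be the Rees algebra of $I$, and let $I^2(t^2+at+b)$ denote the contraction to $\mathcal R_+$ of the ideal $(t^2+at+b)$ of $R[t]$, i.e. $(t^2+at+b)R[t]\cap\mathcal R_+$. Then $R(I)_{a,b}:=\mathcal R_+/I^2(t^2+at+b)$. If $R$ is local, so is $R(I)_{a,b}$. A one-dimensional Cohen-Macaulay local ring $(R,\mathfrak m)$ having a canonical module $\omega_R$ with $R\subseteq\omega_R\subseteq\overline R$ ($\overline R$ the integral closure of $R$ in its total ring of fractions) is almost Gorenstein if $\mathfrak m\,\omega_R=\mathfrak m$. A canonical ideal of $R$ is a (proper) ideal of $R$ isomorphic to the canonical module; equivalently an ideal of the form $c\,\omega_R$ with $c\in R$ regular and $c\,\omega_R\subsetneq R$.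 *)

theory Defs
  imports
    "HOL-Algebra.Algebra"
    "HOL-Library.Extended_Nat"
    "Jordan_Normal_Form.Missing_VectorSpace"
begin

section \<open>Noetherian local rings, dimension and depth\<close>

text \<open>As usual in this context, local rings are Noetherian.\<close>

definition local_ring :: "('a, 'r) ring_scheme \<Rightarrow> bool" where
  "local_ring R \<longleftrightarrow> cring R \<and> noetherian_ring R \<and> (\<exists>!\<mm>. maximalideal \<mm> R)"

definition max_ideal :: "('a, 'r) ring_scheme \<Rightarrow> 'a set" where
  "max_ideal R = (THE \<mm>. maximalideal \<mm> R)"

definition krull_dim :: "('a, 'r) ring_scheme \<Rightarrow> enat" where
  "krull_dim R = Sup {enat n | n.
     \<exists>P. (\<forall>i\<le>n. primeideal (P i) R) \<and> (\<forall>i<n. P i \<subset> P (Suc i))}"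

text \<open>The condition that the quotient by the whole sequence is nonzero is not part of
  this definition; it is automatic for sequences in the maximal ideal.\<close>

definition regular_sequence :: "('a, 'r) ring_scheme \<Rightarrow> 'a list \<Rightarrow> bool" where
  "regular_sequence R xs \<longleftrightarrow> set xs \<subseteq> carrier R \<and>
     (\<forall>i<length xs. \<forall>y\<in>carrier R.
        xs ! i \<otimes>\<^bsub>R\<^esub> y \<in> Idl\<^bsub>R\<^esub> (set (take i xs)) \<longrightarrow> y \<in> Idl\<^bsub>R\<^esub> (set (take i xs)))"

definition depth :: "('a, 'r) ring_scheme \<Rightarrow> enat" where
  "depth R = Sup {enat (length xs) | xs. set xs \<subseteq> max_ideal R \<and> regular_sequence R xs}"

definition cohen_macaulay_local :: "('a, 'r) ring_scheme \<Rightarrow> bool" where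
  "cohen_macaulay_local R \<longleftrightarrow> local_ring R \<and> depth R = krull_dim R"


section \<open>Modules and residue field dimension\<close>

text \<open>In the module records below the fields \<open>mult\<close> and \<open>one\<close> are
  irrelevant.\<close>

definition ring_module :: "('a, 'r) ring_scheme \<Rightarrow> ('a, 'a) module" where
  "ring_module R = \<lparr>carrier = carrier R, monoid.mult = monoid.mult R, monoid.one = monoid.one R, ring.zero = ring.zero R,
     ring.add = ring.add R, module.smult = monoid.mult R\<rparr>"

definition quot_module :: "('a, 'v, 'x) module_scheme \<Rightarrow> 'v set \<Rightarrow> ('a, 'v set) module" where
  "quot_module M N = \<lparr>carrier = a_rcosets\<^bsub>M\<^esub> N, monoid.mult = (\<lambda>S T. N), monoid.one = N, ring.zero = N,
     ring.add = set_add M, module.smult = (\<lambda>r S. \<Union>x\<in>S. N +>\<^bsub>M\<^esub> (r \<odot>\<^bsub>M\<^esub> x))\<rparr>"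

definition power_module :: "('a, 'v, 'x) module_scheme \<Rightarrow> nat \<Rightarrow> ('a, nat \<Rightarrow> 'v) module" where
  "power_module M n = \<lparr>carrier = {..<n} \<rightarrow>\<^sub>E carrier M,
     monoid.mult = (\<lambda>f g. \<lambda>i\<in>{..<n}. \<zero>\<^bsub>M\<^esub>), monoid.one = (\<lambda>i\<in>{..<n}. \<zero>\<^bsub>M\<^esub>), ring.zero = (\<lambda>i\<in>{..<n}. \<zero>\<^bsub>M\<^esub>),
     ring.add = (\<lambda>f g. \<lambda>i\<in>{..<n}. f i \<oplus>\<^bsub>M\<^esub> g i), module.smult = (\<lambda>r f. \<lambda>i\<in>{..<n}. r \<odot>\<^bsub>M\<^esub> f i)\<rparr>"

definition finitely_generated :: "('a, 'r) ring_scheme \<Rightarrow> ('a, 'v, 'x) module_scheme \<Rightarrow> bool" where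
  "finitely_generated R M \<longleftrightarrow>
     (\<exists>S. finite S \<and> S \<subseteq> carrier M \<and> module.span R M S = carrier M)"

definition modules_isomorphic ::
  "('a, 'r) ring_scheme \<Rightarrow> ('a, 'v, 'x) module_scheme \<Rightarrow> ('a, 'w, 'y) module_scheme \<Rightarrow> bool" where
  "modules_isomorphic R M N \<longleftrightarrow> (\<exists>f\<in>module_hom R M N. bij_betw f (carrier M) (carrier N))"

text \<open>An \<open>R\<close>-module annihilated by the maximal ideal, regarded as a vector space over the
  residue field: all representatives of a residue class act in the same way.\<close>

definition residue_space ::
  "('a, 'r) ring_scheme \<Rightarrow> ('a, 'v, 'x) module_scheme \<Rightarrow> ('a set, 'v) module" where
  "residue_space R V = \<lparr>carrier = carrier V, monoid.mult = monoid.mult V, monoid.one = monoid.one V, ring.zero = ring.zero V,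
     ring.add = ring.add V, module.smult = (\<lambda>S v. the_elem ((\<lambda>r. r \<odot>\<^bsub>V\<^esub> v) ` S))\<rparr>"

text \<open>\<^term>\<open>vectorspace.dim\<close> is meaningful only for finite-dimensional spaces; below it is applied
  to subquotients of finitely generated modules over Noetherian rings.\<close>

definition residue_dim :: "('a, 'r) ring_scheme \<Rightarrow> ('a, 'v, 'x) module_scheme \<Rightarrow> nat" where
  "residue_dim R V = vectorspace.dim (R Quot max_ideal R) (residue_space R V)"


section \<open>Hilbert function and embedding dimension\<close>

abbreviation ideal_power :: "('a, 'r) ring_scheme \<Rightarrow> 'a set \<Rightarrow> nat \<Rightarrow> 'a set" where
  "ideal_power R I n \<equiv> I [^]\<^bsub>ideals_set R\<^esub> n"

definition hilbert_function :: "('a, 'r) ring_scheme \<Rightarrow> nat \<Rightarrow> nat" where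
  "hilbert_function A h = residue_dim A
     (quot_module ((ring_module A)\<lparr>carrier := ideal_power A (max_ideal A) h\<rparr>)
        (ideal_power A (max_ideal A) (Suc h)))"

definition embedding_dim :: "('a, 'r) ring_scheme \<Rightarrow> nat" where
  "embedding_dim R = residue_dim R
     (quot_module ((ring_module R)\<lparr>carrier := max_ideal R\<rparr>)
        (ideal_prod R (max_ideal R) (max_ideal R)))"


section \<open>Ext, Cohen-Macaulay type and canonical modules\<close>

text \<open>The map from the \<open>p\<close>-th to the \<open>q\<close>-th power of \<open>M\<close> given by a
  \<open>q\<close> by \<open>p\<close> matrix \<open>A\<close> over the ring.\<close>

definition matrix_map ::
  "('a, 'v, 'x) module_scheme \<Rightarrow> nat \<Rightarrow> nat \<Rightarrow> (nat \<Rightarrow> nat \<Rightarrow> 'a) \<Rightarrow> (nat \<Rightarrow> 'v) \<Rightarrow> nat \<Rightarrow> 'v" where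
  "matrix_map M q p A c = (\<lambda>j\<in>{..<q}. \<Oplus>\<^bsub>M\<^esub>k\<in>{..<p}. A j k \<odot>\<^bsub>M\<^esub> c k)"

text \<open>A resolution of \<open>M\<close> by free modules of finite rank: the \<open>i\<close>-th free module has
  rank \<open>n i\<close>, the standard basis of the one in degree 0 is sent to the generators \<open>e\<close>, and
  \<open>D i\<close> is the \<open>n i\<close> by \<open>n (Suc i)\<close> matrix of the differential from degree
  \<open>Suc i\<close> to degree \<open>i\<close>. Such resolutions exist when \<open>M\<close> is finitely generated over a
  Noetherian ring.\<close>

definition free_resolution ::
  "('a, 'r) ring_scheme \<Rightarrow> ('a, 'v, 'x) module_scheme \<Rightarrow>
   (nat \<Rightarrow> nat) \<Rightarrow> (nat \<Rightarrow> 'v) \<Rightarrow> (nat \<Rightarrow> nat \<Rightarrow> nat \<Rightarrow> 'a) \<Rightarrow> bool" where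
  "free_resolution R M n e D \<longleftrightarrow>
     (let F = (\<lambda>i. power_module (ring_module R) (n i));
          d = (\<lambda>i. matrix_map (ring_module R) (n i) (n (Suc i)) (D i));
          aug = (\<lambda>c. \<Oplus>\<^bsub>M\<^esub>j\<in>{..<n 0}. c j \<odot>\<^bsub>M\<^esub> e j)
      in (\<forall>j<n 0. e j \<in> carrier M) \<and>
         (\<forall>i. \<forall>j<n i. \<forall>k<n (Suc i). D i j k \<in> carrier R) \<and>
         aug ` carrier (F 0) = carrier M \<and>
         {c \<in> carrier (F 0). aug c = \<zero>\<^bsub>M\<^esub>} = d 0 ` carrier (F 1) \<and>
         (\<forall>i. {c \<in> carrier (F (Suc i)). d i c = \<zero>\<^bsub>F i\<^esub>} = d (Suc i) ` carrier (F (Suc (Suc i)))))"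

text \<open>\<open>Ext\<^sup>i\<^sub>R(M, C)\<close> for finitely generated \<open>M\<close>, computed from a chosen free resolution of
  \<open>M\<close> (up to isomorphism the choice is immaterial). Homomorphisms from the free module of
  rank \<open>n i\<close> to \<open>C\<close> are identified with their tuples of values on the standard basis, so
  the coboundary maps are given by the transposed matrices.\<close>

definition Ext_module ::
  "('a, 'r) ring_scheme \<Rightarrow> nat \<Rightarrow> ('a, 'v, 'x) module_scheme \<Rightarrow> ('a, 'w, 'y) module_scheme \<Rightarrow>
   ('a, (nat \<Rightarrow> 'w) set) module" where
  "Ext_module R i M C =
     (let (n, e, D) = (SOME (n, e, D). free_resolution R M n e D);
          H = (\<lambda>i. power_module C (n i));
          \<delta> = (\<lambda>i. matrix_map C (n (Suc i)) (n i) (\<lambda>k j. D i j k));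
          cocycles = {c \<in> carrier (H i). \<delta> i c = \<zero>\<^bsub>H (Suc i)\<^esub>};
          coboundaries = (case i of 0 \<Rightarrow> {\<zero>\<^bsub>H 0\<^esub>} | Suc i' \<Rightarrow> \<delta> i' ` carrier (H i'))
      in quot_module ((H i)\<lparr>carrier := cocycles\<rparr>) coboundaries)"

definition residue_field_module :: "('a, 'r) ring_scheme \<Rightarrow> ('a, 'a set) module" where
  "residue_field_module R = quot_module (ring_module R) (max_ideal R)"

text \<open>The Bass number \<open>dim\<^sub>k Ext\<^sup>i\<^sub>R(k, C)\<close>, where \<open>k\<close> is the residue field.\<close>

definition bass_number :: "('a, 'r) ring_scheme \<Rightarrow> nat \<Rightarrow> ('a, 'v, 'x) module_scheme \<Rightarrow> nat" where
  "bass_number R i C = residue_dim R (Ext_module R i (residue_field_module R) C)"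

definition cm_type :: "('a, 'r) ring_scheme \<Rightarrow> nat" where
  "cm_type R = bass_number R (the_enat (depth R)) (ring_module R)"

text \<open>Canonical modules of a Cohen-Macaulay local ring: finitely generated modules \<open>C\<close> with
  \<open>dim\<^sub>k Ext\<^sup>i\<^sub>R(k, C) = \<delta>\<^sub>i\<^sub>d\<close> for all \<open>i\<close>, where \<open>d\<close> is the dimension of \<open>R\<close>.\<close>

definition canonical_module :: "('a, 'r) ring_scheme \<Rightarrow> ('a, 'v, 'x) module_scheme \<Rightarrow> bool" where
  "canonical_module R C \<longleftrightarrow> module R C \<and> finitely_generated R C \<and>
     (\<forall>i. bass_number R i C = (if enat i = krull_dim R then 1 else 0))"


section \<open>Total ring of fractions\<close>

definition regular_elements :: "('a, 'r) ring_scheme \<Rightarrow> 'a set" where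
  "regular_elements R =
     {s \<in> carrier R. \<forall>x\<in>carrier R. s \<otimes>\<^bsub>R\<^esub> x = \<zero>\<^bsub>R\<^esub> \<longrightarrow> x = \<zero>\<^bsub>R\<^esub>}"

definition fraction_rel :: "('a, 'r) ring_scheme \<Rightarrow> (('a \<times> 'a) \<times> ('a \<times> 'a)) set" where
  "fraction_rel R = {((r, s), (r', s')).
     r \<in> carrier R \<and> s \<in> regular_elements R \<and> r' \<in> carrier R \<and> s' \<in> regular_elements R \<and>
     r \<otimes>\<^bsub>R\<^esub> s' = r' \<otimes>\<^bsub>R\<^esub> s}"

definition fraction :: "('a, 'r) ring_scheme \<Rightarrow> 'a \<Rightarrow> 'a \<Rightarrow> ('a \<times> 'a) set" where
  "fraction R r s = fraction_rel R `` {(r, s)}"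

definition total_fractions :: "('a, 'r) ring_scheme \<Rightarrow> ('a \<times> 'a) set ring" where
  "total_fractions R = \<lparr>carrier = (carrier R \<times> regular_elements R) // fraction_rel R,
     monoid.mult = (\<lambda>S T. \<Union>(r, s)\<in>S. \<Union>(r', s')\<in>T. fraction R (r \<otimes>\<^bsub>R\<^esub> r') (s \<otimes>\<^bsub>R\<^esub> s')),
     monoid.one = fraction R \<one>\<^bsub>R\<^esub> \<one>\<^bsub>R\<^esub>,
     ring.zero = fraction R \<zero>\<^bsub>R\<^esub> \<one>\<^bsub>R\<^esub>,
     ring.add = (\<lambda>S T. \<Union>(r, s)\<in>S. \<Union>(r', s')\<in>T.
       fraction R (r \<otimes>\<^bsub>R\<^esub> s' \<oplus>\<^bsub>R\<^esub> r' \<otimes>\<^bsub>R\<^esub> s) (s \<otimes>\<^bsub>R\<^esub> s'))\<rparr>"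

definition embed :: "('a, 'r) ring_scheme \<Rightarrow> 'a \<Rightarrow> ('a \<times> 'a) set" where
  "embed R r = fraction R r \<one>\<^bsub>R\<^esub>"

definition fractions_module :: "('a, 'r) ring_scheme \<Rightarrow> ('a, ('a \<times> 'a) set) module" where
  "fractions_module R =
     (let Q = total_fractions R in
      \<lparr>carrier = carrier Q, monoid.mult = monoid.mult Q, monoid.one = monoid.one Q, ring.zero = ring.zero Q, ring.add = ring.add Q,
       module.smult = (\<lambda>r x. embed R r \<otimes>\<^bsub>Q\<^esub> x)\<rparr>)"

definition integral_closure :: "('a, 'r) ring_scheme \<Rightarrow> ('a \<times> 'a) set set" where
  "integral_closure R =
     (let Q = total_fractions R in
      {x \<in> carrier Q. \<exists>(n::nat) c. (\<forall>i<n. c i \<in> carrier R) \<and>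
         x [^]\<^bsub>Q\<^esub> n \<oplus>\<^bsub>Q\<^esub> (\<Oplus>\<^bsub>Q\<^esub>i\<in>{..<n}. embed R (c i) \<otimes>\<^bsub>Q\<^esub> x [^]\<^bsub>Q\<^esub> i) = \<zero>\<^bsub>Q\<^esub>})"


section \<open>Almost Gorenstein rings and canonical ideals\<close>

text \<open>\<open>R\<close> is almost Gorenstein with canonical module \<open>\<omega>\<close>, where
  \<open>R \<subseteq> \<omega> \<subseteq> integral_closure R\<close> inside the total ring of fractions; the last
  condition says \<open>\<mm>\<omega> = \<mm>\<close>.\<close>

definition almost_gorenstein :: "('a, 'r) ring_scheme \<Rightarrow> ('a \<times> 'a) set set \<Rightarrow> bool" where
  "almost_gorenstein R \<omega> \<longleftrightarrow>
     cohen_macaulay_local R \<and> krull_dim R = 1 \<and>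
     submodule R \<omega> (fractions_module R) \<and>
     canonical_module R ((fractions_module R)\<lparr>carrier := \<omega>\<rparr>) \<and>
     embed R ` carrier R \<subseteq> \<omega> \<and> \<omega> \<subseteq> integral_closure R \<and>
     ideal_prod (total_fractions R) (embed R ` max_ideal R) \<omega> = embed R ` max_ideal R"

text \<open>\<open>I\<close> is a proper ideal isomorphic to the canonical module \<open>\<omega>\<close>.\<close>

definition canonical_ideal :: "('a, 'r) ring_scheme \<Rightarrow> ('a \<times> 'a) set set \<Rightarrow> 'a set \<Rightarrow> bool" where
  "canonical_ideal R \<omega> I \<longleftrightarrow> ideal I R \<and> I \<noteq> carrier R \<and>
     modules_isomorphic R ((ring_module R)\<lparr>carrier := I\<rparr>) ((fractions_module R)\<lparr>carrier := \<omega>\<rparr>)"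


section \<open>The rings \<open>R(I)\<^sub>a\<^sub>,\<^sub>b\<close>\<close>

definition rees_algebra :: "('a, 'r) ring_scheme \<Rightarrow> 'a set \<Rightarrow> ('a, nat \<Rightarrow> 'a) up_ring" where
  "rees_algebra R I = (UP R)\<lparr>carrier :=
     {p \<in> carrier (UP R). \<forall>n. up_ring.coeff (UP R) p n \<in> ideal_power R I n}\<rparr>"

definition rees_quotient ::
  "('a, 'r) ring_scheme \<Rightarrow> 'a set \<Rightarrow> 'a \<Rightarrow> 'a \<Rightarrow> (nat \<Rightarrow> 'a) set ring" where
  "rees_quotient R I a b =
     (let P = UP R;
          f = up_ring.monom P \<one>\<^bsub>R\<^esub> 2 \<oplus>\<^bsub>P\<^esub> up_ring.monom P a 1 \<oplus>\<^bsub>P\<^esub> up_ring.monom P b 0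
      in rees_algebra R I Quot (PIdl\<^bsub>P\<^esub> f \<inter> carrier (rees_algebra R I)))"

end

theory Submission
  imports Defs
begin

text \<open>
  The ring \<open>R(I)\<^sub>a\<^sub>,\<^sub>b\<close> consists of the classes of \<open>r + i t\<close> with \<open>r \<in> R\<close> and \<open>i \<in> I\<close>, because
  one can divide by the monic polynomial \<open>t\<^sup>2 + a t + b\<close> inside the Rees algebra, and these classes are
  distinct, because no nonzero multiple of that polynomial has degree below two. Its maximal ideal is \<open>\<nn> = \<mm> + I t\<close>, and the multiplication rule gives
  \<open>\<nn>\<^sup>h = \<mm>\<^sup>h + \<mm>\<^sup>h\<^sup>-\<^sup>1 I t\<close> for \<open>h \<ge> 1\<close>, independently of \<open>a\<close> and \<open>b\<close>. Counting lengths one coordinate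
  at a time, the Hilbert function of \<open>R(I)\<^sub>a\<^sub>,\<^sub>b\<close> at \<open>h \<ge> 1\<close> is \<open>H\<^sub>R(h)\<close> plus the length of
  \<open>\<mm>\<^sup>h\<^sup>-\<^sup>1 I / \<mm>\<^sup>h I\<close>.

  Let \<open>c \<in> I\<close> correspond to \<open>1 \<in> \<omega>\<close> under \<open>I \<cong> \<omega>\<close>. It is a regular element, and \<open>\<mm> \<omega> = \<mm>\<close> becomes
  \<open>\<mm> I = c \<mm>\<close>. For \<open>h \<ge> 2\<close> the second summand is therefore the length of \<open>c \<mm>\<^sup>h\<^sup>-\<^sup>1 / c \<mm>\<^sup>h\<close>, that is
  \<open>H\<^sub>R(h - 1)\<close>. For \<open>h = 1\<close> it is the length of \<open>I / c \<mm>\<close>, and it remains to see that this number is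
  the Cohen-Macaulay type (theorem \<open>type_eq_generators\<close>).

  Both the type of \<open>R\<close> and the condition that \<open>\<omega>\<close> is canonical are statements about
  \<open>Ext\<^sup>1(k, M)\<close> computed from some free resolution of the residue field \<open>k\<close>. If \<open>x \<in> \<mm>\<close> is a
  nonzerodivisor on \<open>M\<close>, this module is isomorphic to the socle \<open>(x M : \<mm>) / x M\<close> of \<open>M / x M\<close>
  (theorems \<open>ext1_length\<close> and \<open>bass_number_1\<close>). So the type is the length of \<open>(c R : \<mm>) / c R\<close>, and
  the socle \<open>U / c I\<close> of \<open>I / c I\<close> has length one. The latter yields the part of canonical
  duality that the argument needs: for an ideal \<open>J\<close> containing \<open>c\<close> the length of
  \<open>{i \<in> I. i J \<subseteq> c I} / c I\<close> is at most that of \<open>R / J\<close>. As \<open>I / c I\<close> and \<open>R / c R\<close> have the same length,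
  it follows that an element \<open>i \<in> I\<close> with \<open>i I \<subseteq> c I\<close> lies in \<open>c R\<close>; this is the equality
  \<open>\<omega> : \<omega> = R\<close>. Together with \<open>\<mm> I = c \<mm>\<close> it shows that multiplication by \<open>c\<close> maps \<open>c R : \<mm>\<close> onto \<open>U\<close>.
  Hence the type is the length of \<open>U / c\<^sup>2 R\<close>, which is one plus the length of \<open>c I / c\<^sup>2 R\<close>. Since
  these two summands are the lengths of \<open>c R / c \<mm>\<close> and \<open>I / c R\<close>, they add up to the length of \<open>I / c \<mm>\<close>.

  Dimensions over the residue field are handled throughout as lengths of chains of submodules
  (theorem \<open>residue_dim_eq_rel_length\<close>), which are additive and can be compared along maps between
  modules over different rings.
\<close>

section \<open>Relative length of submodules\<close>

inductive submodule_chain ::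
  "('a, 'r) ring_scheme \<Rightarrow> ('a, 'v, 'x) module_scheme \<Rightarrow> 'v set \<Rightarrow> 'v set \<Rightarrow> nat \<Rightarrow> bool"
  for R M where
  trivial: "submodule R N M \<Longrightarrow> submodule_chain R M N N 0"
| step: "submodule R N M \<Longrightarrow> N \<subset> N' \<Longrightarrow> submodule_chain R M N' V n \<Longrightarrow> submodule_chain R M N V (Suc n)"

text \<open>The length of \<open>V / N\<close>, with the value \<open>\<infinity>\<close> when the chains between \<open>N\<close> and \<open>V\<close> are unbounded.
  Working with pairs of submodules avoids iterated quotients.\<close>

definition rel_length ::
  "('a, 'r) ring_scheme \<Rightarrow> ('a, 'v, 'x) module_scheme \<Rightarrow> 'v set \<Rightarrow> 'v set \<Rightarrow> enat" where
  "rel_length R M N V = Sup (enat ` {n. submodule_chain R M N V n})"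

lemma submodule_chain_submodules:
  assumes "submodule_chain R M N V n"
  shows "submodule R N M \<and> submodule R V M \<and> N \<subseteq> V"
  using assms by induction auto

lemma submodule_chain_append:
  assumes "submodule_chain R M N C i" "submodule_chain R M C V j"
  shows "submodule_chain R M N V (i + j)"
  using assms by (induction arbitrary: j) (auto intro: submodule_chain.intros)

lemma submodule_chain_exists:
  assumes "submodule R N M" "submodule R V M" "N \<subseteq> V"
  shows "\<exists>n. submodule_chain R M N V n"
  using assms by (cases "N = V") (auto intro: submodule_chain.intros)

lemma submodule_chain_exists_nontrivial:
  assumes "submodule R N M" "submodule R V M" "N \<subset> V"
  shows "submodule_chain R M N V 1"
  using assms submodule_chain.step[OF assms(1,3) submodule_chain.trivial[OF assms(2)]] by auto

lemma chain_le_rel_length: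
  "submodule_chain R M N V n \<Longrightarrow> enat n \<le> rel_length R M N V"
  unfolding rel_length_def by (rule Sup_upper) auto

lemma rel_length_leI:
  assumes "\<And>n. submodule_chain R M N V n \<Longrightarrow> enat n \<le> L"
  shows "rel_length R M N V \<le> L"
  unfolding rel_length_def using assms by (auto intro: Sup_least)

lemma chain_of_rel_length_ge:
  assumes "submodule R N M" "submodule R V M" "N \<subseteq> V" "enat k \<le> rel_length R M N V"
  shows "\<exists>n\<ge>k. submodule_chain R M N V n"
proof (rule ccontr)
  assume neg: "\<not> ?thesis"
  obtain n0 where "submodule_chain R M N V n0" using submodule_chain_exists assms by blast
  with neg have k: "k > 0" by (metis not_gr0 zero_le)
  have "rel_length R M N V \<le> enat (k - 1)"
  proof (rule rel_length_leI)
    fix n assume "submodule_chain R M N V n"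
    with neg have "n < k" by (meson not_le)
    then show "enat n \<le> enat (k - 1)" by simp
  qed
  with assms(4) have "enat k \<le> enat (k - 1)" by (rule order_trans)
  with k show False by simp
qed

lemma submodule_uminus:
  assumes "submodule R N M" "x \<in> N"
  shows "\<ominus>\<^bsub>M\<^esub> x \<in> N"
proof -
  interpret module R M using assms(1) by (rule submodule.module)
  have "\<ominus>\<^bsub>R\<^esub> \<one>\<^bsub>R\<^esub> \<odot>\<^bsub>M\<^esub> x \<in> N" using assms by (simp add: submodule.smult_closed)
  moreover have "x \<in> carrier M" using assms submodule.subset by blast
  ultimately show ?thesis by (simp add: smult_l_minus)
qed

lemma submodule_minus:
  assumes "submodule R N M" "x \<in> N" "y \<in> N"
  shows "x \<ominus>\<^bsub>M\<^esub> y \<in> N"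
  using assms submodule_uminus[OF assms(1,3)] by (simp add: a_minus_def submodule.m_closed)

lemma submodule_criterion:
  assumes "module R M" "N \<subseteq> carrier M" "\<zero>\<^bsub>M\<^esub> \<in> N"
    "\<And>x y. x \<in> N \<Longrightarrow> y \<in> N \<Longrightarrow> x \<oplus>\<^bsub>M\<^esub> y \<in> N"
    "\<And>r x. r \<in> carrier R \<Longrightarrow> x \<in> N \<Longrightarrow> r \<odot>\<^bsub>M\<^esub> x \<in> N"
  shows "submodule R N M"
  using assms unfolding LinearCombinations.submodule_def by blast

lemma submodule_inter:
  assumes "submodule R N M" "submodule R C M"
  shows "submodule R (N \<inter> C) M"
  using assms by (auto intro!: submodule_criterion simp: submodule.module submodule.zero_closed
      submodule.m_closed submodule.smult_closed dest: submodule.subset[THEN subsetD])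

definition submodule_add :: "('a, 'v, 'x) module_scheme \<Rightarrow> 'v set \<Rightarrow> 'v set \<Rightarrow> 'v set" where
  "submodule_add M N C = {x \<oplus>\<^bsub>M\<^esub> y | x y. x \<in> N \<and> y \<in> C}"

lemma submodule_add_submodule:
  assumes N: "submodule R N M" and C: "submodule R C M"
  shows "submodule R (submodule_add M N C) M"
proof -
  interpret module R M using N by (rule submodule.module)
  have [simp]: "x \<in> N \<Longrightarrow> x \<in> carrier M" "x \<in> C \<Longrightarrow> x \<in> carrier M" for x
    using submodule.subset[OF N] submodule.subset[OF C] by auto
  show ?thesis
  proof (rule submodule_criterion)
    show "module R M" ..
    show "submodule_add M N C \<subseteq> carrier M" by (auto simp: submodule_add_def)
    show "\<zero>\<^bsub>M\<^esub> \<in> submodule_add M N C"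
      using submodule.zero_closed[OF N] submodule.zero_closed[OF C] M.l_zero[OF M.zero_closed]
      unfolding submodule_add_def by force
  next
    fix u v assume "u \<in> submodule_add M N C" "v \<in> submodule_add M N C"
    then obtain x y x' y' where *: "u = x \<oplus>\<^bsub>M\<^esub> y" "v = x' \<oplus>\<^bsub>M\<^esub> y'" "x \<in> N" "x' \<in> N" "y \<in> C" "y' \<in> C"
      by (auto simp: submodule_add_def)
    then have "u \<oplus>\<^bsub>M\<^esub> v = (x \<oplus>\<^bsub>M\<^esub> x') \<oplus>\<^bsub>M\<^esub> (y \<oplus>\<^bsub>M\<^esub> y')" by (simp add: M.a_ac)
    with * show "u \<oplus>\<^bsub>M\<^esub> v \<in> submodule_add M N C"
      using submodule.m_closed[OF N] submodule.m_closed[OF C] unfolding submodule_add_def by blast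
  next
    fix r u assume r: "r \<in> carrier R" and "u \<in> submodule_add M N C"
    then obtain x y where *: "u = x \<oplus>\<^bsub>M\<^esub> y" "x \<in> N" "y \<in> C" by (auto simp: submodule_add_def)
    then have "r \<odot>\<^bsub>M\<^esub> u = r \<odot>\<^bsub>M\<^esub> x \<oplus>\<^bsub>M\<^esub> r \<odot>\<^bsub>M\<^esub> y" using r by (simp add: smult_r_distr)
    moreover have "r \<odot>\<^bsub>M\<^esub> x \<in> N" "r \<odot>\<^bsub>M\<^esub> y \<in> C"
      using * r submodule.smult_closed[OF N] submodule.smult_closed[OF C] by auto
    ultimately show "r \<odot>\<^bsub>M\<^esub> u \<in> submodule_add M N C"
      unfolding submodule_add_def by blast
  qed
qed

lemma submodule_add_mono: "N \<subseteq> N' \<Longrightarrow> submodule_add M N C \<subseteq> submodule_add M N' C"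
  by (auto simp: submodule_add_def)

lemma submodule_add_absorb:
  assumes "submodule R N M" "submodule R C M" "N \<subseteq> C"
  shows "submodule_add M N C = C"
proof -
  interpret module R M using assms(1) by (rule submodule.module)
  show ?thesis
  proof
    show "submodule_add M N C \<subseteq> C"
      using assms(3) submodule.m_closed[OF assms(2)] by (auto simp: submodule_add_def)
    show "C \<subseteq> submodule_add M N C"
    proof
      fix x assume x: "x \<in> C"
      then have "x = \<zero>\<^bsub>M\<^esub> \<oplus>\<^bsub>M\<^esub> x" using submodule.subset[OF assms(2)] by auto
      with x submodule.zero_closed[OF assms(1)] show "x \<in> submodule_add M N C"
        unfolding submodule_add_def by blast
    qed
  qed
qed

lemma submodule_add_upper:
  assumes "submodule R N M" "submodule R C M"
  shows "N \<subseteq> submodule_add M N C"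
proof
  interpret module R M using assms(1) by (rule submodule.module)
  fix x assume x: "x \<in> N"
  then have "x = x \<oplus>\<^bsub>M\<^esub> \<zero>\<^bsub>M\<^esub>" using submodule.subset[OF assms(1)] by auto
  with x submodule.zero_closed[OF assms(2)] show "x \<in> submodule_add M N C"
    unfolding submodule_add_def by blast
qed

lemma submodule_add_commute:
  assumes "submodule R N M" "submodule R C M"
  shows "submodule_add M N C = submodule_add M C N"
proof -
  interpret module R M using assms(1) by (rule submodule.module)
  show ?thesis
    using submodule.subset[OF assms(1)] submodule.subset[OF assms(2)] M.a_comm
    unfolding submodule_add_def by (smt (verit, best) Collect_cong subset_iff)
qed

text \<open>The modular law: a submodule between \<open>N\<close> and \<open>N'\<close> is detected by its trace on \<open>C\<close> and its image
  modulo \<open>C\<close>. It is what makes length additive.\<close>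

lemma submodule_modular:
  assumes N: "submodule R N M" and N': "submodule R N' M" and C: "submodule R C M"
    and "N \<subseteq> N'" "N \<inter> C = N' \<inter> C" "submodule_add M N C = submodule_add M N' C"
  shows "N = N'"
proof
  interpret module R M using N by (rule submodule.module)
  show "N \<subseteq> N'" by fact
  show "N' \<subseteq> N"
  proof
    fix x assume x: "x \<in> N'"
    then have "x \<in> submodule_add M N C" using submodule_add_upper[OF N' C] assms(6) by auto
    then obtain y c where y: "x = y \<oplus>\<^bsub>M\<^esub> c" "y \<in> N" "c \<in> C" by (auto simp: submodule_add_def)
    have carr: "x \<in> carrier M" "y \<in> carrier M" "c \<in> carrier M"
      using x y submodule.subset[OF N] submodule.subset[OF N'] submodule.subset[OF C] by auto
    have "c = x \<ominus>\<^bsub>M\<^esub> y" unfolding y(1) using carr(2,3) by (simp add: a_minus_def M.a_ac M.r_neg1 M.r_neg2 M.r_neg)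
    also have "\<dots> \<in> N'" using x y assms(4) submodule_minus[OF N'] by blast
    finally have "c \<in> N" using y assms(5) by blast
    with y show "x \<in> N" using submodule.m_closed[OF N] by simp
  qed
qed

text \<open>Intersecting a chain with \<open>C\<close> and adding \<open>C\<close> to it produces two chains; by the modular law every
  proper inclusion stays proper in at least one of them.\<close>

lemma submodule_chain_split_aux:
  assumes "submodule_chain R M N V n" and C: "submodule R C M"
  shows "\<exists>i j. n \<le> i + j \<and> submodule_chain R M (N \<inter> C) (V \<inter> C) i \<and>
    submodule_chain R M (submodule_add M N C) (submodule_add M V C) j"
  using assms(1)
proof induction
  case (trivial N)
  then show ?case using C by (auto intro!: exI[of _ 0] submodule_chain.trivial submodule_inter submodule_add_submodule)
next
  case (step N N' V n)
  then obtain i j where ij: "n \<le> i + j" "submodule_chain R M (N' \<inter> C) (V \<inter> C) i"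
    "submodule_chain R M (submodule_add M N' C) (submodule_add M V C) j" by blast
  have N': "submodule R N' M" using step submodule_chain_submodules by blast
  have sub: "N \<inter> C \<subseteq> N' \<inter> C" "submodule_add M N C \<subseteq> submodule_add M N' C"
    using step(2) submodule_add_mono by blast+
  note sms = submodule_inter[OF step(1) C] submodule_add_submodule[OF step(1) C]
  have "N \<inter> C \<noteq> N' \<inter> C \<or> submodule_add M N C \<noteq> submodule_add M N' C"
    using submodule_modular[OF step(1) N' C] step(2) by blast
  then show ?case
  proof
    assume "N \<inter> C \<noteq> N' \<inter> C"
    then have "submodule_chain R M (N \<inter> C) (V \<inter> C) (Suc i)"
      using sub sms ij(2) by (intro submodule_chain.step[where N'="N' \<inter> C"]) auto
    moreover obtain j' where "j \<le> j'" "submodule_chain R M (submodule_add M N C) (submodule_add M V C) j'"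
      using sub(2) ij(3) sms(2) submodule_chain.step[OF sms(2) _ ij(3)] by (metis le_SucI order_refl psubsetI)
    ultimately show ?thesis using ij(1) by (intro exI[of _ "Suc i"] exI[of _ j']) simp
  next
    assume "submodule_add M N C \<noteq> submodule_add M N' C"
    then have "submodule_chain R M (submodule_add M N C) (submodule_add M V C) (Suc j)"
      using sub sms ij(3) by (intro submodule_chain.step[where N'="submodule_add M N' C"]) auto
    moreover obtain i' where "i \<le> i'" "submodule_chain R M (N \<inter> C) (V \<inter> C) i'"
      using sub(1) ij(2) sms(1) submodule_chain.step[OF sms(1) _ ij(2)] by (metis le_SucI order_refl psubsetI)
    ultimately show ?thesis using ij(1) by (intro exI[of _ i'] exI[of _ "Suc j"]) simp
  qed
qed

lemma submodule_chain_split: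
  assumes "submodule_chain R M N V n" "submodule R C M" "N \<subseteq> C" "C \<subseteq> V"
  shows "\<exists>i j. n \<le> i + j \<and> submodule_chain R M N C i \<and> submodule_chain R M C V j"
proof -
  have N: "submodule R N M" and V: "submodule R V M" using submodule_chain_submodules[OF assms(1)] by auto
  have "N \<inter> C = N" "V \<inter> C = C" "submodule_add M N C = C" "submodule_add M V C = V"
    using assms N V submodule_add_absorb submodule_add_commute by blast+
  with submodule_chain_split_aux[OF assms(1,2)] show ?thesis by simp
qed

lemma enat_le_by_nat: assumes "\<And>k. enat k \<le> a \<Longrightarrow> enat k \<le> b" shows "a \<le> b"
proof (cases a)
  case (enat n) then show ?thesis using assms by simp
next
  case infinity
  then have "\<forall>k. enat k \<le> b" using assms by simp
  then have "b = \<infinity>" by (metis Suc_n_not_le_n enat_ord_simps(1) not_enat_eq)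
  then show ?thesis by simp
qed

theorem rel_length_additive:
  assumes N: "submodule R N M" and C: "submodule R C M" and V: "submodule R V M" and "N \<subseteq> C" "C \<subseteq> V"
  shows "rel_length R M N V = rel_length R M N C + rel_length R M C V"
proof (rule antisym)
  show "rel_length R M N V \<le> rel_length R M N C + rel_length R M C V"
  proof (rule rel_length_leI)
    fix n assume "submodule_chain R M N V n"
    then obtain i j where ij: "n \<le> i + j" "submodule_chain R M N C i" "submodule_chain R M C V j"
      using submodule_chain_split assms by blast
    have "enat n \<le> enat i + enat j" using ij(1) by simp
    also have "\<dots> \<le> rel_length R M N C + rel_length R M C V"
      using ij chain_le_rel_length by (blast intro: add_mono)
    finally show "enat n \<le> rel_length R M N C + rel_length R M C V" .
  qed
  have ext: "enat i + enat j \<le> rel_length R M N V"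
    if le: "enat i \<le> rel_length R M N C" "enat j \<le> rel_length R M C V" for i j
  proof -
    obtain i' where i': "i \<le> i'" "submodule_chain R M N C i'"
      using chain_of_rel_length_ge[OF N C assms(4) le(1)] by blast
    obtain j' where j': "j \<le> j'" "submodule_chain R M C V j'"
      using chain_of_rel_length_ge[OF C V assms(5) le(2)] by blast
    have "enat i + enat j \<le> enat (i' + j')" using i' j' by simp
    also have "\<dots> \<le> rel_length R M N V"
      using chain_le_rel_length[OF submodule_chain_append[OF i'(2) j'(2)]] .
    finally show ?thesis .
  qed
  show "rel_length R M N C + rel_length R M C V \<le> rel_length R M N V"
  proof (rule enat_le_by_nat)
    fix k assume k: "enat k \<le> rel_length R M N C + rel_length R M C V"
    show "enat k \<le> rel_length R M N V"
    proof (cases "rel_length R M N C")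
      case infinity
      then show ?thesis using ext[of k 0] by (simp add: zero_enat_def[symmetric])
    next
      case i: (enat i)
      show ?thesis
      proof (cases "rel_length R M C V")
        case infinity
        then show ?thesis using ext[of 0 k] by (simp add: zero_enat_def[symmetric])
      next
        case (enat j)
        then have "enat k \<le> enat i + enat j" using i k by simp
        also have "\<dots> \<le> rel_length R M N V" using ext[of i j] i enat by simp
        finally show ?thesis .
      qed
    qed
  qed
qed

lemma rel_length_refl:
  assumes "submodule R N M"
  shows "rel_length R M N N = 0"
proof -
  have "n = 0" if "submodule_chain R M N N n" for n
    using that by cases (use submodule_chain_submodules in blast)+
  then have "rel_length R M N N \<le> 0" by (intro rel_length_leI) (auto simp: zero_enat_def)
  then show ?thesis by simp
qed

lemma rel_length_pos:
  assumes "submodule R N M" "submodule R V M" "N \<subset> V"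
  shows "1 \<le> rel_length R M N V"
  using chain_le_rel_length[OF submodule_chain_exists_nontrivial[OF assms]] by (simp add: one_enat_def)

lemma rel_length_mono:
  assumes "submodule R N M" "submodule R V M" "submodule R V' M" "N \<subseteq> V" "V \<subseteq> V'"
  shows "rel_length R M N V \<le> rel_length R M N V'"
  using rel_length_additive[OF assms] by simp


text \<open>An additive map \<open>g\<close> from \<open>V\<close> to \<open>V'\<close> with \<open>g\<^sup>-\<^sup>1(N') = N\<close> pushes chains of submodules forward, even if
  the modules live over different rings \<open>A\<close> and \<open>B\<close>: all that matters is that modulo \<open>N'\<close> each
  scalar of \<open>B\<close> acts on the image of \<open>g\<close> like some scalar of \<open>A\<close>. This is how lengths over
  \<open>R(I)\<^sub>a\<^sub>,\<^sub>b\<close> are compared with lengths over \<open>R\<close>.\<close>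

lemma rel_length_transfer_le:
  assumes N: "submodule A N M" and V: "submodule A V M" and "N \<subseteq> V"
    and N': "submodule B N' M'" and V': "submodule B V' M'"
    and g: "\<And>x. x \<in> V \<Longrightarrow> g x \<in> V'"
    and g_add: "\<And>x y. x \<in> V \<Longrightarrow> y \<in> V \<Longrightarrow> g (x \<oplus>\<^bsub>M\<^esub> y) = g x \<oplus>\<^bsub>M'\<^esub> g y"
    and g_ker: "\<And>x. x \<in> V \<Longrightarrow> g x \<in> N' \<longleftrightarrow> x \<in> N"
    and "N' \<subseteq> V'"
    and g_scal: "\<And>s. s \<in> carrier B \<Longrightarrow> \<exists>r\<in>carrier A. \<forall>x\<in>V. \<exists>d\<in>N'. s \<odot>\<^bsub>M'\<^esub> g x = g (r \<odot>\<^bsub>M\<^esub> x) \<oplus>\<^bsub>M'\<^esub> d"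
  shows "rel_length A M N V \<le> rel_length B M' N' V'"
proof -
  interpret M: module A M using N by (rule submodule.module)
  interpret M': module B M' using N' by (rule submodule.module)
  have V_carr: "x \<in> carrier M" if "x \<in> V" for x using that submodule.subset[OF V] by blast
  have g_carr: "g x \<in> carrier M'" if "x \<in> V" for x using that g submodule.subset[OF V'] by blast
  have N'_carr: "x \<in> carrier M'" if "x \<in> N'" for x using that submodule.subset[OF N'] by blast
  define G where "G L = {g x \<oplus>\<^bsub>M'\<^esub> d | x d. x \<in> L \<and> d \<in> N'}" for L
  have G_sub: "submodule B (G L) M'" if L: "submodule A L M" "L \<subseteq> V" for L
  proof (rule submodule_criterion)
    show "module B M'" ..
    show "G L \<subseteq> carrier M'" using g_carr N'_carr L(2) by (auto simp: G_def)
    have "g \<zero>\<^bsub>M\<^esub> \<in> N'"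
      using g_ker submodule.zero_closed[OF N] submodule.zero_closed[OF V] by blast
    then have "g \<zero>\<^bsub>M\<^esub> \<oplus>\<^bsub>M'\<^esub> \<ominus>\<^bsub>M'\<^esub> g \<zero>\<^bsub>M\<^esub> \<in> G L"
      unfolding G_def using submodule.zero_closed[OF L(1)] submodule_uminus[OF N'] by blast
    then show "\<zero>\<^bsub>M'\<^esub> \<in> G L"
      using g_carr[OF submodule.zero_closed[OF V]] by (simp add: M'.M.r_neg)
  next
    fix u v assume "u \<in> G L" "v \<in> G L"
    then obtain x d y e where *: "u = g x \<oplus>\<^bsub>M'\<^esub> d" "v = g y \<oplus>\<^bsub>M'\<^esub> e" "x \<in> L" "y \<in> L" "d \<in> N'" "e \<in> N'"
      by (auto simp: G_def)
    have "u \<oplus>\<^bsub>M'\<^esub> v = g (x \<oplus>\<^bsub>M\<^esub> y) \<oplus>\<^bsub>M'\<^esub> (d \<oplus>\<^bsub>M'\<^esub> e)"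
      using * L(2) g_add[of x y] g_carr[of x] g_carr[of y] N'_carr[of d] N'_carr[of e]
      by (simp add: subset_iff M'.M.a_ac)
    then show "u \<oplus>\<^bsub>M'\<^esub> v \<in> G L"
      unfolding G_def using * submodule.m_closed[OF L(1)] submodule.m_closed[OF N'] by blast
  next
    fix s u assume s: "s \<in> carrier B" and "u \<in> G L"
    then obtain x d where *: "u = g x \<oplus>\<^bsub>M'\<^esub> d" "x \<in> L" "d \<in> N'" by (auto simp: G_def)
    obtain r e where r: "r \<in> carrier A" and e: "e \<in> N'" "s \<odot>\<^bsub>M'\<^esub> g x = g (r \<odot>\<^bsub>M\<^esub> x) \<oplus>\<^bsub>M'\<^esub> e"
      using g_scal[OF s] * L(2) by blast
    have rx: "r \<odot>\<^bsub>M\<^esub> x \<in> L" using r * submodule.smult_closed[OF L(1)] by blast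
    have "s \<odot>\<^bsub>M'\<^esub> u = g (r \<odot>\<^bsub>M\<^esub> x) \<oplus>\<^bsub>M'\<^esub> (e \<oplus>\<^bsub>M'\<^esub> s \<odot>\<^bsub>M'\<^esub> d)"
      using * e s rx L(2) g_carr[of x] g_carr[of "r \<odot>\<^bsub>M\<^esub> x"] N'_carr[of d] N'_carr[of e]
      by (simp add: subset_iff M'.M.a_ac M'.smult_r_distr)
    then show "s \<odot>\<^bsub>M'\<^esub> u \<in> G L"
      unfolding G_def using rx e * s submodule.m_closed[OF N'] submodule.smult_closed[OF N'] by blast
  qed
  have G_strict: "G L \<subset> G L'" if L: "submodule A L M" "N \<subseteq> L" "L \<subset> L'" "L' \<subseteq> V" for L L'
  proof -
    obtain x where x: "x \<in> L'" "x \<notin> L" using L(3) by blast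
    have xV: "x \<in> V" using x L by blast
    have "g x \<oplus>\<^bsub>M'\<^esub> \<zero>\<^bsub>M'\<^esub> \<in> G L'" using x submodule.zero_closed[OF N'] unfolding G_def by blast
    then have "g x \<in> G L'" using g_carr xV by simp
    moreover have "g x \<notin> G L"
    proof
      assume "g x \<in> G L"
      then obtain y d where y: "g x = g y \<oplus>\<^bsub>M'\<^esub> d" "y \<in> L" "d \<in> N'" by (auto simp: G_def)
      have yV: "y \<in> V" using y L by blast
      have xy: "x \<ominus>\<^bsub>M\<^esub> y \<in> V" using submodule_minus[OF V] xV yV by blast
      have "x = (x \<ominus>\<^bsub>M\<^esub> y) \<oplus>\<^bsub>M\<^esub> y"
        using V_carr[OF xV] V_carr[OF yV] by (simp add: a_minus_def M.M.a_assoc M.M.l_neg)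
      then have "g x = g (x \<ominus>\<^bsub>M\<^esub> y) \<oplus>\<^bsub>M'\<^esub> g y" using g_add[OF xy yV] by simp
      then have "g y \<oplus>\<^bsub>M'\<^esub> g (x \<ominus>\<^bsub>M\<^esub> y) = g y \<oplus>\<^bsub>M'\<^esub> d"
        using y g_carr[OF yV] g_carr[OF xy] by (simp add: M'.M.a_comm)
      then have "g (x \<ominus>\<^bsub>M\<^esub> y) = d"
        using y g_carr[OF yV] g_carr[OF xy] N'_carr by simp
      then have "x \<ominus>\<^bsub>M\<^esub> y \<in> L" using y(3) g_ker[OF xy] L(2) by blast
      then have "(x \<ominus>\<^bsub>M\<^esub> y) \<oplus>\<^bsub>M\<^esub> y \<in> L" using y(2) submodule.m_closed[OF L(1)] by blast
      with x \<open>x = (x \<ominus>\<^bsub>M\<^esub> y) \<oplus>\<^bsub>M\<^esub> y\<close> show False by simp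
    qed
    moreover have "G L \<subseteq> G L'" using L unfolding G_def by blast
    ultimately show ?thesis by blast
  qed
  have chain: "submodule_chain B M' (G L) (G V) n" if "submodule_chain A M L W n" "W = V" "N \<subseteq> L" for L W n
    using that
  proof (induction rule: submodule_chain.induct)
    case (trivial L)
    then show ?case using G_sub by (auto intro: submodule_chain.trivial)
  next
    case (step L L' W n)
    have "L' \<subseteq> V" using submodule_chain_submodules[OF step(3)] step by blast
    then show ?case using step G_sub[of L] G_strict[of L L'] by (intro submodule_chain.step[of _ _ _ "G L'"]) auto
  qed
  have GN: "G N = N'"
  proof
    show "G N \<subseteq> N'"
      using g_ker assms(3) submodule.m_closed[OF N'] by (auto simp: G_def)
    show "N' \<subseteq> G N"
    proof
      fix d assume d: "d \<in> N'"
      let ?z = "g \<zero>\<^bsub>M\<^esub>"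
      have z: "?z \<in> N'" using g_ker submodule.zero_closed[OF N] submodule.zero_closed[OF V] by blast
      have "d = ?z \<oplus>\<^bsub>M'\<^esub> (d \<ominus>\<^bsub>M'\<^esub> ?z)"
        using N'_carr[OF d] N'_carr[OF z] by (simp add: a_minus_def M'.M.a_ac M'.M.r_neg1 M'.M.r_neg2 M'.M.r_neg)
      then show "d \<in> G N"
        unfolding G_def using submodule.zero_closed[OF N] submodule_minus[OF N' d z] by blast
    qed
  qed
  have "G V \<subseteq> V'" using g assms(9) submodule.m_closed[OF V'] by (auto simp: G_def)
  moreover have "N' \<subseteq> G V" using GN assms(3) unfolding G_def by blast
  ultimately have "rel_length B M' N' (G V) \<le> rel_length B M' N' V'"
    using rel_length_mono[OF N' G_sub[OF V] V'] by simp
  moreover have "rel_length A M N V \<le> rel_length B M' N' (G V)"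
    using chain[of N] GN chain_le_rel_length by (intro rel_length_leI) fastforce
  ultimately show ?thesis by simp
qed

text \<open>The converse comparison pulls chains back; for this \<open>g\<close> has to be onto modulo \<open>N'\<close>, and each scalar
  of \<open>A\<close> has to act on the image like some scalar of \<open>B\<close>.\<close>

lemma rel_length_transfer_ge:
  assumes N: "submodule A N M" and V: "submodule A V M"
    and N': "submodule B N' M'" and V': "submodule B V' M'" and "N' \<subseteq> V'"
    and g: "\<And>x. x \<in> V \<Longrightarrow> g x \<in> V'"
    and g_add: "\<And>x y. x \<in> V \<Longrightarrow> y \<in> V \<Longrightarrow> g (x \<oplus>\<^bsub>M\<^esub> y) = g x \<oplus>\<^bsub>M'\<^esub> g y"
    and g_ker: "\<And>x. x \<in> V \<Longrightarrow> g x \<in> N' \<longleftrightarrow> x \<in> N" and "N \<subseteq> V"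
    and g_surj: "\<And>y. y \<in> V' \<Longrightarrow> \<exists>x\<in>V. \<exists>d\<in>N'. y = g x \<oplus>\<^bsub>M'\<^esub> d"
    and g_scal: "\<And>r. r \<in> carrier A \<Longrightarrow> \<exists>s\<in>carrier B. \<forall>x\<in>V. \<exists>d\<in>N'. g (r \<odot>\<^bsub>M\<^esub> x) = s \<odot>\<^bsub>M'\<^esub> g x \<oplus>\<^bsub>M'\<^esub> d"
  shows "rel_length B M' N' V' \<le> rel_length A M N V"
proof -
  interpret M: module A M using N by (rule submodule.module)
  interpret M': module B M' using N' by (rule submodule.module)
  define P where "P L = {x \<in> V. g x \<in> L}" for L
  have P_sub: "submodule A (P L) M" if L: "submodule B L M'" "N' \<subseteq> L" for L
  proof (rule submodule_criterion)
    show "module A M" ..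
    show "P L \<subseteq> carrier M" using submodule.subset[OF V] by (auto simp: P_def)
    show "\<zero>\<^bsub>M\<^esub> \<in> P L"
      using submodule.zero_closed[OF N] submodule.zero_closed[OF V] g_ker L(2) by (auto simp: P_def)
  next
    fix x y assume "x \<in> P L" "y \<in> P L"
    then show "x \<oplus>\<^bsub>M\<^esub> y \<in> P L"
      using g_add submodule.m_closed[OF V] submodule.m_closed[OF L(1)] by (auto simp: P_def)
  next
    fix r x assume r: "r \<in> carrier A" and "x \<in> P L"
    then have x: "x \<in> V" "g x \<in> L" by (auto simp: P_def)
    obtain s d where "s \<in> carrier B" "d \<in> N'" "g (r \<odot>\<^bsub>M\<^esub> x) = s \<odot>\<^bsub>M'\<^esub> g x \<oplus>\<^bsub>M'\<^esub> d"
      using g_scal[OF r] x by blast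
    then show "r \<odot>\<^bsub>M\<^esub> x \<in> P L"
      using x r L(2) submodule.smult_closed[OF V] submodule.m_closed[OF L(1)] submodule.smult_closed[OF L(1)]
      by (auto simp: P_def)
  qed
  have P_strict: "P L \<subset> P L'" if L: "submodule B L M'" "submodule B L' M'" "N' \<subseteq> L" "L \<subset> L'" "L' \<subseteq> V'" for L L'
  proof -
    obtain y where y: "y \<in> L'" "y \<notin> L" using L by blast
    obtain x d where x: "x \<in> V" "d \<in> N'" "y = g x \<oplus>\<^bsub>M'\<^esub> d" using g_surj y L by blast
    have "g x \<in> carrier M'" "d \<in> carrier M'"
      using x g submodule.subset[OF V'] submodule.subset[OF N'] by blast+
    then have "g x = y \<ominus>\<^bsub>M'\<^esub> d" unfolding x(3) by (simp add: a_minus_def M'.M.a_assoc M'.M.r_neg)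
    then have "g x \<in> L'" using y x(2) L submodule_minus[OF L(2)] by auto
    moreover have "g x \<notin> L"
      using y(2) x(2,3) L(3) submodule.m_closed[OF L(1)] by blast
    ultimately have "x \<in> P L'" "x \<notin> P L" using x by (auto simp: P_def)
    then show ?thesis using L by (auto simp: P_def)
  qed
  have chain: "submodule_chain A M (P L) (P V') n" if "submodule_chain B M' L W n" "W = V'" "N' \<subseteq> L" for L W n
    using that
  proof (induction rule: submodule_chain.induct)
    case (trivial L)
    then show ?case using P_sub by (auto intro: submodule_chain.trivial)
  next
    case (step L L' W n)
    have "submodule B L' M'" "L' \<subseteq> V'" using submodule_chain_submodules[OF step(3)] step by blast+
    then show ?case using step P_sub[of L] P_strict[of L L'] by (intro submodule_chain.step[of _ _ _ "P L'"]) auto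
  qed
  have "P V' = V" using g by (auto simp: P_def)
  moreover have "P N' = N" using g_ker \<open>N \<subseteq> V\<close> by (auto simp: P_def)
  ultimately show ?thesis
    using chain[of N'] chain_le_rel_length by (intro rel_length_leI) fastforce
qed

lemma (in cring) maximalideal_unit_mod:
  assumes "maximalideal \<mm> R" "a \<in> carrier R" "a \<notin> \<mm>"
  shows "\<exists>b\<in>carrier R. \<exists>c\<in>\<mm>. \<one> = b \<otimes> a \<oplus> c"
proof -
  interpret m: maximalideal \<mm> R by fact
  let ?J = "PIdl a <+>\<^bsub>R\<^esub> \<mm>"
  have J: "ideal ?J R" using add_ideals[OF cgenideal_ideal[OF assms(2)] m.ideal_axioms] .
  have a: "a \<in> PIdl a" using cgenideal_self[OF assms(2)] .
  have "a \<oplus> \<zero> \<in> ?J" using a m.zero_closed unfolding set_add_def' by blast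
  then have aJ: "a \<in> ?J" using assms(2) by simp
  have "\<mm> \<subseteq> ?J"
  proof
    fix x assume x: "x \<in> \<mm>"
    have "\<zero> \<in> PIdl a" using cgenideal_ideal[OF assms(2)] by (simp add: additive_subgroup.zero_closed ideal.axioms(1))
    then have "\<zero> \<oplus> x \<in> ?J" using x unfolding set_add_def' by blast
    then show "x \<in> ?J" using x m.Icarr by simp
  qed
  then have "?J = carrier R"
    using m.I_maximal[OF J] aJ assms(3) ideal.Icarr[OF J] by blast
  then have "\<one> \<in> ?J" by simp
  then show ?thesis unfolding set_add_def' cgenideal_def by blast
qed

definition cyclic_submodule :: "('a, 'r) ring_scheme \<Rightarrow> ('a, 'v, 'x) module_scheme \<Rightarrow> 'v \<Rightarrow> 'v set" where
  "cyclic_submodule R M z = (\<lambda>a. a \<odot>\<^bsub>M\<^esub> z) ` carrier R"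

context module begin

lemma cyclic_submodule_submodule:
  assumes "z \<in> carrier M"
  shows "submodule R (cyclic_submodule R M z) M"
proof (rule submodule_criterion)
  show "module R M" ..
  show "cyclic_submodule R M z \<subseteq> carrier M" using assms by (auto simp: cyclic_submodule_def)
  show "\<zero>\<^bsub>M\<^esub> \<in> cyclic_submodule R M z"
    using assms unfolding cyclic_submodule_def by (intro image_eqI[of _ _ "\<zero>"]) auto
next
  fix u v assume "u \<in> cyclic_submodule R M z" "v \<in> cyclic_submodule R M z"
  then show "u \<oplus>\<^bsub>M\<^esub> v \<in> cyclic_submodule R M z"
    using assms by (auto simp: cyclic_submodule_def smult_l_distr[symmetric])
next
  fix r u assume "r \<in> carrier R" "u \<in> cyclic_submodule R M z"
  then show "r \<odot>\<^bsub>M\<^esub> u \<in> cyclic_submodule R M z"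
    using assms by (auto simp: cyclic_submodule_def smult_assoc1[symmetric])
qed

lemma self_in_cyclic_submodule: "z \<in> carrier M \<Longrightarrow> z \<in> cyclic_submodule R M z"
  unfolding cyclic_submodule_def by (rule image_eqI[of _ _ "\<one>"]) auto

text \<open>The quotient of \<open>N + R z\<close> by \<open>N\<close> is a nonzero cyclic module killed by the maximal ideal \<open>\<mm>\<close>, so it is
  simple: outside \<open>\<mm>\<close> every scalar is invertible modulo \<open>\<mm>\<close>.\<close>

lemma rel_length_simple_step:
  assumes m: "maximalideal \<mm> R" and N: "submodule R N M" and z: "z \<in> carrier M" "z \<notin> N"
    and mz: "\<And>a. a \<in> \<mm> \<Longrightarrow> a \<odot>\<^bsub>M\<^esub> z \<in> N"
  shows "rel_length R M N (submodule_add M N (cyclic_submodule R M z)) = 1" (is "rel_length R M N ?V = 1")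
proof (rule antisym)
  note Z = cyclic_submodule_submodule[OF z(1)]
  note V = submodule_add_submodule[OF N Z]
  have "z \<in> ?V" using self_in_cyclic_submodule[OF z(1)] submodule_add_upper[OF Z N]
    submodule_add_commute[OF N Z] by blast
  then have "N \<subset> ?V" using submodule_add_upper[OF N Z] z by blast
  then show "1 \<le> rel_length R M N ?V" using rel_length_pos[OF N V] by simp
  have top: "L = ?V" if L: "submodule R L M" "N \<subset> L" "L \<subseteq> ?V" for L
  proof -
    obtain y where y: "y \<in> L" "y \<notin> N" using L by blast
    then obtain n a where na: "y = n \<oplus>\<^bsub>M\<^esub> a \<odot>\<^bsub>M\<^esub> z" "n \<in> N" "a \<in> carrier R"
      using L(3) unfolding submodule_add_def cyclic_submodule_def by blast
    have "a \<notin> \<mm>" using na y mz submodule.m_closed[OF N] by blast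
    then obtain b c where bc: "b \<in> carrier R" "c \<in> \<mm>" "\<one> = b \<otimes> a \<oplus> c"
      using maximalideal_unit_mod[OF m na(3)] by blast
    have c: "c \<in> carrier R" using bc m by (meson ideal.Icarr maximalideal.axioms(1))
    have nc: "n \<in> carrier M" using na submodule.subset[OF N] by blast
    have "a \<odot>\<^bsub>M\<^esub> z = y \<ominus>\<^bsub>M\<^esub> n"
      unfolding na(1) using nc na(3) z(1) by (simp add: a_minus_def M.a_ac M.r_neg1 M.r_neg2 M.r_neg)
    then have az: "a \<odot>\<^bsub>M\<^esub> z \<in> L" using submodule_minus[OF L(1)] y na(2) L(2) by auto
    have "z = (b \<otimes> a \<oplus> c) \<odot>\<^bsub>M\<^esub> z" using bc(3)[symmetric] z by simp
    also have "\<dots> = b \<odot>\<^bsub>M\<^esub> (a \<odot>\<^bsub>M\<^esub> z) \<oplus>\<^bsub>M\<^esub> c \<odot>\<^bsub>M\<^esub> z"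
      using bc(1) c na(3) z by (simp add: smult_l_distr smult_assoc1)
    also have "\<dots> \<in> L"
      using az bc mz[OF bc(2)] L(2) submodule.m_closed[OF L(1)] submodule.smult_closed[OF L(1)] by blast
    finally have "z \<in> L" .
    then have "?V \<subseteq> L"
      using L(2) submodule.m_closed[OF L(1)] submodule.smult_closed[OF L(1)]
      by (auto simp: submodule_add_def cyclic_submodule_def)
    with L show ?thesis by blast
  qed
  show "rel_length R M N ?V \<le> 1"
  proof (rule rel_length_leI)
    fix n assume "submodule_chain R M N ?V n"
    then show "enat n \<le> 1"
    proof cases
      case trivial
      then show ?thesis by (simp add: zero_enat_def[symmetric])
    next
      case (step N' k)
      have "N' = ?V" using top[of N'] step submodule_chain_submodules[OF step(4)] by blast
      then have "enat k \<le> 0"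
        using chain_le_rel_length[OF step(4)] rel_length_refl[OF V] by simp
      then show ?thesis using step by (simp add: zero_enat_def one_enat_def)
    qed
  qed
qed

end

section \<open>Dimension over the residue field\<close>

lemma submodule_abelian_subgroup:
  assumes "submodule R N M"
  shows "abelian_subgroup N M"
proof -
  interpret module R M using assms by (rule submodule.module)
  have "subgroup N (add_monoid M)"
    using assms submodule_uminus[OF assms] submodule.subset[OF assms]
    by (auto simp: subgroup_def submodule.m_closed submodule.zero_closed a_inv_def)
  then show ?thesis
    by (intro abelian_subgroupI3 additive_subgroup.intro M.abelian_group_axioms)
qed

lemma coset_eq_iff:
  assumes N: "submodule R N M" and x: "x \<in> carrier M" and y: "y \<in> carrier M"
  shows "N +>\<^bsub>M\<^esub> x = N +>\<^bsub>M\<^esub> y \<longleftrightarrow> x \<ominus>\<^bsub>M\<^esub> y \<in> N"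
proof -
  interpret abelian_subgroup N M by (rule submodule_abelian_subgroup[OF N])
  show ?thesis
    using a_rcos_module[OF y x] a_rcos_self[OF x] a_repr_independence'[OF _ y, of x]
    by (auto simp: a_minus_def)
qed

lemma carrier_update_coset: "N +>\<^bsub>M\<lparr>carrier := V\<rparr>\<^esub> x = N +>\<^bsub>M\<^esub> x"
  by (simp add: a_r_coset_def')

lemma set_add_carrier_update: "set_add (M\<lparr>carrier := V\<rparr>) = set_add M"
  by (intro ext) (simp add: set_add_def')

lemma quot_module_simps:
  "carrier (quot_module M N) = a_rcosets\<^bsub>M\<^esub> N"
  "ring.zero (quot_module M N) = N"
  "ring.add (quot_module M N) = set_add M"
  "module.smult (quot_module M N) r S = (\<Union>x\<in>S. N +>\<^bsub>M\<^esub> (r \<odot>\<^bsub>M\<^esub> x))"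
  by (simp_all add: quot_module_def)

lemma quot_module_carrier:
  "carrier (quot_module (M\<lparr>carrier := V\<rparr>) N) = (\<lambda>x. N +>\<^bsub>M\<^esub> x) ` V"
  by (auto simp: quot_module_simps A_RCOSETS_def' carrier_update_coset)

lemma quot_module_add:
  assumes "submodule R N M" "x \<in> carrier M" "y \<in> carrier M"
  shows "(N +>\<^bsub>M\<^esub> x) \<oplus>\<^bsub>quot_module (M\<lparr>carrier := V\<rparr>) N\<^esub> (N +>\<^bsub>M\<^esub> y) = N +>\<^bsub>M\<^esub> (x \<oplus>\<^bsub>M\<^esub> y)"
  using abelian_subgroup.a_rcos_sum[OF submodule_abelian_subgroup[OF assms(1)] assms(2,3)]
  by (simp add: quot_module_simps set_add_carrier_update)

lemma quot_module_smult:
  assumes N: "submodule R N M" and r: "r \<in> carrier R" and x: "x \<in> carrier M"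
  shows "r \<odot>\<^bsub>quot_module (M\<lparr>carrier := V\<rparr>) N\<^esub> (N +>\<^bsub>M\<^esub> x) = N +>\<^bsub>M\<^esub> (r \<odot>\<^bsub>M\<^esub> x)"
proof -
  interpret module R M using N by (rule submodule.module)
  interpret S: abelian_subgroup N M by (rule submodule_abelian_subgroup[OF N])
  have "N +>\<^bsub>M\<^esub> (r \<odot>\<^bsub>M\<^esub> y) = N +>\<^bsub>M\<^esub> (r \<odot>\<^bsub>M\<^esub> x)" if y: "y \<in> N +>\<^bsub>M\<^esub> x" for y
  proof -
    have yc: "y \<in> carrier M" using y x S.a_subset unfolding a_r_coset_def' by auto
    have "y \<ominus>\<^bsub>M\<^esub> x \<in> N" using S.a_rcos_module[OF x yc] y by (simp add: a_minus_def)
    then have "r \<odot>\<^bsub>M\<^esub> (y \<ominus>\<^bsub>M\<^esub> x) \<in> N" using submodule.smult_closed[OF N] r by blast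
    also have "r \<odot>\<^bsub>M\<^esub> (y \<ominus>\<^bsub>M\<^esub> x) = r \<odot>\<^bsub>M\<^esub> y \<ominus>\<^bsub>M\<^esub> r \<odot>\<^bsub>M\<^esub> x"
      using r yc x by (simp add: a_minus_def smult_r_distr smult_r_minus)
    finally show ?thesis using coset_eq_iff[OF N] r yc x by simp
  qed
  then have "(\<Union>y\<in>N +>\<^bsub>M\<^esub> x. N +>\<^bsub>M\<^esub> (r \<odot>\<^bsub>M\<^esub> y)) = N +>\<^bsub>M\<^esub> (r \<odot>\<^bsub>M\<^esub> x)"
    using S.a_rcos_self[OF x] by blast
  then show ?thesis by (simp add: quot_module_simps carrier_update_coset)
qed

lemma submodule_coset_zero: "submodule R N M \<Longrightarrow> N +>\<^bsub>M\<^esub> \<zero>\<^bsub>M\<^esub> = N"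
proof -
  assume N: "submodule R N M"
  interpret module R M using N by (rule submodule.module)
  show ?thesis using submodule.subset[OF N] by (auto simp: a_r_coset_def' subset_iff)
qed

lemma quot_module_module:
  assumes N: "submodule R N M" and V: "submodule R V M" and "N \<subseteq> V"
  shows "module R (quot_module (M\<lparr>carrier := V\<rparr>) N)" (is "module R ?Q")
proof -
  interpret module R M using N by (rule submodule.module)
  note c = quot_module_carrier[where M=M and V=V and N=N]
  have V_carr: "x \<in> V \<Longrightarrow> x \<in> carrier M" for x using submodule.subset[OF V] by blast
  note add = quot_module_add[OF N V_carr V_carr, where V=V]
  note smult = quot_module_smult[OF N _ V_carr, where V=V]
  note Vc = submodule.m_closed[OF V] submodule.smult_closed[OF V]
  have zero: "\<zero>\<^bsub>?Q\<^esub> = N +>\<^bsub>M\<^esub> \<zero>\<^bsub>M\<^esub>" using submodule_coset_zero[OF N] by (simp add: quot_module_simps)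
  have z: "\<zero>\<^bsub>M\<^esub> \<in> V" by (rule submodule.zero_closed[OF V])
  show ?thesis
  proof (rule moduleI)
    show "cring R" ..
    show "abelian_group ?Q"
    proof (rule abelian_groupI)
      fix u v assume "u \<in> carrier ?Q" "v \<in> carrier ?Q"
      then show "u \<oplus>\<^bsub>?Q\<^esub> v \<in> carrier ?Q" "u \<oplus>\<^bsub>?Q\<^esub> v = v \<oplus>\<^bsub>?Q\<^esub> u"
        unfolding c using Vc V_carr by (auto simp: add M.a_comm)
    next
      show "\<zero>\<^bsub>?Q\<^esub> \<in> carrier ?Q" unfolding c zero using z by blast
    next
      fix u v w assume "u \<in> carrier ?Q" "v \<in> carrier ?Q" "w \<in> carrier ?Q"
      then show "u \<oplus>\<^bsub>?Q\<^esub> v \<oplus>\<^bsub>?Q\<^esub> w = u \<oplus>\<^bsub>?Q\<^esub> (v \<oplus>\<^bsub>?Q\<^esub> w)"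
        unfolding c using Vc V_carr by (auto simp: add M.a_assoc)
    next
      fix u assume "u \<in> carrier ?Q"
      then obtain x where x: "x \<in> V" "u = N +>\<^bsub>M\<^esub> x" unfolding c by blast
      then show "\<zero>\<^bsub>?Q\<^esub> \<oplus>\<^bsub>?Q\<^esub> u = u" unfolding zero using V_carr z by (simp add: add)
      have "(N +>\<^bsub>M\<^esub> (\<ominus>\<^bsub>M\<^esub> x)) \<oplus>\<^bsub>?Q\<^esub> u = \<zero>\<^bsub>?Q\<^esub>"
        using x submodule_uminus[OF V] V_carr by (simp add: add zero M.l_neg)
      then show "\<exists>v\<in>carrier ?Q. v \<oplus>\<^bsub>?Q\<^esub> u = \<zero>\<^bsub>?Q\<^esub>"
        unfolding c using x submodule_uminus[OF V] by blast
    qed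
  qed (unfold c, use Vc V_carr in \<open>auto simp: add smult smult_l_distr smult_r_distr smult_assoc1\<close>)
qed

lemma quot_ring_simps:
  "carrier (R Quot J) = a_rcosets\<^bsub>R\<^esub> J" "ring.zero (R Quot J) = J" "monoid.one (R Quot J) = J +>\<^bsub>R\<^esub> \<one>\<^bsub>R\<^esub>"
  "ring.add (R Quot J) = set_add R" "monoid.mult (R Quot J) = rcoset_mult R J"
  by (simp_all add: FactRing_def)

lemma residue_space_simps:
  "carrier (residue_space R V) = carrier V" "ring.zero (residue_space R V) = ring.zero V"
  "ring.add (residue_space R V) = ring.add V"
  "module.smult (residue_space R V) S v = the_elem ((\<lambda>r. r \<odot>\<^bsub>V\<^esub> v) ` S)"
  by (simp_all add: residue_space_def)

lemma residue_space_vectorspace: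
  assumes V: "module R V" and m: "maximalideal \<mm> R"
    and ann: "\<And>a v. a \<in> \<mm> \<Longrightarrow> v \<in> carrier V \<Longrightarrow> a \<odot>\<^bsub>V\<^esub> v = \<zero>\<^bsub>V\<^esub>"
  shows "vectorspace (R Quot \<mm>) (residue_space R V)"
    and "\<And>r v. r \<in> carrier R \<Longrightarrow> v \<in> carrier V \<Longrightarrow> (\<mm> +>\<^bsub>R\<^esub> r) \<odot>\<^bsub>residue_space R V\<^esub> v = r \<odot>\<^bsub>V\<^esub> v"
proof -
  interpret module R V by fact
  interpret m: maximalideal \<mm> R by fact
  show smult: "(\<mm> +>\<^bsub>R\<^esub> r) \<odot>\<^bsub>residue_space R V\<^esub> v = r \<odot>\<^bsub>V\<^esub> v" if "r \<in> carrier R" "v \<in> carrier V" for r v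
  proof -
    have "s \<odot>\<^bsub>V\<^esub> v = r \<odot>\<^bsub>V\<^esub> v" if "s \<in> \<mm> +>\<^bsub>R\<^esub> r" for s
    proof -
      obtain a where a: "a \<in> \<mm>" "s = a \<oplus>\<^bsub>R\<^esub> r" using \<open>s \<in> \<mm> +>\<^bsub>R\<^esub> r\<close> unfolding a_r_coset_def' by blast
      then show ?thesis
        using ann[OF a(1)] \<open>r \<in> carrier R\<close> \<open>v \<in> carrier V\<close> m.Icarr by (simp add: smult_l_distr)
    qed
    moreover have "r \<in> \<mm> +>\<^bsub>R\<^esub> r" using m.a_rcos_self that by blast
    ultimately have "(\<lambda>s. s \<odot>\<^bsub>V\<^esub> v) ` (\<mm> +>\<^bsub>R\<^esub> r) = {r \<odot>\<^bsub>V\<^esub> v}" by blast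
    then show ?thesis by (simp add: residue_space_simps)
  qed
  have fld: "field (R Quot \<mm>)" using m.quotient_is_field R.is_cring by blast
  have carrK: "carrier (R Quot \<mm>) = (\<lambda>r. \<mm> +>\<^bsub>R\<^esub> r) ` carrier R"
    by (auto simp: quot_ring_simps A_RCOSETS_def')
  have "module (R Quot \<mm>) (residue_space R V)"
  proof (rule moduleI)
    show "cring (R Quot \<mm>)" using fld by (simp add: field_def domain_def)
    show "abelian_group (residue_space R V)"
    proof (rule abelian_groupI)
      fix v assume "v \<in> carrier (residue_space R V)"
      then show "\<exists>w\<in>carrier (residue_space R V). w \<oplus>\<^bsub>residue_space R V\<^esub> v = \<zero>\<^bsub>residue_space R V\<^esub>"
        using M.l_neg[of v] M.add.inv_closed[of v] by (auto simp: residue_space_simps)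
    qed (auto simp: residue_space_simps M.a_ac)
  qed (unfold carrK residue_space_simps(1,2,3),
      auto simp: smult smult_l_distr smult_r_distr smult_assoc1 quot_ring_simps m.a_rcos_sum m.rcoset_mult_add)
  then show "vectorspace (R Quot \<mm>) (residue_space R V)"
    using fld by (simp add: vectorspace_def)
qed

text \<open>A basis is built along a chain from \<open>N\<close> to \<open>V\<close>. Each time a vector outside the span so far is added,
  the remaining length drops by exactly one (lemma \<open>rel_length_simple_step\<close>), so the process stops
  after as many steps as the length says.\<close>

theorem residue_dim_eq_rel_length:
  assumes m: "maximalideal \<mm> R" "max_ideal R = \<mm>"
    and N: "submodule R N M" and V: "submodule R V M" and NV: "N \<subseteq> V"
    and mV: "\<And>a v. a \<in> \<mm> \<Longrightarrow> v \<in> V \<Longrightarrow> a \<odot>\<^bsub>M\<^esub> v \<in> N"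
    and len: "rel_length R M N V = enat n"
  shows "residue_dim R (quot_module (M\<lparr>carrier := V\<rparr>) N) = n"
proof -
  define Q where "Q = quot_module (M\<lparr>carrier := V\<rparr>) N"
  define \<pi> where "\<pi> x = N +>\<^bsub>M\<^esub> x" for x
  interpret M: module R M using N by (rule submodule.module)
  interpret m: maximalideal \<mm> R by fact
  have V_carr: "x \<in> V \<Longrightarrow> x \<in> carrier M" for x using submodule.subset[OF V] by blast
  have Q: "module R Q" unfolding Q_def by (rule quot_module_module[OF N V NV])
  have carrQ: "carrier Q = \<pi> ` V" unfolding Q_def \<pi>_def by (rule quot_module_carrier)
  have zeroQ: "\<zero>\<^bsub>Q\<^esub> = N" unfolding Q_def by (simp add: quot_module_simps)
  have \<pi>_smult: "r \<odot>\<^bsub>Q\<^esub> \<pi> x = \<pi> (r \<odot>\<^bsub>M\<^esub> x)" if "r \<in> carrier R" "x \<in> V" for r x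
    unfolding Q_def \<pi>_def using quot_module_smult[OF N] that V_carr by blast
  have \<pi>_add: "\<pi> x \<oplus>\<^bsub>Q\<^esub> \<pi> y = \<pi> (x \<oplus>\<^bsub>M\<^esub> y)" if "x \<in> V" "y \<in> V" for x y
    unfolding Q_def \<pi>_def using quot_module_add[OF N] that V_carr by blast
  have \<pi>_eq: "\<pi> x = \<pi> y \<longleftrightarrow> x \<ominus>\<^bsub>M\<^esub> y \<in> N" if "x \<in> V" "y \<in> V" for x y
    unfolding \<pi>_def using coset_eq_iff[OF N] that V_carr by blast
  have \<pi>_N: "\<pi> x = N" if "x \<in> N" for x
  proof -
    have "x \<ominus>\<^bsub>M\<^esub> \<zero>\<^bsub>M\<^esub> \<in> N" using that submodule_minus[OF N] submodule.zero_closed[OF N] by blast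
    then show ?thesis
      using \<pi>_eq[of x "\<zero>\<^bsub>M\<^esub>"] that NV submodule.zero_closed[OF V] submodule_coset_zero[OF N]
      by (auto simp: \<pi>_def)
  qed
  have ann: "a \<odot>\<^bsub>Q\<^esub> v = \<zero>\<^bsub>Q\<^esub>" if "a \<in> \<mm>" "v \<in> carrier Q" for a v
    using that mV \<pi>_N \<pi>_smult m.Icarr unfolding carrQ zeroQ by auto
  define W where "W = residue_space R Q"
  interpret W: vectorspace "R Quot \<mm>" W
    unfolding W_def by (rule residue_space_vectorspace(1)[OF Q m(1) ann])
  have W_smult: "(\<mm> +>\<^bsub>R\<^esub> r) \<odot>\<^bsub>W\<^esub> \<pi> x = \<pi> (r \<odot>\<^bsub>M\<^esub> x)" if "r \<in> carrier R" "x \<in> V" for r x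
    using residue_space_vectorspace(2)[OF Q m(1) ann] that \<pi>_smult carrQ by (simp add: W_def)
  have carrW: "carrier W = \<pi> ` V" by (simp add: W_def residue_space_simps carrQ)
  have W_add: "\<pi> x \<oplus>\<^bsub>W\<^esub> \<pi> y = \<pi> (x \<oplus>\<^bsub>M\<^esub> y)" if "x \<in> V" "y \<in> V" for x y
    using \<pi>_add[OF that] by (simp add: W_def residue_space_simps)
  have W_zero: "\<zero>\<^bsub>W\<^esub> = N" by (simp add: W_def residue_space_simps zeroQ)
  have carrK: "carrier (R Quot \<mm>) = (\<lambda>r. \<mm> +>\<^bsub>R\<^esub> r) ` carrier R"
    by (auto simp: quot_ring_simps A_RCOSETS_def')
  have image_sub: "submodule (R Quot \<mm>) (\<pi> ` L) W" if L: "submodule R L M" "N \<subseteq> L" "L \<subseteq> V" for L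
  proof (rule submodule_criterion)
    show "module (R Quot \<mm>) W" ..
    show "\<pi> ` L \<subseteq> carrier W" using L carrW by blast
    show "\<zero>\<^bsub>W\<^esub> \<in> \<pi> ` L"
      unfolding W_zero using \<pi>_N submodule.zero_closed[OF N] L(2) by blast
  next
    fix u v assume "u \<in> \<pi> ` L" "v \<in> \<pi> ` L"
    then show "u \<oplus>\<^bsub>W\<^esub> v \<in> \<pi> ` L" using W_add L submodule.m_closed[OF L(1)] by (auto simp: subset_iff)
  next
    fix s u assume "s \<in> carrier (R Quot \<mm>)" "u \<in> \<pi> ` L"
    then show "s \<odot>\<^bsub>W\<^esub> u \<in> \<pi> ` L"
      unfolding carrK using W_smult L submodule.smult_closed[OF L(1)] by (auto simp: subset_iff)
  qed
  have grow: "\<exists>B'. finite B' \<and> W.basis B' \<and> card B' = card B + k"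
    if "submodule R L M" "N \<subseteq> L" "L \<subseteq> V" "rel_length R M L V = enat k"
      "finite B" "B \<subseteq> carrier W" "W.lin_indpt B" "W.span B = \<pi> ` L" for L k B
    using that
  proof (induction k arbitrary: L B)
    case 0
    have "L = V" using rel_length_pos[OF 0(1) V] 0(3,4) by (cases "L = V") (auto simp: zero_enat_def one_enat_def)
    then show ?case using 0 carrW by (intro exI[of _ B]) (simp add: W.basis_def)
  next
    case (Suc k)
    note L = Suc.prems(1-3)
    have "L \<noteq> V" using rel_length_refl[OF V] Suc.prems(4) by (auto simp: zero_enat_def)
    then obtain z where z: "z \<in> V" "z \<notin> L" using L by blast
    have zM: "z \<in> carrier M" using z V_carr by blast
    define L' where "L' = submodule_add M L (cyclic_submodule R M z)"
    note Z = M.cyclic_submodule_submodule[OF zM]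
    have L': "submodule R L' M" unfolding L'_def by (rule submodule_add_submodule[OF L(1) Z])
    have LL': "L \<subseteq> L'" unfolding L'_def by (rule submodule_add_upper[OF L(1) Z])
    have zL': "z \<in> L'" unfolding L'_def using M.self_in_cyclic_submodule[OF zM]
        submodule_add_upper[OF Z L(1)] submodule_add_commute[OF L(1) Z] by blast
    have L'V: "L' \<subseteq> V" unfolding L'_def submodule_add_def cyclic_submodule_def
      using L(3) z(1) submodule.m_closed[OF V] submodule.smult_closed[OF V] by blast
    have "rel_length R M L L' = 1"
      unfolding L'_def using M.rel_length_simple_step[OF m(1) L(1) zM z(2)] mV z(1) L(2) by blast
    then have "rel_length R M L' V = enat k"
      using rel_length_additive[OF L(1) L' V LL' L'V] Suc.prems(4)
      by (cases "rel_length R M L' V") (auto simp: one_enat_def)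
    moreover have z_span: "\<pi> z \<notin> W.span B"
    proof
      assume "\<pi> z \<in> W.span B"
      then obtain y where y: "y \<in> L" "\<pi> z = \<pi> y" unfolding Suc.prems(8) by blast
      then have "z \<ominus>\<^bsub>M\<^esub> y \<in> L" using \<pi>_eq[OF z(1), of y] L by blast
      then have "(z \<ominus>\<^bsub>M\<^esub> y) \<oplus>\<^bsub>M\<^esub> y \<in> L" using y submodule.m_closed[OF L(1)] by blast
      moreover have "(z \<ominus>\<^bsub>M\<^esub> y) \<oplus>\<^bsub>M\<^esub> y = z"
        using zM y(1) V_carr L(3) by (simp add: a_minus_def M.M.a_assoc M.M.l_neg subset_iff)
      ultimately show False using z(2) by simp
    qed
    have zW: "\<pi> z \<in> carrier W" using z carrW by blast
    have B_own: "B \<subseteq> W.span B" by (rule W.in_own_span[OF Suc.prems(6)])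
    then have zB: "\<pi> z \<notin> B" using z_span by blast
    have li: "W.lin_indpt (insert (\<pi> z) B)"
      using W.lin_dep_iff_in_span[OF Suc.prems(6,7) zW zB] z_span by simp
    have B'c: "insert (\<pi> z) B \<subseteq> carrier W" using zW Suc.prems(6) by blast
    have span': "W.span (insert (\<pi> z) B) = \<pi> ` L'"
    proof
      have "insert (\<pi> z) B \<subseteq> \<pi> ` L'" using B_own Suc.prems(8) LL' zL' by blast
      then show "W.span (insert (\<pi> z) B) \<subseteq> \<pi> ` L'"
        using W.span_is_subset[OF _ image_sub[OF L' _ L'V]] LL' L(2) by blast
      note S = W.span_is_submodule[OF B'c]
      have zS: "\<pi> z \<in> W.span (insert (\<pi> z) B)" using W.in_own_span[OF B'c] by blast
      have "B \<subseteq> W.span (insert (\<pi> z) B)" using W.in_own_span[OF B'c] by blast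
      then have LS: "\<pi> ` L \<subseteq> W.span (insert (\<pi> z) B)"
        using W.span_is_subset[OF _ S] Suc.prems(8) by blast
      show "\<pi> ` L' \<subseteq> W.span (insert (\<pi> z) B)"
      proof
        fix u assume "u \<in> \<pi> ` L'"
        then obtain x r where x: "x \<in> L" "r \<in> carrier R" "u = \<pi> (x \<oplus>\<^bsub>M\<^esub> r \<odot>\<^bsub>M\<^esub> z)"
          unfolding L'_def submodule_add_def cyclic_submodule_def by blast
        have rz: "r \<odot>\<^bsub>M\<^esub> z \<in> V" using x z submodule.smult_closed[OF V] by blast
        have "u = \<pi> x \<oplus>\<^bsub>W\<^esub> (\<mm> +>\<^bsub>R\<^esub> r) \<odot>\<^bsub>W\<^esub> \<pi> z"
          unfolding x(3) W_smult[OF x(2) z(1)] using W_add[of x "r \<odot>\<^bsub>M\<^esub> z"] rz x(1) L(3) by auto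
        then show "u \<in> W.span (insert (\<pi> z) B)"
          using submodule.m_closed[OF S] submodule.smult_closed[OF S] zS LS x carrK by auto
      qed
    qed
    ultimately obtain B' where "finite B'" "W.basis B'" "card B' = card (insert (\<pi> z) B) + k"
      using Suc.IH[OF L' _ L'V _ _ B'c li span'] LL' L(2) Suc.prems(5) by blast
    then show ?case using zB Suc.prems(5) by (intro exI[of _ B']) simp
  qed
  have "W.lin_indpt {}" by (simp add: W.lin_dep_def)
  moreover have "W.span {} = \<pi> ` N"
  proof -
    have "W.span {} = {N}" by (auto simp: W.span_def W.lincomb_def W_zero)
    also have "\<dots> = \<pi> ` N" using \<pi>_N submodule.zero_closed[OF N] by auto
    finally show ?thesis .
  qed
  ultimately obtain B where "finite B" "W.basis B" "card B = n"
    using grow[OF N order_refl NV len, of "{}"] by auto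
  then have "W.dim = n" using W.dim_basis by blast
  then show ?thesis unfolding residue_dim_def m(2) W_def Q_def .
qed

section \<open>Ideals as submodules\<close>

lemma ring_module_simps [simp]:
  "carrier (ring_module R) = carrier R" "\<zero>\<^bsub>ring_module R\<^esub> = \<zero>\<^bsub>R\<^esub>"
  "x \<oplus>\<^bsub>ring_module R\<^esub> y = x \<oplus>\<^bsub>R\<^esub> y" "r \<odot>\<^bsub>ring_module R\<^esub> x = r \<otimes>\<^bsub>R\<^esub> x"
  by (simp_all add: ring_module_def)

lemma (in cring) ring_module_module: "module R (ring_module R)"
proof (rule moduleI)
  show "abelian_group (ring_module R)"
  proof (rule abelian_groupI)
    fix x assume "x \<in> carrier (ring_module R)"
    then show "\<exists>y\<in>carrier (ring_module R). y \<oplus>\<^bsub>ring_module R\<^esub> x = \<zero>\<^bsub>ring_module R\<^esub>"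
      using l_neg[of x] by (auto intro!: bexI[of _ "\<ominus> x"])
  qed (auto simp: a_ac)
qed (auto simp: l_distr r_distr m_assoc is_cring)

lemma (in cring) submodule_ring_module_iff: "submodule R J (ring_module R) \<longleftrightarrow> ideal J R"
proof
  assume J: "submodule R J (ring_module R)"
  have c: "J \<subseteq> carrier R" "\<zero> \<in> J" "\<And>x y. x \<in> J \<Longrightarrow> y \<in> J \<Longrightarrow> x \<oplus> y \<in> J"
    "\<And>r x. r \<in> carrier R \<Longrightarrow> x \<in> J \<Longrightarrow> r \<otimes> x \<in> J"
    using submodule.subset[OF J] submodule.zero_closed[OF J] submodule.m_closed[OF J] submodule.smult_closed[OF J]
    by auto
  have neg: "\<ominus> x \<in> J" if "x \<in> J" for x
  proof -
    have "\<ominus> \<one> \<otimes> x \<in> J" using c(4) that by simp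
    then show ?thesis using that c(1) by (simp add: l_minus subset_iff)
  qed
  show "ideal J R"
  proof (rule idealI)
    show "subgroup J (add_monoid R)" using c neg by (auto simp: subgroup_def a_inv_def[symmetric])
    fix a x assume "a \<in> J" "x \<in> carrier R"
    then show "x \<otimes> a \<in> J" "a \<otimes> x \<in> J" using c m_comm[of a x] by auto
  qed (rule ring_axioms)
next
  assume "ideal J R"
  then interpret ideal J R .
  show "submodule R J (ring_module R)"
    by (rule submodule_criterion) (use ring_module_module I_l_closed Icarr in auto)
qed

section \<open>Finitely generated submodules\<close>

text \<open>Finite generation in a form suited to induction: such submodules arise from the zero submodule by
  adding one cyclic submodule at a time.\<close>

inductive fg_submodule :: "('a, 'r) ring_scheme \<Rightarrow> ('a, 'v, 'x) module_scheme \<Rightarrow> 'v set \<Rightarrow> bool"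
  for R M where
  zero: "fg_submodule R M {\<zero>\<^bsub>M\<^esub>}"
| add: "fg_submodule R M L \<Longrightarrow> z \<in> carrier M \<Longrightarrow> fg_submodule R M (submodule_add M L (cyclic_submodule R M z))"

lemma (in module) zero_submodule: "submodule R {\<zero>\<^bsub>M\<^esub>} M"
  by (rule submodule_criterion) (auto intro: module_axioms)

lemma (in module) fg_submodule_submodule: "fg_submodule R M L \<Longrightarrow> submodule R L M"
  by (induction rule: fg_submodule.induct)
    (auto intro: zero_submodule submodule_add_submodule cyclic_submodule_submodule)

lemma submodule_add_assoc:
  assumes "submodule R L M" "submodule R L' M" "submodule R L'' M"
  shows "submodule_add M L (submodule_add M L' L'') = submodule_add M (submodule_add M L L') L''"
proof -
  interpret module R M using assms(1) by (rule submodule.module)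
  have c: "x \<in> carrier M" if "x \<in> L \<or> x \<in> L' \<or> x \<in> L''" for x
    using that assms submodule.subset by blast
  show ?thesis
  proof (intro equalityI subsetI)
    fix u assume "u \<in> submodule_add M L (submodule_add M L' L'')"
    then obtain x y z where "x \<in> L" "y \<in> L'" "z \<in> L''" "u = x \<oplus>\<^bsub>M\<^esub> (y \<oplus>\<^bsub>M\<^esub> z)"
      unfolding submodule_add_def by blast
    moreover from this have "u = (x \<oplus>\<^bsub>M\<^esub> y) \<oplus>\<^bsub>M\<^esub> z" using c by (simp add: M.a_assoc)
    ultimately show "u \<in> submodule_add M (submodule_add M L L') L''"
      unfolding submodule_add_def by blast
  next
    fix u assume "u \<in> submodule_add M (submodule_add M L L') L''"
    then obtain x y z where "x \<in> L" "y \<in> L'" "z \<in> L''" "u = (x \<oplus>\<^bsub>M\<^esub> y) \<oplus>\<^bsub>M\<^esub> z"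
      unfolding submodule_add_def by blast
    moreover from this have "u = x \<oplus>\<^bsub>M\<^esub> (y \<oplus>\<^bsub>M\<^esub> z)" using c by (simp add: M.a_assoc)
    ultimately show "u \<in> submodule_add M L (submodule_add M L' L'')"
      unfolding submodule_add_def by blast
  qed
qed

lemma (in module) fg_submodule_add:
  assumes "fg_submodule R M L" "fg_submodule R M L'"
  shows "fg_submodule R M (submodule_add M L L')"
  using assms(2)
proof induction
  case zero
  note Ls = fg_submodule_submodule[OF assms(1)]
  have "submodule_add M L {\<zero>\<^bsub>M\<^esub>} = submodule_add M {\<zero>\<^bsub>M\<^esub>} L"
    using submodule_add_commute Ls zero_submodule by blast
  also have "\<dots> = L"
    using submodule_add_absorb[OF zero_submodule Ls] submodule.zero_closed[OF Ls] by simp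
  finally show ?case using assms(1) by simp
next
  case (add L' z)
  then show ?case
    using fg_submodule.add[OF add(3,2)]
      submodule_add_assoc[OF fg_submodule_submodule[OF assms(1)] fg_submodule_submodule[OF add(1)]
        cyclic_submodule_submodule[OF add(2)]] by simp
qed

lemma fg_submodule_hom_image:
  assumes "module R M" "module R M'" and f: "f \<in> module_hom R M M'" and "fg_submodule R M L"
  shows "fg_submodule R M' (f ` L)"
proof -
  interpret mod_hom R M M' f using assms by (simp add: mod_hom_def mod_hom_axioms_def)
  show ?thesis using assms(4)
  proof induction
    case zero
    then show ?case by (simp add: fg_submodule.zero)
  next
    case (add L z)
    have Lc: "x \<in> carrier M" if "x \<in> L" for x
      using that submodule.subset[OF M.fg_submodule_submodule[OF add(1)]] by blast
    have "f ` submodule_add M L (cyclic_submodule R M z) = submodule_add M' (f ` L) (cyclic_submodule R M' (f z))"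
    proof (intro equalityI subsetI)
      fix u assume "u \<in> f ` submodule_add M L (cyclic_submodule R M z)"
      then obtain x r where "x \<in> L" "r \<in> carrier R" "u = f (x \<oplus>\<^bsub>M\<^esub> r \<odot>\<^bsub>M\<^esub> z)"
        unfolding submodule_add_def cyclic_submodule_def by blast
      moreover from this have "u = f x \<oplus>\<^bsub>M'\<^esub> r \<odot>\<^bsub>M'\<^esub> f z" using Lc add(2) by simp
      ultimately show "u \<in> submodule_add M' (f ` L) (cyclic_submodule R M' (f z))"
        unfolding submodule_add_def cyclic_submodule_def by blast
    next
      fix u assume "u \<in> submodule_add M' (f ` L) (cyclic_submodule R M' (f z))"
      then obtain x r where "x \<in> L" "r \<in> carrier R" "u = f x \<oplus>\<^bsub>M'\<^esub> r \<odot>\<^bsub>M'\<^esub> f z"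
        unfolding submodule_add_def cyclic_submodule_def by blast
      moreover from this have "u = f (x \<oplus>\<^bsub>M\<^esub> r \<odot>\<^bsub>M\<^esub> z)" using Lc add(2) by simp
      ultimately show "u \<in> f ` submodule_add M L (cyclic_submodule R M z)"
        unfolding submodule_add_def cyclic_submodule_def by blast
    qed
    with add show ?case using fg_submodule.add[OF add(3)] f_im[OF add(2)] by simp
  qed
qed

lemma fg_submodule_lift:
  assumes M: "module R M" and M': "module R M'" and f: "f \<in> module_hom R M M'" and K: "submodule R K M"
    and L: "fg_submodule R M' L" "L \<subseteq> f ` K"
  shows "\<exists>L'. fg_submodule R M L' \<and> L' \<subseteq> K \<and> L \<subseteq> f ` L'"
  using L
proof induction
  case zero
  interpret mod_hom R M M' f using assms by (simp add: mod_hom_def mod_hom_axioms_def)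
  show ?case using submodule.zero_closed[OF K]
    by (intro exI[of _ "{\<zero>\<^bsub>M\<^esub>}"]) (auto intro: fg_submodule.zero)
next
  case (add L z)
  interpret mod_hom R M M' f using assms by (simp add: mod_hom_def mod_hom_axioms_def)
  note Ls = N.fg_submodule_submodule[OF add(1)] and Z = N.cyclic_submodule_submodule[OF add(2)]
  have LK: "L \<subseteq> f ` K" using submodule_add_upper[OF Ls Z] add.prems by blast
  have "z \<in> f ` K"
    using N.self_in_cyclic_submodule[OF add(2)] submodule_add_upper[OF Z Ls] submodule_add_commute[OF Ls Z] add.prems
    by blast
  then obtain y where y: "y \<in> K" "z = f y" by blast
  obtain L' where L': "fg_submodule R M L'" "L' \<subseteq> K" "L \<subseteq> f ` L'" using add.IH[OF LK] by blast
  have Kc: "K \<subseteq> carrier M" by (rule submodule.subset[OF K])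
  let ?L = "submodule_add M L' (cyclic_submodule R M y)"
  have "fg_submodule R M ?L" using fg_submodule.add[OF L'(1)] y Kc by blast
  moreover have "?L \<subseteq> K"
    using L'(2) y submodule.m_closed[OF K] submodule.smult_closed[OF K]
    unfolding submodule_add_def cyclic_submodule_def by blast
  moreover have "submodule_add M' L (cyclic_submodule R M' z) \<subseteq> f ` ?L"
  proof
    fix u assume "u \<in> submodule_add M' L (cyclic_submodule R M' z)"
    then obtain x r where xr: "x \<in> L'" "r \<in> carrier R" "u = f x \<oplus>\<^bsub>M'\<^esub> r \<odot>\<^bsub>M'\<^esub> f y"
      using L'(3) y(2) unfolding submodule_add_def cyclic_submodule_def by blast
    moreover from this have "u = f (x \<oplus>\<^bsub>M\<^esub> r \<odot>\<^bsub>M\<^esub> y)" using Kc L'(2) y by (simp add: subset_iff)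
    ultimately show "u \<in> f ` ?L"
      unfolding submodule_add_def cyclic_submodule_def by blast
  qed
  ultimately show ?case by blast
qed

text \<open>If the image and the kernel of a map on \<open>K\<close> are finitely generated, so is \<open>K\<close>: lift generators of
  the image and add the kernel.\<close>

lemma fg_submodule_extension:
  assumes M: "module R M" and M': "module R M'" and f: "f \<in> module_hom R M M'" and K: "submodule R K M"
    and im: "fg_submodule R M' (f ` K)" and ker: "fg_submodule R M {x \<in> K. f x = \<zero>\<^bsub>M'\<^esub>}" (is "fg_submodule R M ?K0")
  shows "fg_submodule R M K"
proof -
  interpret mod_hom R M M' f using assms by (simp add: mod_hom_def mod_hom_axioms_def)
  obtain L where L: "fg_submodule R M L" "L \<subseteq> K" "f ` K \<subseteq> f ` L"
    using fg_submodule_lift[OF M M' f K im order_refl] by blast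
  have Kc: "x \<in> carrier M" if "x \<in> K" for x using that submodule.subset[OF K] by blast
  have "submodule_add M L ?K0 = K"
  proof (intro equalityI subsetI)
    fix u assume "u \<in> submodule_add M L ?K0"
    then show "u \<in> K" using L(2) submodule.m_closed[OF K] unfolding submodule_add_def by blast
  next
    fix u assume u: "u \<in> K"
    then obtain y where y: "y \<in> L" "f u = f y" using L(3) by blast
    have yK: "y \<in> K" using y L(2) by blast
    have d: "u \<ominus>\<^bsub>M\<^esub> y \<in> K" using submodule_minus[OF K u yK] .
    have u': "u = y \<oplus>\<^bsub>M\<^esub> (u \<ominus>\<^bsub>M\<^esub> y)"
      using Kc[OF u] Kc[OF yK] by (simp add: a_minus_def M.M.a_ac M.M.r_neg2 M.M.r_neg)
    have "f y \<oplus>\<^bsub>M'\<^esub> \<zero>\<^bsub>M'\<^esub> = f y \<oplus>\<^bsub>M'\<^esub> f (u \<ominus>\<^bsub>M\<^esub> y)"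
      using u' y(2) f_add[OF Kc[OF yK] Kc[OF d]] Kc[OF yK] by simp
    then have "f (u \<ominus>\<^bsub>M\<^esub> y) = \<zero>\<^bsub>M'\<^esub>" using Kc[OF yK] Kc[OF d] by simp
    with d y(1) u' show "u \<in> submodule_add M L ?K0" unfolding submodule_add_def by blast
  qed
  with M.fg_submodule_add[OF L(1) ker] show ?thesis by simp
qed

lemma (in cring) fg_ideal:
  assumes "noetherian_ring R" "ideal J R"
  shows "fg_submodule R (ring_module R) J"
proof -
  interpret RM: module R "ring_module R" by (rule ring_module_module)
  obtain A where A: "A \<subseteq> carrier R" "finite A" "J = Idl A"
    using noetherian_ring.finetely_gen[OF assms] by blast
  have AJ: "A \<subseteq> J" using genideal_self[OF A(1)] A(3) by simp
  have "\<exists>L. fg_submodule R (ring_module R) L \<and> L \<subseteq> J \<and> B \<subseteq> L" if "finite B" "B \<subseteq> J" for B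
    using that
  proof (induction B)
    case empty
    then show ?case
      using fg_submodule.zero[of R "ring_module R"] additive_subgroup.zero_closed[OF ideal.axioms(1)[OF assms(2)]]
      by auto
  next
    case (insert z B)
    then obtain L where L: "fg_submodule R (ring_module R) L" "L \<subseteq> J" "B \<subseteq> L" by auto
    have z: "z \<in> carrier R" using insert ideal.Icarr[OF assms(2)] by auto
    note Ls = RM.fg_submodule_submodule[OF L(1)]
    have Z: "submodule R (cyclic_submodule R (ring_module R) z) (ring_module R)"
      using RM.cyclic_submodule_submodule z by simp
    let ?L = "submodule_add (ring_module R) L (cyclic_submodule R (ring_module R) z)"
    have J: "submodule R J (ring_module R)" using submodule_ring_module_iff assms(2) by simp
    have "fg_submodule R (ring_module R) ?L" using fg_submodule.add[OF L(1)] z by simp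
    moreover have "?L \<subseteq> J"
      using L(2) insert.prems submodule.m_closed[OF J] submodule.smult_closed[OF J]
      unfolding submodule_add_def cyclic_submodule_def by blast
    moreover have "insert z B \<subseteq> ?L"
      using L(3) submodule_add_upper[OF Ls Z] submodule_add_upper[OF Z Ls] submodule_add_commute[OF Ls Z]
        RM.self_in_cyclic_submodule[of z] z by auto
    ultimately show ?case by blast
  qed
  from this[OF A(2) AJ] obtain L where L: "fg_submodule R (ring_module R) L" "L \<subseteq> J" "A \<subseteq> L" by blast
  have "ideal L R" using RM.fg_submodule_submodule[OF L(1)] submodule_ring_module_iff by simp
  then have "J \<subseteq> L" using genideal_minimal[OF _ L(3)] A(3) by simp
  with L show ?thesis by (simp add: subset_antisym)
qed

section \<open>Powers of a module\<close>

lemma power_module_simps: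
  "carrier (power_module M n) = {..<n} \<rightarrow>\<^sub>E carrier M"
  "\<zero>\<^bsub>power_module M n\<^esub> = (\<lambda>i\<in>{..<n}. \<zero>\<^bsub>M\<^esub>)"
  "f \<oplus>\<^bsub>power_module M n\<^esub> g = (\<lambda>i\<in>{..<n}. f i \<oplus>\<^bsub>M\<^esub> g i)"
  "r \<odot>\<^bsub>power_module M n\<^esub> f = (\<lambda>i\<in>{..<n}. r \<odot>\<^bsub>M\<^esub> f i)"
  by (simp_all add: power_module_def)

lemma power_module_apply:
  assumes "i < n"
  shows "\<zero>\<^bsub>power_module M n\<^esub> i = \<zero>\<^bsub>M\<^esub>"
    "(f \<oplus>\<^bsub>power_module M n\<^esub> g) i = f i \<oplus>\<^bsub>M\<^esub> g i"
    "(r \<odot>\<^bsub>power_module M n\<^esub> f) i = r \<odot>\<^bsub>M\<^esub> f i"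
  using assms by (simp_all add: power_module_simps)

lemma power_module_memI:
  assumes "\<And>i. i < n \<Longrightarrow> f i \<in> carrier M"
  shows "(\<lambda>i\<in>{..<n}. f i) \<in> carrier (power_module M n)"
  using assms by (simp add: power_module_simps)

lemma power_module_memD: "f \<in> carrier (power_module M n) \<Longrightarrow> i < n \<Longrightarrow> f i \<in> carrier M"
  unfolding power_module_simps by (erule PiE_mem) simp

lemma power_module_eqI:
  assumes "f \<in> carrier (power_module M n)" "g \<in> carrier (power_module M n)"
    "\<And>i. i < n \<Longrightarrow> f i = g i"
  shows "f = g"
  using assms unfolding power_module_simps by (blast intro: PiE_ext)

lemma restrict_PiE_eq: "f \<in> A \<rightarrow>\<^sub>E B \<Longrightarrow> (\<lambda>i\<in>A. f i) = f"
  by (simp add: PiE_def extensional_restrict)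

lemma (in module) power_module_module: "module R (power_module M n)"
proof -
  note memD = power_module_memD[where M=M and n=n]
  have add: "f \<oplus>\<^bsub>power_module M n\<^esub> g \<in> carrier (power_module M n)"
    if "f \<in> carrier (power_module M n)" "g \<in> carrier (power_module M n)" for f g
    unfolding power_module_simps(3) using memD that by (intro power_module_memI) simp
  have smult: "r \<odot>\<^bsub>power_module M n\<^esub> f \<in> carrier (power_module M n)"
    if "r \<in> carrier R" "f \<in> carrier (power_module M n)" for r f
    unfolding power_module_simps(4) using memD that by (intro power_module_memI) simp
  have zero: "\<zero>\<^bsub>power_module M n\<^esub> \<in> carrier (power_module M n)"
    unfolding power_module_simps(2) by (intro power_module_memI) simp
  note closed = add smult zero
  show ?thesis
  proof (rule moduleI)
    show "cring R" ..
    show "abelian_group (power_module M n)"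
    proof (rule abelian_groupI)
      fix f assume f: "f \<in> carrier (power_module M n)"
      have neg: "(\<lambda>i\<in>{..<n}. \<ominus>\<^bsub>M\<^esub> f i) \<in> carrier (power_module M n)"
        using f memD by (intro power_module_memI) simp
      moreover have "(\<lambda>i\<in>{..<n}. \<ominus>\<^bsub>M\<^esub> f i) \<oplus>\<^bsub>power_module M n\<^esub> f = \<zero>\<^bsub>power_module M n\<^esub>"
        by (rule power_module_eqI[OF add[OF neg f] zero]) (simp add: power_module_apply M.l_neg memD[OF f])
      ultimately show "\<exists>g\<in>carrier (power_module M n). g \<oplus>\<^bsub>power_module M n\<^esub> f = \<zero>\<^bsub>power_module M n\<^esub>" by blast
      show "\<zero>\<^bsub>power_module M n\<^esub> \<oplus>\<^bsub>power_module M n\<^esub> f = f"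
        by (rule power_module_eqI[OF add[OF zero f] f]) (simp add: power_module_apply memD[OF f])
    next
      fix f g assume f: "f \<in> carrier (power_module M n)" and g: "g \<in> carrier (power_module M n)"
      show "f \<oplus>\<^bsub>power_module M n\<^esub> g = g \<oplus>\<^bsub>power_module M n\<^esub> f"
        by (rule power_module_eqI[OF add[OF f g] add[OF g f]])
          (simp add: power_module_apply memD[OF f] memD[OF g] M.a_comm)
      fix h assume h: "h \<in> carrier (power_module M n)"
      show "f \<oplus>\<^bsub>power_module M n\<^esub> g \<oplus>\<^bsub>power_module M n\<^esub> h = f \<oplus>\<^bsub>power_module M n\<^esub> (g \<oplus>\<^bsub>power_module M n\<^esub> h)"
        by (rule power_module_eqI[OF add[OF add[OF f g] h] add[OF f add[OF g h]]])
          (simp add: power_module_apply memD[OF f] memD[OF g] memD[OF h] M.a_assoc)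
    qed (use closed in auto)
  next
    fix a b f assume a: "a \<in> carrier R" and b: "b \<in> carrier R" and f: "f \<in> carrier (power_module M n)"
    show "(a \<oplus> b) \<odot>\<^bsub>power_module M n\<^esub> f = a \<odot>\<^bsub>power_module M n\<^esub> f \<oplus>\<^bsub>power_module M n\<^esub> b \<odot>\<^bsub>power_module M n\<^esub> f"
      using a b f closed by (intro power_module_eqI[of _ M n])
        (auto simp add: power_module_apply memD[OF f] smult_l_distr)
    show "(a \<otimes> b) \<odot>\<^bsub>power_module M n\<^esub> f = a \<odot>\<^bsub>power_module M n\<^esub> (b \<odot>\<^bsub>power_module M n\<^esub> f)"
      using a b f closed by (intro power_module_eqI[of _ M n])
        (auto simp add: power_module_apply memD[OF f] smult_assoc1)
  next
    fix a f g assume a: "a \<in> carrier R" and f: "f \<in> carrier (power_module M n)" and g: "g \<in> carrier (power_module M n)"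
    show "a \<odot>\<^bsub>power_module M n\<^esub> (f \<oplus>\<^bsub>power_module M n\<^esub> g) =
        a \<odot>\<^bsub>power_module M n\<^esub> f \<oplus>\<^bsub>power_module M n\<^esub> a \<odot>\<^bsub>power_module M n\<^esub> g"
      using a g f closed by (intro power_module_eqI[of _ M n])
        (auto simp add: power_module_apply memD[OF f] memD[OF g] smult_r_distr)
  next
    fix f assume f: "f \<in> carrier (power_module M n)"
    show "\<one> \<odot>\<^bsub>power_module M n\<^esub> f = f"
      using f closed by (intro power_module_eqI[of _ M n]) (auto simp add: power_module_apply memD[OF f])
  qed (use closed in auto)
qed

text \<open>Induction on the rank: the last coordinate of \<open>K\<close> runs through an ideal, which is finitely generated,
  and the elements of \<open>K\<close> with last coordinate zero form a submodule of the free module of rank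
  one less.\<close>

theorem (in cring) submodule_of_free_fg:
  assumes noeth: "noetherian_ring R"
  shows "submodule R K (power_module (ring_module R) n) \<Longrightarrow> fg_submodule R (power_module (ring_module R) n) K"
proof (induction n arbitrary: K)
  case 0
  have "(\<lambda>i\<in>{..<0::nat}. \<zero>) = (\<lambda>i. undefined)" by auto
  then have "K = {\<zero>\<^bsub>power_module (ring_module R) 0\<^esub>}"
    using submodule.subset[OF 0] submodule.zero_closed[OF 0] by (auto simp: power_module_simps)
  then show ?case using fg_submodule.zero[of R "power_module (ring_module R) 0"] by simp
next
  case (Suc n)
  interpret RM: module R "ring_module R" by (rule ring_module_module)
  let ?F = "power_module (ring_module R)"
  define \<pi> :: "(nat \<Rightarrow> 'a) \<Rightarrow> 'a" where "\<pi> f = f n" for f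
  define \<iota> :: "(nat \<Rightarrow> 'a) \<Rightarrow> nat \<Rightarrow> 'a" where "\<iota> f = (\<lambda>i\<in>{..<Suc n}. if i = n then \<zero> else f i)" for f
  have F1: "module R (?F (Suc n))" and F0: "module R (?F n)" by (rule RM.power_module_module)+
  have \<pi>: "\<pi> \<in> module_hom R (?F (Suc n)) (ring_module R)"
    using power_module_memD[of _ "ring_module R" "Suc n" n]
    by (simp add: module_hom_def \<pi>_def power_module_apply)
  have \<iota>: "\<iota> \<in> module_hom R (?F n) (?F (Suc n))"
  proof -
    have mem: "\<iota> f \<in> carrier (?F (Suc n))" if "f \<in> carrier (?F n)" for f
      unfolding \<iota>_def using power_module_memD[OF that]
      by (intro power_module_memI) (auto simp: less_Suc_eq)
    have ap: "\<iota> f i = (if i = n then \<zero> else f i)" if "i < Suc n" for f i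
      using that by (simp add: \<iota>_def)
    interpret F0: module R "?F n" by (rule F0)
    interpret F1: module R "?F (Suc n)" by (rule F1)
    show ?thesis unfolding module_hom_def
    proof (intro CollectI conjI allI impI)
      show "\<iota> \<in> carrier (?F n) \<rightarrow> carrier (?F (Suc n))" using mem by blast
    next
      fix f g assume *: "f \<in> carrier (?F n) \<and> g \<in> carrier (?F n)"
      show "\<iota> (f \<oplus>\<^bsub>?F n\<^esub> g) = \<iota> f \<oplus>\<^bsub>?F (Suc n)\<^esub> \<iota> g"
        using * by (intro power_module_eqI[of _ "ring_module R" "Suc n"])
          (auto simp: mem power_module_apply ap less_Suc_eq)
    next
      fix r f assume *: "r \<in> carrier R \<and> f \<in> carrier (?F n)"
      show "\<iota> (r \<odot>\<^bsub>?F n\<^esub> f) = r \<odot>\<^bsub>?F (Suc n)\<^esub> \<iota> f"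
        using * by (intro power_module_eqI[of _ "ring_module R" "Suc n"])
          (auto simp: mem power_module_apply ap less_Suc_eq)
    qed
  qed
  interpret \<pi>: mod_hom R "?F (Suc n)" "ring_module R" \<pi>
    using F1 RM.module_axioms \<pi> by (simp add: mod_hom_def mod_hom_axioms_def)
  interpret \<iota>: mod_hom R "?F n" "?F (Suc n)" \<iota>
    using F1 F0 \<iota> by (simp add: mod_hom_def mod_hom_axioms_def)
  have Kc: "x \<in> carrier (?F (Suc n))" if "x \<in> K" for x using that submodule.subset[OF Suc.prems] by blast
  note Ks = submodule.m_closed[OF Suc.prems] submodule.smult_closed[OF Suc.prems]
  have "submodule R (\<pi> ` K) (ring_module R)"
  proof (rule submodule_criterion)
    show "module R (ring_module R)" ..
    show "\<pi> ` K \<subseteq> carrier (ring_module R)" using Kc \<pi>.f_im by blast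
    show "\<zero>\<^bsub>ring_module R\<^esub> \<in> \<pi> ` K"
      using submodule.zero_closed[OF Suc.prems] \<pi>.f0_is_0 by force
  next
    fix u v assume "u \<in> \<pi> ` K" "v \<in> \<pi> ` K"
    then obtain f g where fg: "f \<in> K" "g \<in> K" "u = \<pi> f" "v = \<pi> g" by blast
    then have "u \<oplus>\<^bsub>ring_module R\<^esub> v = \<pi> (f \<oplus>\<^bsub>?F (Suc n)\<^esub> g)" using Kc by (simp only: \<pi>.f_add)
    then show "u \<oplus>\<^bsub>ring_module R\<^esub> v \<in> \<pi> ` K" using Ks(1)[OF fg(1,2)] by (simp only: imageI)
  next
    fix r u assume "r \<in> carrier R" "u \<in> \<pi> ` K"
    then obtain f where f: "r \<in> carrier R" "f \<in> K" "u = \<pi> f" by blast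
    then have "r \<odot>\<^bsub>ring_module R\<^esub> u = \<pi> (r \<odot>\<^bsub>?F (Suc n)\<^esub> f)" using Kc by (simp only: \<pi>.f_smult)
    then show "r \<odot>\<^bsub>ring_module R\<^esub> u \<in> \<pi> ` K" using Ks(2)[OF f(1,2)] by (simp only: imageI)
  qed
  then have im: "fg_submodule R (ring_module R) (\<pi> ` K)"
    using fg_ideal[OF noeth] submodule_ring_module_iff by blast
  let ?K0 = "{f \<in> carrier (?F n). \<iota> f \<in> K}"
  have "submodule R ?K0 (?F n)"
  proof (rule submodule_criterion)
    show "module R (?F n)" by fact
  qed (use submodule.zero_closed[OF Suc.prems] Ks \<iota>.M.M.zero_closed in auto)
  then have "fg_submodule R (?F n) ?K0" by (rule Suc.IH)
  then have "fg_submodule R (?F (Suc n)) (\<iota> ` ?K0)" using fg_submodule_hom_image[OF F0 F1 \<iota>] by blast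
  moreover have "\<iota> ` ?K0 = {x \<in> K. \<pi> x = \<zero>\<^bsub>ring_module R\<^esub>}"
  proof (intro equalityI subsetI)
    fix u assume "u \<in> \<iota> ` ?K0"
    then show "u \<in> {x \<in> K. \<pi> x = \<zero>\<^bsub>ring_module R\<^esub>}" by (auto simp: \<pi>_def \<iota>_def)
  next
    fix u assume u: "u \<in> {x \<in> K. \<pi> x = \<zero>\<^bsub>ring_module R\<^esub>}"
    then have uc: "u \<in> {..<Suc n} \<rightarrow>\<^sub>E carrier R" "u n = \<zero>" using Kc by (auto simp: power_module_simps \<pi>_def)
    have "\<iota> (restrict u {..<n}) = (\<lambda>i\<in>{..<Suc n}. u i)"
      unfolding \<iota>_def using uc(2) by (intro restrict_ext) auto
    then have "\<iota> (restrict u {..<n}) = u" using restrict_PiE_eq[OF uc(1)] by simp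
    moreover have "restrict u {..<n} \<in> carrier (?F n)"
      using power_module_memD[of u "ring_module R" "Suc n"] uc(1) by (intro power_module_memI) (simp add: power_module_simps)
    ultimately have "u = \<iota> (restrict u {..<n}) \<and> restrict u {..<n} \<in> ?K0" using u by simp
    then show "u \<in> \<iota> ` ?K0" by blast
  qed
  ultimately show ?case using fg_submodule_extension[OF F1 RM.module_axioms \<pi> Suc.prems im] by simp
qed

section \<open>Linear combinations and matrices\<close>

text \<open>The entries of a matrix applied to a tuple. It is kept as a function of two sequences, of which only
  the first \<open>n\<close> terms count, so that rows and columns of a matrix can both be inserted without
  restricting them to their index sets.\<close>

definition pairing :: "('a, 'v, 'x) module_scheme \<Rightarrow> nat \<Rightarrow> (nat \<Rightarrow> 'a) \<Rightarrow> (nat \<Rightarrow> 'v) \<Rightarrow> 'v" where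
  "pairing M n a v = (\<Oplus>\<^bsub>M\<^esub>k\<in>{..<n}. a k \<odot>\<^bsub>M\<^esub> v k)"

lemma matrix_map_pairing: "matrix_map M q p A c = (\<lambda>j\<in>{..<q}. pairing M p (A j) c)"
  by (simp add: matrix_map_def pairing_def)

context module begin

lemma pairing_closed:
  assumes "\<And>k. k < n \<Longrightarrow> a k \<in> carrier R" "\<And>k. k < n \<Longrightarrow> v k \<in> carrier M"
  shows "pairing M n a v \<in> carrier M"
  unfolding pairing_def by (rule M.finsum_closed) (use assms in auto)

lemma pairing_0: "pairing M 0 a v = \<zero>\<^bsub>M\<^esub>"
  by (simp add: pairing_def)

lemma pairing_Suc:
  assumes "\<And>k. k < Suc n \<Longrightarrow> a k \<in> carrier R" "\<And>k. k < Suc n \<Longrightarrow> v k \<in> carrier M"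
  shows "pairing M (Suc n) a v = pairing M n a v \<oplus>\<^bsub>M\<^esub> a n \<odot>\<^bsub>M\<^esub> v n"
proof -
  have "(\<lambda>k. a k \<odot>\<^bsub>M\<^esub> v k) \<in> {..<n} \<rightarrow> carrier M" using assms by simp
  then have "pairing M (Suc n) a v = a n \<odot>\<^bsub>M\<^esub> v n \<oplus>\<^bsub>M\<^esub> pairing M n a v"
    unfolding pairing_def lessThan_Suc using assms[of n] by (subst M.finsum_insert) auto
  then show ?thesis using pairing_closed[of n a v] assms by (simp add: M.a_comm)
qed

lemma pairing_cong:
  assumes "\<And>k. k < n \<Longrightarrow> a k = a' k" "\<And>k. k < n \<Longrightarrow> v k = v' k"
    and "\<And>k. k < n \<Longrightarrow> a k \<in> carrier R" "\<And>k. k < n \<Longrightarrow> v k \<in> carrier M"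
  shows "pairing M n a v = pairing M n a' v'"
  unfolding pairing_def by (rule M.finsum_cong') (use assms in auto)

lemma pairing_add_left:
  assumes "\<And>k. k < n \<Longrightarrow> a k \<in> carrier R" "\<And>k. k < n \<Longrightarrow> b k \<in> carrier R"
    "\<And>k. k < n \<Longrightarrow> v k \<in> carrier M"
  shows "pairing M n (\<lambda>k. a k \<oplus>\<^bsub>R\<^esub> b k) v = pairing M n a v \<oplus>\<^bsub>M\<^esub> pairing M n b v"
  using assms
proof (induction n)
  case (Suc n)
  then have "pairing M n a v \<in> carrier M" "pairing M n b v \<in> carrier M" by (auto intro!: pairing_closed)
  with Suc show ?case by (simp add: pairing_Suc smult_l_distr M.a_ac)
qed (simp add: pairing_0)

lemma pairing_add_right:
  assumes "\<And>k. k < n \<Longrightarrow> a k \<in> carrier R" "\<And>k. k < n \<Longrightarrow> v k \<in> carrier M"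
    "\<And>k. k < n \<Longrightarrow> w k \<in> carrier M"
  shows "pairing M n a (\<lambda>k. v k \<oplus>\<^bsub>M\<^esub> w k) = pairing M n a v \<oplus>\<^bsub>M\<^esub> pairing M n a w"
  using assms
proof (induction n)
  case (Suc n)
  then have "pairing M n a v \<in> carrier M" "pairing M n a w \<in> carrier M" by (auto intro!: pairing_closed)
  with Suc show ?case by (simp add: pairing_Suc smult_r_distr M.a_ac)
qed (simp add: pairing_0)

lemma pairing_smult_left:
  assumes "r \<in> carrier R" "\<And>k. k < n \<Longrightarrow> a k \<in> carrier R" "\<And>k. k < n \<Longrightarrow> v k \<in> carrier M"
  shows "pairing M n (\<lambda>k. r \<otimes>\<^bsub>R\<^esub> a k) v = r \<odot>\<^bsub>M\<^esub> pairing M n a v"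
  using assms
proof (induction n)
  case (Suc n)
  then have "pairing M n a v \<in> carrier M" by (auto intro!: pairing_closed)
  with Suc show ?case by (simp add: pairing_Suc smult_r_distr smult_assoc1)
qed (simp add: pairing_0)

lemma pairing_smult_right:
  assumes "r \<in> carrier R" "\<And>k. k < n \<Longrightarrow> a k \<in> carrier R" "\<And>k. k < n \<Longrightarrow> v k \<in> carrier M"
  shows "pairing M n a (\<lambda>k. r \<odot>\<^bsub>M\<^esub> v k) = r \<odot>\<^bsub>M\<^esub> pairing M n a v"
proof -
  have "pairing M n a (\<lambda>k. r \<odot>\<^bsub>M\<^esub> v k) = pairing M n (\<lambda>k. r \<otimes>\<^bsub>R\<^esub> a k) v"
    unfolding pairing_def
    by (rule M.finsum_cong') (use assms in \<open>auto simp: smult_assoc1[symmetric] m_comm\<close>)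
  then show ?thesis using pairing_smult_left assms by simp
qed

lemma pairing_zero_left:
  assumes "\<And>k. k < n \<Longrightarrow> v k \<in> carrier M"
  shows "pairing M n (\<lambda>k. \<zero>\<^bsub>R\<^esub>) v = \<zero>\<^bsub>M\<^esub>"
  using assms by (induction n) (simp_all add: pairing_0 pairing_Suc)

lemma pairing_zero_right:
  assumes "\<And>k. k < n \<Longrightarrow> a k \<in> carrier R"
  shows "pairing M n a (\<lambda>k. \<zero>\<^bsub>M\<^esub>) = \<zero>\<^bsub>M\<^esub>"
  using assms by (induction n) (simp_all add: pairing_0 pairing_Suc)

lemma pairing_unit:
  assumes "j < n" "r \<in> carrier R" "\<And>k. k < n \<Longrightarrow> v k \<in> carrier M"
  shows "pairing M n (\<lambda>k. if k = j then r else \<zero>\<^bsub>R\<^esub>) v = r \<odot>\<^bsub>M\<^esub> v j"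
  using assms
proof (induction n)
  case (Suc n)
  show ?case
  proof (cases "j = n")
    case True
    have "pairing M n (\<lambda>k. if k = j then r else \<zero>\<^bsub>R\<^esub>) v = pairing M n (\<lambda>k. \<zero>\<^bsub>R\<^esub>) v"
      using Suc.prems True by (intro pairing_cong) auto
    then show ?thesis using Suc.prems True by (simp add: pairing_Suc pairing_zero_left)
  next
    case False
    then show ?thesis using Suc by (simp add: pairing_Suc)
  qed
qed simp

text \<open>Interchange of summation; in terms of matrices, transposition is adjoint to the original map.\<close>

lemma pairing_swap:
  assumes "\<And>j k. j < q \<Longrightarrow> k < p \<Longrightarrow> A j k \<in> carrier R" "\<And>k. k < p \<Longrightarrow> a k \<in> carrier R"
    "\<And>j. j < q \<Longrightarrow> v j \<in> carrier M"
  shows "pairing M q (\<lambda>j. pairing (ring_module R) p (A j) a) v = pairing M p a (\<lambda>k. pairing M q (\<lambda>j. A j k) v)"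
  using assms
proof (induction p)
  case 0
  interpret RM: module R "ring_module R" by (rule R.ring_module_module)
  show ?case using 0 by (simp add: RM.pairing_0 pairing_0 pairing_zero_left)
next
  case (Suc p)
  interpret RM: module R "ring_module R" by (rule R.ring_module_module)
  have cl: "pairing (ring_module R) p (A j) a \<in> carrier R" if "j < q" for j
    using RM.pairing_closed[of p "A j" a] Suc.prems that by simp
  have cl2: "pairing M q (\<lambda>j. A j k) v \<in> carrier M" if "k < Suc p" for k
    using Suc.prems that by (intro pairing_closed) auto
  have "pairing M q (\<lambda>j. pairing (ring_module R) (Suc p) (A j) a) v
      = pairing M q (\<lambda>j. pairing (ring_module R) p (A j) a \<oplus>\<^bsub>R\<^esub> a p \<otimes>\<^bsub>R\<^esub> A j p) v"
    using Suc.prems cl by (intro pairing_cong) (auto simp: RM.pairing_Suc m_comm)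
  also have "\<dots> = pairing M q (\<lambda>j. pairing (ring_module R) p (A j) a) v
      \<oplus>\<^bsub>M\<^esub> a p \<odot>\<^bsub>M\<^esub> pairing M q (\<lambda>j. A j p) v"
    using Suc.prems cl by (simp add: pairing_add_left pairing_smult_left)
  also have "\<dots> = pairing M (Suc p) a (\<lambda>k. pairing M q (\<lambda>j. A j k) v)"
    using Suc cl2 by (simp add: pairing_Suc)
  finally show ?case .
qed

lemma pairing_scalar_vector:
  assumes "\<And>k. k < n \<Longrightarrow> a k \<in> carrier R" "\<And>k. k < n \<Longrightarrow> e k \<in> carrier R" "u \<in> carrier M"
  shows "pairing M n a (\<lambda>k. e k \<odot>\<^bsub>M\<^esub> u) = pairing (ring_module R) n a e \<odot>\<^bsub>M\<^esub> u"
proof -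
  interpret RM: module R "ring_module R" by (rule R.ring_module_module)
  show ?thesis using assms
  proof (induction n)
    case (Suc n)
    then have "pairing (ring_module R) n a e \<in> carrier R" using RM.pairing_closed[of n a e] by simp
    with Suc show ?case by (simp add: pairing_Suc RM.pairing_Suc smult_l_distr smult_assoc1)
  qed (simp add: pairing_0 RM.pairing_0)
qed

end

lemma pairing_hom:
  assumes "module R M" "module R M'" "f \<in> module_hom R M M'"
    and "\<And>k. k < n \<Longrightarrow> a k \<in> carrier R" "\<And>k. k < n \<Longrightarrow> v k \<in> carrier M"
  shows "pairing M' n a (\<lambda>k. f (v k)) = f (pairing M n a v)"
proof -
  interpret mod_hom R M M' f using assms by (simp add: mod_hom_def mod_hom_axioms_def)
  show ?thesis using assms(4,5)
  proof (induction n)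
    case (Suc n)
    then have "pairing M n a v \<in> carrier M" by (auto intro!: M.pairing_closed)
    with Suc show ?case by (simp add: M.pairing_Suc N.pairing_Suc)
  qed (simp add: M.pairing_0 N.pairing_0)
qed

lemma (in module) matrix_map_hom:
  assumes "\<And>j k. j < q \<Longrightarrow> k < p \<Longrightarrow> A j k \<in> carrier R"
  shows "matrix_map M q p A \<in> module_hom R (power_module M p) (power_module M q)"
proof -
  interpret P: module R "power_module M p" by (rule power_module_module)
  interpret Q: module R "power_module M q" by (rule power_module_module)
  note memD = power_module_memD[where M=M]
  have mem: "matrix_map M q p A c \<in> carrier (power_module M q)" if "c \<in> carrier (power_module M p)" for c
    unfolding matrix_map_pairing using assms memD[OF that]
    by (intro power_module_memI pairing_closed) auto
  have ap: "matrix_map M q p A c j = pairing M p (A j) c" if "j < q" for c j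
    using that by (simp add: matrix_map_pairing)
  show ?thesis unfolding module_hom_def
  proof (intro CollectI conjI allI impI)
    show "matrix_map M q p A \<in> carrier (power_module M p) \<rightarrow> carrier (power_module M q)" using mem by blast
  next
    fix c d assume "c \<in> carrier (power_module M p) \<and> d \<in> carrier (power_module M p)"
    then have c: "c \<in> carrier (power_module M p)" and d: "d \<in> carrier (power_module M p)" by auto
    show "matrix_map M q p A (c \<oplus>\<^bsub>power_module M p\<^esub> d) = matrix_map M q p A c \<oplus>\<^bsub>power_module M q\<^esub> matrix_map M q p A d"
    proof (rule power_module_eqI)
      fix j assume j: "j < q"
      have "pairing M p (A j) (c \<oplus>\<^bsub>power_module M p\<^esub> d) = pairing M p (A j) (\<lambda>k. c k \<oplus>\<^bsub>M\<^esub> d k)"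
        using assms j memD[OF c] memD[OF d] by (intro pairing_cong) (auto simp: power_module_apply)
      also have "\<dots> = pairing M p (A j) c \<oplus>\<^bsub>M\<^esub> pairing M p (A j) d"
        using assms j memD[OF c] memD[OF d] by (intro pairing_add_right) auto
      finally show "matrix_map M q p A (c \<oplus>\<^bsub>power_module M p\<^esub> d) j
          = (matrix_map M q p A c \<oplus>\<^bsub>power_module M q\<^esub> matrix_map M q p A d) j"
        using j by (simp add: ap power_module_apply)
    qed (use mem c d in auto)
  next
    fix r c assume "r \<in> carrier R \<and> c \<in> carrier (power_module M p)"
    then have r: "r \<in> carrier R" and c: "c \<in> carrier (power_module M p)" by auto
    show "matrix_map M q p A (r \<odot>\<^bsub>power_module M p\<^esub> c) = r \<odot>\<^bsub>power_module M q\<^esub> matrix_map M q p A c"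
    proof (rule power_module_eqI)
      fix j assume j: "j < q"
      have "pairing M p (A j) (r \<odot>\<^bsub>power_module M p\<^esub> c) = pairing M p (A j) (\<lambda>k. r \<odot>\<^bsub>M\<^esub> c k)"
        using assms j r memD[OF c] by (intro pairing_cong) (auto simp: power_module_apply)
      also have "\<dots> = r \<odot>\<^bsub>M\<^esub> pairing M p (A j) c"
        using assms j r memD[OF c] by (intro pairing_smult_right) auto
      finally show "matrix_map M q p A (r \<odot>\<^bsub>power_module M p\<^esub> c) j
          = (r \<odot>\<^bsub>power_module M q\<^esub> matrix_map M q p A c) j"
        using j by (simp add: ap power_module_apply)
    qed (use mem c r in auto)
  qed
qed

lemma (in mod_hom) kernel_submodule: "submodule R {x \<in> carrier M. f x = \<zero>\<^bsub>N\<^esub>} M"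
  by (rule submodule_criterion) (auto intro: M.module_axioms)

lemma (in mod_hom) image_submodule: "submodule R (f ` carrier M) N"
proof (rule submodule_criterion)
  show "\<zero>\<^bsub>N\<^esub> \<in> f ` carrier M" using f0_is_0 M.M.zero_closed by (metis imageI)
next
  fix u v assume "u \<in> f ` carrier M" "v \<in> f ` carrier M"
  then show "u \<oplus>\<^bsub>N\<^esub> v \<in> f ` carrier M" using f_add by (smt (verit) M.M.add.m_closed imageE imageI)
next
  fix r u assume "r \<in> carrier R" "u \<in> f ` carrier M"
  then show "r \<odot>\<^bsub>N\<^esub> u \<in> f ` carrier M" using f_smult by (smt (verit) M.smult_closed imageE imageI)
qed (auto intro: N.module_axioms)

section \<open>Free resolutions\<close>

text \<open>Generators of a submodule of a free module, written as the columns of a matrix.\<close>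

lemma (in cring) fg_submodule_matrix_image:
  assumes "fg_submodule R (power_module (ring_module R) n) L"
  shows "\<exists>p D. (\<forall>j<n. \<forall>k<p. D j k \<in> carrier R) \<and>
    L = matrix_map (ring_module R) n p D ` carrier (power_module (ring_module R) p)"
  using assms
proof induction
  case zero
  interpret RM: module R "ring_module R" by (rule ring_module_module)
  have "carrier (power_module (ring_module R) 0) \<noteq> {}" by (simp add: power_module_simps)
  moreover have "matrix_map (ring_module R) n 0 (\<lambda>_ _. \<zero>) c = \<zero>\<^bsub>power_module (ring_module R) n\<^esub>" for c
    by (simp add: matrix_map_pairing power_module_simps RM.pairing_0)
  ultimately show ?case by (intro exI[of _ 0] exI[of _ "\<lambda>_ _. \<zero>"]) auto
next
  case (add L z)
  interpret RM: module R "ring_module R" by (rule ring_module_module)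
  let ?F = "power_module (ring_module R)"
  obtain p D where D: "\<And>j k. j < n \<Longrightarrow> k < p \<Longrightarrow> D j k \<in> carrier R"
    and L: "L = matrix_map (ring_module R) n p D ` carrier (?F p)" using add.IH by blast
  define D' where "D' j k = (if k < p then D j k else z j)" for j k
  have zc: "z j \<in> carrier R" if "j < n" for j using power_module_memD[OF add(2) that] by simp
  have D': "D' j k \<in> carrier R" if "j < n" for j k
    using D zc that by (cases "k < p") (auto simp: D'_def)
  have key: "matrix_map (ring_module R) n (Suc p) D' c
      = matrix_map (ring_module R) n p D d \<oplus>\<^bsub>?F n\<^esub> r \<odot>\<^bsub>?F n\<^esub> z"
    if c: "\<And>k. k < p \<Longrightarrow> c k = d k" "c p = r" "\<And>k. k < p \<Longrightarrow> d k \<in> carrier R" "r \<in> carrier R" for c d r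
    unfolding power_module_simps matrix_map_pairing
  proof (rule restrict_ext)
    fix j assume j: "j \<in> {..<n}"
    have "pairing (ring_module R) (Suc p) (D' j) c = pairing (ring_module R) p (D' j) c \<oplus> D' j p \<otimes> c p"
      using D' j c by (subst RM.pairing_Suc) (auto simp: less_Suc_eq)
    also have "pairing (ring_module R) p (D' j) c = pairing (ring_module R) p (D j) d"
      using D j c by (intro RM.pairing_cong) (auto simp: D'_def)
    also have "D' j p \<otimes> c p = r \<otimes> z j" using c zc j by (simp add: D'_def m_comm)
    finally show "pairing (ring_module R) (Suc p) (D' j) c =
      (\<lambda>i\<in>{..<n}. pairing (ring_module R) p (D i) d) j \<oplus>\<^bsub>ring_module R\<^esub> (\<lambda>i\<in>{..<n}. r \<odot>\<^bsub>ring_module R\<^esub> z i) j"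
      using j by simp
  qed
  have "submodule_add (?F n) L (cyclic_submodule R (?F n) z) = matrix_map (ring_module R) n (Suc p) D' ` carrier (?F (Suc p))"
  proof (intro equalityI subsetI)
    fix u assume "u \<in> submodule_add (?F n) L (cyclic_submodule R (?F n) z)"
    then obtain d r where dr: "d \<in> carrier (?F p)" "r \<in> carrier R"
      "u = matrix_map (ring_module R) n p D d \<oplus>\<^bsub>?F n\<^esub> r \<odot>\<^bsub>?F n\<^esub> z"
      unfolding L submodule_add_def cyclic_submodule_def by blast
    define c where "c = (\<lambda>k\<in>{..<Suc p}. if k < p then d k else r)"
    have dc: "d k \<in> carrier R" if "k < p" for k using power_module_memD[OF dr(1) that] by simp
    have "c \<in> carrier (?F (Suc p))" unfolding c_def using dc dr(2) by (intro power_module_memI) simp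
    moreover have "matrix_map (ring_module R) n (Suc p) D' c = u"
      unfolding dr(3) by (rule key) (use dc dr(2) in \<open>auto simp: c_def\<close>)
    ultimately show "u \<in> matrix_map (ring_module R) n (Suc p) D' ` carrier (?F (Suc p))" by blast
  next
    fix u assume "u \<in> matrix_map (ring_module R) n (Suc p) D' ` carrier (?F (Suc p))"
    then obtain c where c: "c \<in> carrier (?F (Suc p))" "u = matrix_map (ring_module R) n (Suc p) D' c" by blast
    have cc: "c k \<in> carrier R" if "k < Suc p" for k using power_module_memD[OF c(1) that] by simp
    have "u = matrix_map (ring_module R) n p D (restrict c {..<p}) \<oplus>\<^bsub>?F n\<^esub> c p \<odot>\<^bsub>?F n\<^esub> z"
      unfolding c(2) by (rule key) (use cc in auto)
    moreover have "restrict c {..<p} \<in> carrier (?F p)" using cc by (intro power_module_memI) simp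
    ultimately show "u \<in> submodule_add (?F n) L (cyclic_submodule R (?F n) z)"
      unfolding L submodule_add_def cyclic_submodule_def using cc[of p] by blast
  qed
  then show ?case using D' by (intro exI[of _ "Suc p"] exI[of _ D']) simp
qed

text \<open>Start with the generator \<open>g\<close> and repeatedly cover the kernel of the last map by a free module of
  finite rank. The residue field is the cyclic module to resolve.\<close>

theorem (in cring) free_resolution_exists:
  assumes noeth: "noetherian_ring R" and M: "module R M" and g: "g \<in> carrier M"
    and gen: "carrier M = (\<lambda>r. r \<odot>\<^bsub>M\<^esub> g) ` carrier R"
  shows "\<exists>n e D. free_resolution R M n e D"
proof -
  interpret RM: module R "ring_module R" by (rule ring_module_module)
  interpret M: module R M by fact
  let ?F = "power_module (ring_module R)"
  let ?mm = "matrix_map (ring_module R)"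
  have cover: "\<exists>p D. (\<forall>j<n. \<forall>k<p. D j k \<in> carrier R) \<and> K = ?mm n p D ` carrier (?F p)"
    if "submodule R K (?F n)" for K n
    using fg_submodule_matrix_image submodule_of_free_fg[OF noeth that] by blast
  define aug where "aug c = pairing M 1 c (\<lambda>_. g)" for c
  have aug: "aug c = c 0 \<odot>\<^bsub>M\<^esub> g" if "c 0 \<in> carrier R" for c
    unfolding aug_def using M.pairing_Suc[of 0 c "\<lambda>_. g"] g that by (simp add: M.pairing_0)
  have F1c: "c 0 \<in> carrier R" if "c \<in> carrier (?F 1)" for c
    using power_module_memD[OF that, of 0] by simp
  have aug_hom: "aug \<in> module_hom R (?F 1) M"
    using g F1c by (auto simp: module_hom_def aug power_module_apply M.smult_l_distr M.smult_assoc1)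
  interpret F1: module R "?F 1" by (rule RM.power_module_module)
  interpret aug: mod_hom R "?F 1" M aug using aug_hom F1.module_axioms M by (simp add: mod_hom_def mod_hom_axioms_def)
  obtain p0 D0 where D0: "\<forall>j<1. \<forall>k<p0. D0 j k \<in> carrier R"
    "{c \<in> carrier (?F 1). aug c = \<zero>\<^bsub>M\<^esub>} = ?mm 1 p0 D0 ` carrier (?F p0)"
    using cover[OF aug.kernel_submodule] by blast
  \<comment> \<open>A state \<open>(q, p, D)\<close> is one differential with its two ranks; \<open>Q\<close> says that the next one is exact with it.\<close>
  define P where "P i s = (case s of (q, p, D) \<Rightarrow> (\<forall>j<q. \<forall>k<p. D j k \<in> carrier R) \<and>
      (i = 0 \<longrightarrow> q = 1 \<and> {c \<in> carrier (?F 1). aug c = \<zero>\<^bsub>M\<^esub>} = ?mm 1 p D ` carrier (?F p)))"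
    for i :: nat and s :: "nat \<times> nat \<times> (nat \<Rightarrow> nat \<Rightarrow> 'a)"
  define Q where "Q s s' = (case (s, s') of ((q, p, D), (q', p', D')) \<Rightarrow> q' = p \<and>
      {c \<in> carrier (?F p). ?mm q p D c = \<zero>\<^bsub>?F q\<^esub>} = ?mm p p' D' ` carrier (?F p'))"
    for s s' :: "nat \<times> nat \<times> (nat \<Rightarrow> nat \<Rightarrow> 'a)"
  have step: "\<exists>s'. P (Suc i) s' \<and> Q s s'" if Ps: "P i s" for i s
  proof -
    obtain q p D where s: "s = (q, p, D)" using prod_cases3 by blast
    have D: "\<And>j k. j < q \<Longrightarrow> k < p \<Longrightarrow> D j k \<in> carrier R" using Ps by (simp add: P_def s)
    interpret mh: mod_hom R "?F p" "?F q" "?mm q p D"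
      using RM.matrix_map_hom[OF D] RM.power_module_module by (simp add: mod_hom_def mod_hom_axioms_def)
    obtain p' D' where "\<forall>j<p. \<forall>k<p'. D' j k \<in> carrier R"
      "{c \<in> carrier (?F p). ?mm q p D c = \<zero>\<^bsub>?F q\<^esub>} = ?mm p p' D' ` carrier (?F p')"
      using cover[OF mh.kernel_submodule] by blast
    then show ?thesis by (intro exI[of _ "(p, p', D')"]) (simp add: P_def Q_def s)
  qed
  have "P 0 (1, p0, D0)" using D0 by (simp add: P_def)
  then obtain S where S: "\<And>i. P i (S i)" "\<And>i. Q (S i) (S (Suc i))"
    using dependent_nat_choice[of P "\<lambda>_. Q"] step by metis
  define n where "n i = fst (S i)" for i
  define D where "D i = snd (snd (S i))" for i
  have Seq: "S i = (n i, n (Suc i), D i)" for i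
  proof -
    have "fst (S (Suc i)) = fst (snd (S i))" using S(2)[of i] by (auto simp: Q_def split: prod.splits)
    then show ?thesis by (simp add: n_def D_def prod_eq_iff)
  qed
  have n0: "n 0 = 1" using S(1)[of 0] by (simp add: Seq P_def)
  have "free_resolution R M n (\<lambda>_. g) D"
    unfolding free_resolution_def Let_def pairing_def[symmetric]
  proof (intro conjI allI impI)
    fix j show "g \<in> carrier M" by (rule g)
  next
    fix i j k assume "j < n i" "k < n (Suc i)"
    then show "D i j k \<in> carrier R" using S(1)[of i] by (simp add: Seq P_def)
  next
    show "(\<lambda>c. pairing M (n 0) c (\<lambda>_. g)) ` carrier (?F (n 0)) = carrier M"
    proof (intro equalityI subsetI)
      fix u assume "u \<in> carrier M"
      then obtain r where r: "r \<in> carrier R" "u = r \<odot>\<^bsub>M\<^esub> g" using gen by blast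
      then have "(\<lambda>i\<in>{..<1}. r) \<in> carrier (?F 1)" "aug (\<lambda>i\<in>{..<1::nat}. r) = u"
        by (auto simp: aug intro: power_module_memI)
      then show "u \<in> (\<lambda>c. pairing M (n 0) c (\<lambda>_. g)) ` carrier (?F (n 0))"
        unfolding n0 aug_def by blast
    qed (use aug.f_im in \<open>auto simp: n0 aug_def\<close>)
  next
    show "{c \<in> carrier (?F (n 0)). pairing M (n 0) c (\<lambda>_. g) = \<zero>\<^bsub>M\<^esub>} = ?mm (n 0) (n (Suc 0)) (D 0) ` carrier (?F (n 1))"
      using S(1)[of 0] by (simp add: Seq P_def aug_def n0)
  next
    fix i
    show "{c \<in> carrier (?F (n (Suc i))). ?mm (n i) (n (Suc i)) (D i) c = \<zero>\<^bsub>?F (n i)\<^esub>} =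
         ?mm (n (Suc i)) (n (Suc (Suc i))) (D (Suc i)) ` carrier (?F (n (Suc (Suc i))))"
      using S(2)[of i] by (simp add: Seq Q_def)
  qed
  then show ?thesis by blast
qed

section \<open>The first Bass number\<close>

definition multiples :: "('a, 'v, 'x) module_scheme \<Rightarrow> 'a \<Rightarrow> 'v set" where
  "multiples M x = (\<lambda>c. x \<odot>\<^bsub>M\<^esub> c) ` carrier M"

text \<open>The preimage in \<open>M\<close> of the socle of \<open>M / x M\<close>.\<close>

definition socle_mod :: "('a, 'v, 'x) module_scheme \<Rightarrow> 'a set \<Rightarrow> 'a \<Rightarrow> 'v set" where
  "socle_mod M \<mm> x = {u \<in> carrier M. \<forall>r\<in>\<mm>. r \<odot>\<^bsub>M\<^esub> u \<in> multiples M x}"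

lemma (in abelian_group) eq_of_minus_eq_zero:
  assumes "c \<in> carrier G" "d \<in> carrier G" "c \<ominus> d = \<zero>"
  shows "c = d"
proof -
  have "c = (c \<ominus> d) \<oplus> d" using assms(1,2) by (simp add: a_minus_def a_assoc l_neg)
  then show ?thesis using assms by simp
qed

lemma (in module) multiples_submodule:
  assumes "x \<in> carrier R"
  shows "submodule R (multiples M x) M"
proof (rule submodule_criterion)
  show "module R M" ..
  show "multiples M x \<subseteq> carrier M" using assms by (auto simp: multiples_def)
  have "x \<odot>\<^bsub>M\<^esub> \<zero>\<^bsub>M\<^esub> \<in> multiples M x" unfolding multiples_def by blast
  then show "\<zero>\<^bsub>M\<^esub> \<in> multiples M x" using assms by simp
next
  fix u v assume "u \<in> multiples M x" "v \<in> multiples M x"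
  then show "u \<oplus>\<^bsub>M\<^esub> v \<in> multiples M x"
    using assms by (auto simp: multiples_def smult_r_distr[symmetric])
next
  fix r u assume r: "r \<in> carrier R" and "u \<in> multiples M x"
  then obtain c where c: "c \<in> carrier M" "u = x \<odot>\<^bsub>M\<^esub> c" by (auto simp: multiples_def)
  then have "r \<odot>\<^bsub>M\<^esub> u = x \<odot>\<^bsub>M\<^esub> (r \<odot>\<^bsub>M\<^esub> c)" using r assms by (simp add: smult_assoc1[symmetric] m_comm)
  then show "r \<odot>\<^bsub>M\<^esub> u \<in> multiples M x" using r c by (auto simp: multiples_def)
qed

lemma (in module) socle_mod_submodule:
  assumes "x \<in> carrier R" "\<mm> \<subseteq> carrier R"
  shows "submodule R (socle_mod M \<mm> x) M"
proof (rule submodule_criterion)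
  note X = multiples_submodule[OF assms(1)]
  show "module R M" ..
  show "socle_mod M \<mm> x \<subseteq> carrier M" by (auto simp: socle_mod_def)
  show "\<zero>\<^bsub>M\<^esub> \<in> socle_mod M \<mm> x"
    using submodule.zero_closed[OF X] assms by (auto simp: socle_mod_def subset_iff)
next
  note X = multiples_submodule[OF assms(1)]
  fix u v assume "u \<in> socle_mod M \<mm> x" "v \<in> socle_mod M \<mm> x"
  then show "u \<oplus>\<^bsub>M\<^esub> v \<in> socle_mod M \<mm> x"
    using submodule.m_closed[OF X] assms by (auto simp: socle_mod_def subset_iff smult_r_distr)
next
  note X = multiples_submodule[OF assms(1)]
  fix s u assume s: "s \<in> carrier R" and u: "u \<in> socle_mod M \<mm> x"
  have "r \<odot>\<^bsub>M\<^esub> (s \<odot>\<^bsub>M\<^esub> u) \<in> multiples M x" if r: "r \<in> \<mm>" for r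
  proof -
    have "r \<odot>\<^bsub>M\<^esub> (s \<odot>\<^bsub>M\<^esub> u) = s \<odot>\<^bsub>M\<^esub> (r \<odot>\<^bsub>M\<^esub> u)"
      using r s u assms by (auto simp: socle_mod_def smult_assoc1[symmetric] m_comm subset_iff)
    then show ?thesis using submodule.smult_closed[OF X s] u r by (auto simp: socle_mod_def)
  qed
  then show "s \<odot>\<^bsub>M\<^esub> u \<in> socle_mod M \<mm> x" using s u by (auto simp: socle_mod_def)
qed

lemma (in module) multiples_subset_socle_mod:
  assumes "x \<in> carrier R" "\<mm> \<subseteq> carrier R"
  shows "multiples M x \<subseteq> socle_mod M \<mm> x"
  using submodule.subset[OF multiples_submodule[OF assms(1)]]
    submodule.smult_closed[OF multiples_submodule[OF assms(1)]] assms(2)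
  by (auto simp: socle_mod_def)

lemma (in cring) pairing_ring_commute:
  assumes "\<And>k. k < n \<Longrightarrow> a k \<in> carrier R" "\<And>k. k < n \<Longrightarrow> v k \<in> carrier R"
  shows "pairing (ring_module R) n a v = pairing (ring_module R) n v a"
proof -
  interpret RM: module R "ring_module R" by (rule ring_module_module)
  show ?thesis
    unfolding pairing_def by (rule RM.M.finsum_cong') (use assms in \<open>auto simp: m_comm\<close>)
qed

lemma (in cring) pairing_ring_unit_right:
  assumes "j < n" "r \<in> carrier R" "\<And>k. k < n \<Longrightarrow> a k \<in> carrier R"
  shows "pairing (ring_module R) n a (\<lambda>k. if k = j then r else \<zero>) = r \<otimes> a j"
proof -
  interpret RM: module R "ring_module R" by (rule ring_module_module)
  show ?thesis
    using assms RM.pairing_unit[of j n r a] pairing_ring_commute[of n a "\<lambda>k. if k = j then r else \<zero>"] by simp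
qed

text \<open>For a nonzerodivisor \<open>x \<in> \<mm>\<close> on \<open>M\<close>, the connecting map of \<open>0 \<rightarrow> M \<rightarrow> M \<rightarrow> M / x M \<rightarrow> 0\<close> (multiplication
  by \<open>x\<close>) is an isomorphism \<open>Hom(k, M / x M) \<rightarrow> Ext\<^sup>1(k, M)\<close>, since \<open>Hom(k, M) = 0\<close> and \<open>x\<close> kills
  \<open>Ext\<^sup>1(k, M)\<close>. The proof writes this map down on cochains. The resolution enters only through
  its first two matrices \<open>D0\<close> and \<open>D1\<close> and representatives \<open>\<epsilon>\<close> in \<open>R\<close> of the chosen generators of \<open>k\<close>; the
  exactness hypotheses say that \<open>D0\<close> has image \<open>{c. \<Sum> c\<^sub>j \<epsilon>\<^sub>j \<in> \<mm>}\<close> and that \<open>D1\<close> maps onto the kernel of \<open>D0\<close>.\<close>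

theorem (in module) ext1_length:
  fixes \<epsilon> :: "nat \<Rightarrow> 'a" and D0 D1 :: "nat \<Rightarrow> nat \<Rightarrow> 'a"
  defines "RM \<equiv> ring_module R"
  assumes m: "maximalideal \<mm> R" and x: "x \<in> \<mm>"
    and reg: "\<And>c. c \<in> carrier M \<Longrightarrow> x \<odot>\<^bsub>M\<^esub> c = \<zero>\<^bsub>M\<^esub> \<Longrightarrow> c = \<zero>\<^bsub>M\<^esub>"
    and \<epsilon>: "\<And>j. j < n0 \<Longrightarrow> \<epsilon> j \<in> carrier R"
    and D0: "\<And>j k. j < n0 \<Longrightarrow> k < n1 \<Longrightarrow> D0 j k \<in> carrier R"
    and D1: "\<And>k l. k < n1 \<Longrightarrow> l < n2 \<Longrightarrow> D1 k l \<in> carrier R"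
    and unit: "\<exists>j<n0. \<epsilon> j \<notin> \<mm>"
    and exact0: "\<And>c. (\<And>j. j < n0 \<Longrightarrow> c j \<in> carrier R) \<Longrightarrow> pairing RM n0 c \<epsilon> \<in> \<mm> \<Longrightarrow>
      \<exists>a. (\<forall>k<n1. a k \<in> carrier R) \<and> (\<forall>j<n0. c j = pairing RM n1 (D0 j) a)"
    and complex0: "\<And>a. (\<And>k. k < n1 \<Longrightarrow> a k \<in> carrier R) \<Longrightarrow> pairing RM n0 (\<lambda>j. pairing RM n1 (D0 j) a) \<epsilon> \<in> \<mm>"
    and exact1: "\<And>a. (\<And>k. k < n1 \<Longrightarrow> a k \<in> carrier R) \<Longrightarrow> (\<And>j. j < n0 \<Longrightarrow> pairing RM n1 (D0 j) a = \<zero>) \<Longrightarrow>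
      \<exists>b. (\<forall>l<n2. b l \<in> carrier R) \<and> (\<forall>k<n1. a k = pairing RM n2 (D1 k) b)"
    and complex1: "\<And>b j. (\<And>l. l < n2 \<Longrightarrow> b l \<in> carrier R) \<Longrightarrow> j < n0 \<Longrightarrow>
      pairing RM n1 (D0 j) (\<lambda>k. pairing RM n2 (D1 k) b) = \<zero>"
  defines "H \<equiv> power_module M n1"
    and "Z \<equiv> {c \<in> carrier (power_module M n1). matrix_map M n2 n1 (\<lambda>l k. D1 k l) c = \<zero>\<^bsub>power_module M n2\<^esub>}"
    and "B \<equiv> matrix_map M n1 n0 (\<lambda>k j. D0 j k) ` carrier (power_module M n0)"
  shows "submodule R Z H" "submodule R B H" "B \<subseteq> Z"
    "rel_length R H B Z = rel_length R M (multiples M x) (socle_mod M \<mm> x)"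
    "\<And>r z. r \<in> \<mm> \<Longrightarrow> z \<in> Z \<Longrightarrow> r \<odot>\<^bsub>H\<^esub> z \<in> B"
proof -
  interpret m: maximalideal \<mm> R by fact
  interpret RM: module R RM unfolding RM_def by (rule R.ring_module_module)
  interpret H: module R H unfolding H_def by (rule power_module_module)
  have [simp]: "carrier RM = carrier R" "\<zero>\<^bsub>RM\<^esub> = \<zero>" "\<And>y z. y \<oplus>\<^bsub>RM\<^esub> z = y \<oplus> z" "\<And>y z. y \<odot>\<^bsub>RM\<^esub> z = y \<otimes> z"
    by (simp_all add: RM_def)
  note swap = pairing_swap[folded RM_def] and RMswap = RM.pairing_swap[folded RM_def, simplified]
  note scalar_vector = pairing_scalar_vector[folded RM_def]
  note RMcomm = R.pairing_ring_commute[folded RM_def]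
  note RMunit = R.pairing_ring_unit_right[folded RM_def]
  have RMcl: "pairing RM n a v \<in> carrier R" if "\<And>k. k < n \<Longrightarrow> a k \<in> carrier R" "\<And>k. k < n \<Longrightarrow> v k \<in> carrier R" for n a v
    using RM.pairing_closed[of n a v] that by simp
  have xR: "x \<in> carrier R" using x by (rule m.Icarr)
  have mR: "\<mm> \<subseteq> carrier R" using m.Icarr by blast
  have cancel: "c = d" if "c \<in> carrier M" "d \<in> carrier M" "x \<odot>\<^bsub>M\<^esub> c = x \<odot>\<^bsub>M\<^esub> d" for c d
  proof -
    have "x \<odot>\<^bsub>M\<^esub> (c \<ominus>\<^bsub>M\<^esub> d) = \<zero>\<^bsub>M\<^esub>"
      using that xR by (simp add: a_minus_def smult_r_distr smult_r_minus M.r_neg)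
    then have "c \<ominus>\<^bsub>M\<^esub> d = \<zero>\<^bsub>M\<^esub>" using reg that by simp
    then show ?thesis using that M.eq_of_minus_eq_zero by blast
  qed
  let ?X = "multiples M x" and ?U = "socle_mod M \<mm> x"
  note X = multiples_submodule[OF xR] and U = socle_mod_submodule[OF xR mR]
  note XU = multiples_subset_socle_mod[OF xR mR]
  have Uc: "u \<in> carrier M" if "u \<in> ?U" for u using that by (simp add: socle_mod_def)
  have XI: "x \<odot>\<^bsub>M\<^esub> c \<in> ?X" if "c \<in> carrier M" for c using that by (auto simp: multiples_def)

  \<comment> \<open>The augmentation of the \<open>k\<close>-th column of \<open>D0\<close>; it lies in \<open>\<mm>\<close>, so \<open>w\<^sub>k u\<close> is divisible by \<open>x\<close> for \<open>u\<close> in the socle.\<close>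
  define w where "w k = pairing RM n0 (\<lambda>j. D0 j k) \<epsilon>" for k
  have wc: "w k \<in> carrier R" if "k < n1" for k unfolding w_def using D0 \<epsilon> that by (intro RMcl) auto
  have pair_w: "pairing RM n0 (\<lambda>j. pairing RM n1 (D0 j) a) \<epsilon> = pairing RM n1 a w"
    if "\<And>k. k < n1 \<Longrightarrow> a k \<in> carrier R" for a
    unfolding w_def using D0 \<epsilon> that by (intro RMswap) auto
  have wm: "w k \<in> \<mm>" if k: "k < n1" for k
  proof -
    have "pairing RM n1 (\<lambda>i. if i = k then \<one> else \<zero>) w = w k"
      using RM.pairing_unit[OF k, of \<one> w] wc k by simp
    then show ?thesis using complex0[of "\<lambda>i. if i = k then \<one> else \<zero>"] pair_w[of "\<lambda>i. if i = k then \<one> else \<zero>"] by simp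
  qed
  have w_cocycle: "pairing RM n1 (\<lambda>k. D1 k l) w = \<zero>" if l: "l < n2" for l
  proof -
    let ?b = "\<lambda>i. if i = l then \<one> else \<zero>"
    have D1l: "pairing RM n2 (D1 k) ?b = D1 k l" if "k < n1" for k
      using RMunit[OF l, of \<one> "D1 k"] D1 l that by simp
    have "pairing RM n1 (\<lambda>k. D1 k l) w = pairing RM n1 (\<lambda>k. pairing RM n2 (D1 k) ?b) w"
      using D1l D1 l wc by (intro RM.pairing_cong) auto
    also have "\<dots> = pairing RM n0 (\<lambda>j. pairing RM n1 (D0 j) (\<lambda>k. pairing RM n2 (D1 k) ?b)) \<epsilon>"
      using D1l D1 l by (intro pair_w[symmetric]) auto
    also have "\<dots> = pairing RM n0 (\<lambda>j. \<zero>) \<epsilon>"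
      using complex1[of ?b] \<epsilon> by (intro RM.pairing_cong) auto
    also have "\<dots> = \<zero>" using RM.pairing_zero_left[of n0 \<epsilon>] \<epsilon> by simp
    finally show ?thesis .
  qed

  have D0T: "\<And>k j. k < n1 \<Longrightarrow> j < n0 \<Longrightarrow> D0 j k \<in> carrier R" and D1T: "\<And>l k. l < n2 \<Longrightarrow> k < n1 \<Longrightarrow> D1 k l \<in> carrier R"
    using D0 D1 by auto
  interpret d0: mod_hom R "power_module M n0" H "matrix_map M n1 n0 (\<lambda>k j. D0 j k)"
    using matrix_map_hom[of n1 n0 "\<lambda>k j. D0 j k"] D0T power_module_module H.module_axioms
    by (simp add: mod_hom_def mod_hom_axioms_def H_def)
  interpret d1: mod_hom R H "power_module M n2" "matrix_map M n2 n1 (\<lambda>l k. D1 k l)"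
    using matrix_map_hom[of n2 n1 "\<lambda>l k. D1 k l"] D1T power_module_module H.module_axioms
    by (simp add: mod_hom_def mod_hom_axioms_def H_def)
  show Z: "submodule R Z H" using d1.kernel_submodule unfolding Z_def H_def by simp
  show B: "submodule R B H" using d0.image_submodule unfolding B_def by simp
  have Hc: "h k \<in> carrier M" if "h \<in> carrier H" "k < n1" for h k
    using that power_module_memD unfolding H_def by blast
  have Z_iff: "h \<in> Z \<longleftrightarrow> h \<in> carrier H \<and> (\<forall>l<n2. pairing M n1 (\<lambda>k. D1 k l) h = \<zero>\<^bsub>M\<^esub>)" for h
  proof
    assume h: "h \<in> Z"
    then have "matrix_map M n2 n1 (\<lambda>l k. D1 k l) h l = \<zero>\<^bsub>M\<^esub>" if "l < n2" for l
      using that by (simp add: Z_def power_module_apply)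
    then show "h \<in> carrier H \<and> (\<forall>l<n2. pairing M n1 (\<lambda>k. D1 k l) h = \<zero>\<^bsub>M\<^esub>)"
      using h by (auto simp: Z_def H_def matrix_map_pairing)
  next
    assume "h \<in> carrier H \<and> (\<forall>l<n2. pairing M n1 (\<lambda>k. D1 k l) h = \<zero>\<^bsub>M\<^esub>)"
    then show "h \<in> Z" by (auto simp: Z_def H_def matrix_map_pairing power_module_simps intro!: restrict_ext)
  qed
  have B_iff: "h \<in> B \<longleftrightarrow> h \<in> carrier H \<and> (\<exists>b. (\<forall>j<n0. b j \<in> carrier M) \<and> (\<forall>k<n1. h k = pairing M n0 (\<lambda>j. D0 j k) b))" for h
  proof
    assume h: "h \<in> B"
    then obtain b where b: "b \<in> carrier (power_module M n0)" "h = matrix_map M n1 n0 (\<lambda>k j. D0 j k) b"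
      unfolding B_def by blast
    have "h \<in> carrier H" using h submodule.subset[OF B] by blast
    moreover have "\<forall>j<n0. b j \<in> carrier M" using power_module_memD[OF b(1)] by blast
    moreover have "\<forall>k<n1. h k = pairing M n0 (\<lambda>j. D0 j k) b" unfolding b(2) by (simp add: matrix_map_pairing)
    ultimately show "h \<in> carrier H \<and> (\<exists>b. (\<forall>j<n0. b j \<in> carrier M) \<and> (\<forall>k<n1. h k = pairing M n0 (\<lambda>j. D0 j k) b))"
      by blast
  next
    assume "h \<in> carrier H \<and> (\<exists>b. (\<forall>j<n0. b j \<in> carrier M) \<and> (\<forall>k<n1. h k = pairing M n0 (\<lambda>j. D0 j k) b))"
    then obtain b where h: "h \<in> carrier H" and b: "\<And>j. j < n0 \<Longrightarrow> b j \<in> carrier M"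
      "\<And>k. k < n1 \<Longrightarrow> h k = pairing M n0 (\<lambda>j. D0 j k) b" by blast
    let ?b = "\<lambda>j\<in>{..<n0}. b j"
    have bc: "?b \<in> carrier (power_module M n0)" using b(1) by (intro power_module_memI) simp
    have "h = matrix_map M n1 n0 (\<lambda>k j. D0 j k) ?b"
    proof (rule power_module_eqI[of _ M n1])
      fix k assume k: "k < n1"
      have "pairing M n0 (\<lambda>j. D0 j k) ?b = pairing M n0 (\<lambda>j. D0 j k) b"
        using D0 k b(1) by (intro pairing_cong) auto
      then show "h k = matrix_map M n1 n0 (\<lambda>k j. D0 j k) ?b k" using k b(2) by (simp add: matrix_map_pairing)
    qed (use h d0.f_im[OF bc] H_def in auto)
    then show "h \<in> B" unfolding B_def using bc by blast
  qed

  \<comment> \<open>The connecting map sends \<open>u\<close> to the cocycle \<open>w\<^sub>k u / x\<close>; the quotient is unique because \<open>x\<close> is a nonzerodivisor.\<close>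
  define q where "q v = (SOME c. c \<in> carrier M \<and> x \<odot>\<^bsub>M\<^esub> c = v)" for v
  have q: "q v \<in> carrier M \<and> x \<odot>\<^bsub>M\<^esub> q v = v" if "v \<in> ?X" for v
    unfolding q_def by (rule someI_ex) (use that in \<open>auto simp: multiples_def\<close>)
  define g where "g u = (\<lambda>k\<in>{..<n1}. q (w k \<odot>\<^bsub>M\<^esub> u))" for u
  have gk: "g u k \<in> carrier M" "x \<odot>\<^bsub>M\<^esub> g u k = w k \<odot>\<^bsub>M\<^esub> u" if "u \<in> ?U" "k < n1" for u k
    using q[of "w k \<odot>\<^bsub>M\<^esub> u"] wm that by (auto simp: g_def socle_mod_def)
  have gH: "g u \<in> carrier H" if "u \<in> ?U" for u
    using gk(1)[OF that] unfolding H_def g_def by (intro power_module_memI) simp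
  have gZ: "g u \<in> Z" if u: "u \<in> ?U" for u
    unfolding Z_iff
  proof (intro conjI allI impI)
    fix l assume l: "l < n2"
    have "x \<odot>\<^bsub>M\<^esub> pairing M n1 (\<lambda>k. D1 k l) (g u) = pairing M n1 (\<lambda>k. D1 k l) (\<lambda>k. x \<odot>\<^bsub>M\<^esub> g u k)"
      using gk(1)[OF u] D1 l xR by (intro pairing_smult_right[symmetric]) auto
    also have "\<dots> = pairing M n1 (\<lambda>k. D1 k l) (\<lambda>k. w k \<odot>\<^bsub>M\<^esub> u)"
      using gk[OF u] D1 l xR wc Uc[OF u] by (intro pairing_cong) auto
    also have "\<dots> = pairing RM n1 (\<lambda>k. D1 k l) w \<odot>\<^bsub>M\<^esub> u"
      using D1 l wc Uc[OF u] by (intro scalar_vector) auto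
    also have "\<dots> = \<zero>\<^bsub>M\<^esub>" using w_cocycle[OF l] Uc[OF u] by simp
    finally show "pairing M n1 (\<lambda>k. D1 k l) (g u) = \<zero>\<^bsub>M\<^esub>"
      using gk(1)[OF u] D1 l by - (rule reg[OF pairing_closed]; auto)
  qed (rule gH[OF u])
  have g_eqI: "g u = h" if "u \<in> ?U" "h \<in> carrier H" "\<And>k. k < n1 \<Longrightarrow> x \<odot>\<^bsub>M\<^esub> h k = w k \<odot>\<^bsub>M\<^esub> u" for u h
  proof (rule power_module_eqI[of _ M n1])
    fix k assume "k < n1"
    then show "g u k = h k" using gk[OF that(1)] Hc[OF that(2)] that(3) by - (rule cancel; auto)
  qed (use gH that H_def in auto)
  have g_add: "g (u \<oplus>\<^bsub>M\<^esub> v) = g u \<oplus>\<^bsub>H\<^esub> g v" if u: "u \<in> ?U" and v: "v \<in> ?U" for u v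
  proof (rule g_eqI)
    show "u \<oplus>\<^bsub>M\<^esub> v \<in> ?U" using submodule.m_closed[OF U] u v by blast
    show "g u \<oplus>\<^bsub>H\<^esub> g v \<in> carrier H" using gH u v by simp
    fix k assume "k < n1"
    then show "x \<odot>\<^bsub>M\<^esub> (g u \<oplus>\<^bsub>H\<^esub> g v) k = w k \<odot>\<^bsub>M\<^esub> (u \<oplus>\<^bsub>M\<^esub> v)"
      using gk[OF u] gk[OF v] wc Uc[OF u] Uc[OF v] xR by (simp add: H_def power_module_apply smult_r_distr)
  qed
  have g_smult: "g (r \<odot>\<^bsub>M\<^esub> u) = r \<odot>\<^bsub>H\<^esub> g u" if u: "u \<in> ?U" and r: "r \<in> carrier R" for u r
  proof (rule g_eqI)
    show "r \<odot>\<^bsub>M\<^esub> u \<in> ?U" using submodule.smult_closed[OF U] u r by blast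
    show "r \<odot>\<^bsub>H\<^esub> g u \<in> carrier H" using gH u r by simp
    fix k assume k: "k < n1"
    have "x \<odot>\<^bsub>M\<^esub> (r \<odot>\<^bsub>M\<^esub> g u k) = r \<odot>\<^bsub>M\<^esub> (x \<odot>\<^bsub>M\<^esub> g u k)"
      using gk(1)[OF u k] r xR by (simp add: smult_assoc1[symmetric] m_comm)
    also have "\<dots> = w k \<odot>\<^bsub>M\<^esub> (r \<odot>\<^bsub>M\<^esub> u)"
      using gk(2)[OF u k] r wc[OF k] Uc[OF u] by (simp add: smult_assoc1[symmetric] m_comm)
    finally show "x \<odot>\<^bsub>M\<^esub> (r \<odot>\<^bsub>H\<^esub> g u) k = w k \<odot>\<^bsub>M\<^esub> (r \<odot>\<^bsub>M\<^esub> u)"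
      using k by (simp add: H_def power_module_apply)
  qed

  \<comment> \<open>Some \<open>\<epsilon>\<close> is a unit modulo \<open>\<mm>\<close>; through this generator a homomorphism \<open>k \<rightarrow> M / x M\<close> is read off.\<close>
  obtain j0 where j0: "j0 < n0" "\<epsilon> j0 \<notin> \<mm>" using unit by blast
  obtain \<beta> \<gamma> where \<beta>: "\<beta> \<in> carrier R" "\<gamma> \<in> \<mm>" "\<one> = \<beta> \<otimes> \<epsilon> j0 \<oplus> \<gamma>"
    using maximalideal_unit_mod[OF m \<epsilon>[OF j0(1)] j0(2)] by blast
  note \<epsilon>0 = \<epsilon>[OF j0(1)]
  have \<gamma>R: "\<gamma> \<in> carrier R" using \<beta>(2) mR by blast

  have g_ker: "g u \<in> B \<longleftrightarrow> u \<in> ?X" if u: "u \<in> ?U" for u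
  proof
    assume "u \<in> ?X"
    then obtain c where c: "c \<in> carrier M" "u = x \<odot>\<^bsub>M\<^esub> c" by (auto simp: multiples_def)
    have "g u k = pairing M n0 (\<lambda>j. D0 j k) (\<lambda>j. \<epsilon> j \<odot>\<^bsub>M\<^esub> c)" if k: "k < n1" for k
    proof -
      have "x \<odot>\<^bsub>M\<^esub> g u k = w k \<odot>\<^bsub>M\<^esub> (x \<odot>\<^bsub>M\<^esub> c)" using gk(2)[OF u k] c by simp
      also have "\<dots> = x \<odot>\<^bsub>M\<^esub> (w k \<odot>\<^bsub>M\<^esub> c)" using wc[OF k] xR c(1) by (simp add: smult_assoc1[symmetric] m_comm)
      finally have "g u k = w k \<odot>\<^bsub>M\<^esub> c" using gk(1)[OF u k] wc[OF k] c(1) by - (rule cancel; auto)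
      also have "\<dots> = pairing M n0 (\<lambda>j. D0 j k) (\<lambda>j. \<epsilon> j \<odot>\<^bsub>M\<^esub> c)"
        unfolding w_def using D0 k \<epsilon> c(1) by (intro scalar_vector[symmetric]) auto
      finally show ?thesis .
    qed
    then show "g u \<in> B" unfolding B_iff using gH[OF u] \<epsilon> c(1) by (intro conjI exI[of _ "\<lambda>j. \<epsilon> j \<odot>\<^bsub>M\<^esub> c"]) auto
  next
    assume "g u \<in> B"
    then obtain b where b: "\<And>j. j < n0 \<Longrightarrow> b j \<in> carrier M"
      "\<And>k. k < n1 \<Longrightarrow> g u k = pairing M n0 (\<lambda>j. D0 j k) b" unfolding B_iff by blast
    have bj0: "b j0 \<in> carrier M" using b(1) j0(1) .
    let ?c = "\<lambda>j. if j = j0 then x else \<zero>"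
    have ce: "pairing RM n0 ?c \<epsilon> = x \<otimes> \<epsilon> j0" using RM.pairing_unit[OF j0(1) xR, of \<epsilon>] \<epsilon> by simp
    then have "pairing RM n0 ?c \<epsilon> \<in> \<mm>" using x \<epsilon>0 m.I_r_closed by simp
    then obtain a where a: "\<And>k. k < n1 \<Longrightarrow> a k \<in> carrier R" "\<And>j. j < n0 \<Longrightarrow> ?c j = pairing RM n1 (D0 j) a"
      using exact0[of ?c] xR by force
    have "x \<odot>\<^bsub>M\<^esub> b j0 = pairing M n0 ?c b" using pairing_unit[OF j0(1) xR, of b] b(1) by simp
    also have "\<dots> = pairing M n0 (\<lambda>j. pairing RM n1 (D0 j) a) b"
      using b(1) xR by (intro pairing_cong) (auto simp: a(2)[symmetric])
    also have "\<dots> = pairing M n1 a (\<lambda>k. pairing M n0 (\<lambda>j. D0 j k) b)"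
      using D0 a(1) b(1) by (intro swap) auto
    also have "\<dots> = pairing M n1 a (g u)"
      using b a(1) D0 by (intro pairing_cong) (auto intro!: pairing_closed)
    finally have "x \<odot>\<^bsub>M\<^esub> (x \<odot>\<^bsub>M\<^esub> b j0) = x \<odot>\<^bsub>M\<^esub> pairing M n1 a (g u)" by simp
    also have "\<dots> = pairing M n1 a (\<lambda>k. x \<odot>\<^bsub>M\<^esub> g u k)"
      using gk(1)[OF u] a(1) xR by (intro pairing_smult_right[symmetric]) auto
    also have "\<dots> = pairing M n1 a (\<lambda>k. w k \<odot>\<^bsub>M\<^esub> u)"
      using gk[OF u] a(1) xR wc Uc[OF u] by (intro pairing_cong) auto
    also have "\<dots> = pairing RM n1 a w \<odot>\<^bsub>M\<^esub> u" using a(1) wc Uc[OF u] by (intro scalar_vector) auto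
    also have "pairing RM n1 a w = pairing RM n0 (\<lambda>j. pairing RM n1 (D0 j) a) \<epsilon>" using pair_w[of a] a(1) by simp
    also have "\<dots> = pairing RM n0 ?c \<epsilon>"
      using a D0 \<epsilon> by (intro RM.pairing_cong) (auto intro!: RMcl)
    also have "\<dots> \<odot>\<^bsub>M\<^esub> u = x \<odot>\<^bsub>M\<^esub> (\<epsilon> j0 \<odot>\<^bsub>M\<^esub> u)" using ce xR \<epsilon>0 Uc[OF u] by (simp add: smult_assoc1)
    finally have eq: "x \<odot>\<^bsub>M\<^esub> b j0 = \<epsilon> j0 \<odot>\<^bsub>M\<^esub> u"
      using xR bj0 \<epsilon>0 Uc[OF u] by - (rule cancel; auto)
    have "u = (\<beta> \<otimes> \<epsilon> j0 \<oplus> \<gamma>) \<odot>\<^bsub>M\<^esub> u" using \<beta>(3)[symmetric] Uc[OF u] by simp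
    also have "\<dots> = \<beta> \<odot>\<^bsub>M\<^esub> (\<epsilon> j0 \<odot>\<^bsub>M\<^esub> u) \<oplus>\<^bsub>M\<^esub> \<gamma> \<odot>\<^bsub>M\<^esub> u"
      using \<beta>(1) \<gamma>R \<epsilon>0 Uc[OF u] by (simp add: smult_l_distr smult_assoc1)
    also have "\<dots> \<in> ?X"
      unfolding eq[symmetric] using \<beta> u XI[OF bj0] submodule.m_closed[OF X] submodule.smult_closed[OF X]
      by (auto simp: socle_mod_def)
    finally show "u \<in> ?X" .
  qed

  \<comment> \<open>A cocycle \<open>h\<close> is a functional on the image of \<open>D0\<close>. As \<open>x\<close> times any vector is in this image, \<open>h\<close> extends to the
    whole free module with values \<open>\<theta>\<^sub>j / x\<close>, where \<open>\<theta>\<^sub>j = h(x e\<^sub>j)\<close>. Modulo \<open>x M\<close> the functional \<open>\<theta>\<close> factors through \<open>k\<close>,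
    so it is \<open>\<epsilon>\<^sub>j u\<close> for a socle element \<open>u\<close>, and the difference is a coboundary.\<close>
  have g_surj: "\<exists>u\<in>?U. \<exists>d\<in>B. h = g u \<oplus>\<^bsub>H\<^esub> d" if "h \<in> Z" for h
  proof -
    have hH: "h \<in> carrier H" and hco: "\<And>l. l < n2 \<Longrightarrow> pairing M n1 (\<lambda>k. D1 k l) h = \<zero>\<^bsub>M\<^esub>"
      using that Z_iff by auto
    note hk = Hc[OF hH]
    have K0: "pairing M n1 a h = \<zero>\<^bsub>M\<^esub>"
      if a: "\<And>k. k < n1 \<Longrightarrow> a k \<in> carrier R" "\<And>j. j < n0 \<Longrightarrow> pairing RM n1 (D0 j) a = \<zero>" for a
    proof -
      obtain b where b: "\<And>l. l < n2 \<Longrightarrow> b l \<in> carrier R" "\<And>k. k < n1 \<Longrightarrow> a k = pairing RM n2 (D1 k) b"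
        using exact1[OF a] by blast
      have "pairing M n1 a h = pairing M n1 (\<lambda>k. pairing RM n2 (D1 k) b) h"
        using a(1) b(2) hk by (intro pairing_cong) auto
      also have "\<dots> = pairing M n2 b (\<lambda>l. pairing M n1 (\<lambda>k. D1 k l) h)"
        using D1 b(1) hk by (intro swap) auto
      also have "\<dots> = pairing M n2 b (\<lambda>l. \<zero>\<^bsub>M\<^esub>)"
        using hco b(1) by (intro pairing_cong) auto
      also have "\<dots> = \<zero>\<^bsub>M\<^esub>" using b(1) by (rule pairing_zero_right)
      finally show ?thesis .
    qed
    have K1: "pairing M n1 a h = pairing M n1 a' h"
      if a: "\<And>k. k < n1 \<Longrightarrow> a k \<in> carrier R" "\<And>k. k < n1 \<Longrightarrow> a' k \<in> carrier R"
        "\<And>j. j < n0 \<Longrightarrow> pairing RM n1 (D0 j) a = pairing RM n1 (D0 j) a'" for a a'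
    proof -
      let ?d = "\<lambda>k. a k \<oplus> (\<ominus> \<one>) \<otimes> a' k"
      have "pairing M n1 ?d h = \<zero>\<^bsub>M\<^esub>"
      proof (rule K0)
        fix j assume j: "j < n0"
        have "pairing RM n1 (D0 j) ?d = pairing RM n1 (D0 j) a \<oplus> pairing RM n1 (D0 j) (\<lambda>k. (\<ominus> \<one>) \<otimes> a' k)"
          using RM.pairing_add_right[of n1 "D0 j" a "\<lambda>k. (\<ominus> \<one>) \<otimes> a' k"] D0 j a by simp
        also have "pairing RM n1 (D0 j) (\<lambda>k. (\<ominus> \<one>) \<otimes> a' k) = (\<ominus> \<one>) \<otimes> pairing RM n1 (D0 j) a'"
          using RM.pairing_smult_right[of "\<ominus> \<one>" n1 "D0 j" a'] D0 j a by simp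
        finally show "pairing RM n1 (D0 j) ?d = \<zero>"
          using a(3)[OF j] RMcl[of n1 "D0 j" a'] D0[OF j] a(2) by (simp add: R.l_minus R.r_neg)
      qed (use a in auto)
      moreover have "pairing M n1 ?d h = pairing M n1 a h \<oplus>\<^bsub>M\<^esub> (\<ominus> \<one>) \<odot>\<^bsub>M\<^esub> pairing M n1 a' h"
        using a hk by (simp add: pairing_add_left pairing_smult_left)
      moreover have cl: "pairing M n1 a h \<in> carrier M" "pairing M n1 a' h \<in> carrier M"
        using a hk by (auto intro!: pairing_closed)
      ultimately have "pairing M n1 a h \<ominus>\<^bsub>M\<^esub> pairing M n1 a' h = \<zero>\<^bsub>M\<^esub>"
        by (simp add: smult_l_minus a_minus_def)
      then show ?thesis using cl M.eq_of_minus_eq_zero by blast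
    qed
    have "\<exists>a. (\<forall>k<n1. a k \<in> carrier R) \<and> (\<forall>i<n0. (if i = j then x else \<zero>) = pairing RM n1 (D0 i) a)" if j: "j < n0" for j
    proof (rule exact0)
      have "pairing RM n0 (\<lambda>i. if i = j then x else \<zero>) \<epsilon> = x \<otimes> \<epsilon> j"
        using RM.pairing_unit[OF j xR, of \<epsilon>] \<epsilon> by simp
      then show "pairing RM n0 (\<lambda>i. if i = j then x else \<zero>) \<epsilon> \<in> \<mm>" using x \<epsilon>[OF j] m.I_r_closed by simp
    qed (use xR in auto)
    then obtain A where A: "\<And>j k. j < n0 \<Longrightarrow> k < n1 \<Longrightarrow> A j k \<in> carrier R"
      "\<And>i j. i < n0 \<Longrightarrow> j < n0 \<Longrightarrow> pairing RM n1 (D0 i) (A j) = (if i = j then x else \<zero>)"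
      by metis
    define \<theta> where "\<theta> j = pairing M n1 (A j) h" for j
    have \<theta>c: "\<theta> j \<in> carrier M" if "j < n0" for j unfolding \<theta>_def using A(1)[OF that] hk by (intro pairing_closed) auto
    have K2: "x \<odot>\<^bsub>M\<^esub> pairing M n1 a h = pairing M n0 c \<theta>"
      if a: "\<And>k. k < n1 \<Longrightarrow> a k \<in> carrier R" and c: "\<And>j. j < n0 \<Longrightarrow> c j \<in> carrier R"
        and ca: "\<And>j. j < n0 \<Longrightarrow> pairing RM n1 (D0 j) a = c j" for a c
    proof -
      define s where "s k = pairing RM n0 (\<lambda>j. A j k) c" for k
      have sc: "s k \<in> carrier R" if "k < n1" for k unfolding s_def using A(1) c that by (intro RMcl) auto
      have "pairing M n1 s h = pairing M n0 c (\<lambda>j. pairing M n1 (\<lambda>k. A j k) h)"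
        unfolding s_def using A(1) c hk by (intro swap) auto
      then have s1: "pairing M n1 s h = pairing M n0 c \<theta>" unfolding \<theta>_def .
      have "pairing M n1 s h = pairing M n1 (\<lambda>k. x \<otimes> a k) h"
      proof (rule K1)
        fix i assume i: "i < n0"
        have "pairing RM n1 (D0 i) s = pairing RM n1 s (D0 i)" using sc D0[OF i] by (intro RMcomm) auto
        also have "\<dots> = pairing RM n0 c (\<lambda>j. pairing RM n1 (\<lambda>k. A j k) (D0 i))"
          unfolding s_def using A(1) c D0[OF i] by (intro RMswap) auto
        also have "\<dots> = pairing RM n0 c (\<lambda>j. if j = i then x else \<zero>)"
        proof (rule RM.pairing_cong)
          fix j assume j: "j < n0"
          have "pairing RM n1 (A j) (D0 i) = pairing RM n1 (D0 i) (A j)"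
            using A(1)[OF j] D0[OF i] by (intro RMcomm) auto
          then show "pairing RM n1 (\<lambda>k. A j k) (D0 i) = (if j = i then x else \<zero>)" using A(2)[OF i j] by auto
          show "pairing RM n1 (\<lambda>k. A j k) (D0 i) \<in> carrier RM"
            using A(1)[OF j] D0[OF i] RMcl[of n1 "A j" "D0 i"] by simp
        qed (use c in auto)
        also have "\<dots> = x \<otimes> c i" using RMunit[OF i xR, of c] c by simp
        also have "\<dots> = pairing RM n1 (D0 i) (\<lambda>k. x \<otimes> a k)"
          using RM.pairing_smult_right[of x n1 "D0 i" a] xR D0[OF i] a ca[OF i] by simp
        finally show "pairing RM n1 (D0 i) s = pairing RM n1 (D0 i) (\<lambda>k. x \<otimes> a k)" .
      qed (use sc a xR in auto)
      also have "\<dots> = x \<odot>\<^bsub>M\<^esub> pairing M n1 a h" using xR a hk by (intro pairing_smult_left) auto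
      finally show ?thesis using s1 by simp
    qed
    have K3: "pairing M n0 c \<theta> \<in> ?X" if c: "\<And>j. j < n0 \<Longrightarrow> c j \<in> carrier R" "pairing RM n0 c \<epsilon> \<in> \<mm>" for c
    proof -
      obtain a where a: "\<And>k. k < n1 \<Longrightarrow> a k \<in> carrier R" "\<And>j. j < n0 \<Longrightarrow> c j = pairing RM n1 (D0 j) a"
        using exact0[OF c] by blast
      have "pairing M n0 c \<theta> = x \<odot>\<^bsub>M\<^esub> pairing M n1 a h" by (rule K2[OF a(1) c(1) a(2)[symmetric], symmetric])
      then show ?thesis using a(1) hk by (auto intro!: XI pairing_closed)
    qed
    have r\<theta>: "r \<odot>\<^bsub>M\<^esub> \<theta> j0 \<in> ?X" if r: "r \<in> \<mm>" for r
    proof -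
      have rR: "r \<in> carrier R" using r mR by blast
      have "pairing RM n0 (\<lambda>j. if j = j0 then r else \<zero>) \<epsilon> = r \<otimes> \<epsilon> j0"
        using RM.pairing_unit[OF j0(1), of r \<epsilon>] \<epsilon> rR by simp
      then have "pairing M n0 (\<lambda>j. if j = j0 then r else \<zero>) \<theta> \<in> ?X"
        using r \<epsilon>0 m.I_r_closed rR by (intro K3) auto
      then show ?thesis using pairing_unit[OF j0(1) rR, of \<theta>] \<theta>c by simp
    qed
    define u where "u = \<beta> \<odot>\<^bsub>M\<^esub> \<theta> j0"
    have uc: "u \<in> carrier M" unfolding u_def using \<beta> \<theta>c[OF j0(1)] by simp
    have uU: "u \<in> ?U"
    proof -
      have "r \<odot>\<^bsub>M\<^esub> u \<in> ?X" if r: "r \<in> \<mm>" for r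
      proof -
        have rR: "r \<in> carrier R" using r mR by blast
        have "r \<odot>\<^bsub>M\<^esub> u = \<beta> \<odot>\<^bsub>M\<^esub> (r \<odot>\<^bsub>M\<^esub> \<theta> j0)"
          unfolding u_def using rR \<beta>(1) \<theta>c[OF j0(1)] by (simp add: smult_assoc1[symmetric] m_comm)
        then show ?thesis using submodule.smult_closed[OF X \<beta>(1) r\<theta>[OF r]] by simp
      qed
      then show ?thesis using uc by (simp add: socle_mod_def)
    qed
    have "\<exists>b\<in>carrier M. \<theta> j = \<epsilon> j \<odot>\<^bsub>M\<^esub> u \<oplus>\<^bsub>M\<^esub> x \<odot>\<^bsub>M\<^esub> b" if j: "j < n0" for j
    proof -
      let ?c1 = "\<lambda>i. if i = j then \<one> else \<zero>" and ?c2 = "\<lambda>i. if i = j0 then \<ominus> (\<epsilon> j \<otimes> \<beta>) else \<zero>"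
      note \<epsilon>j = \<epsilon>[OF j]
      have eb: "\<ominus> (\<epsilon> j \<otimes> \<beta>) \<in> carrier R" using \<epsilon>j \<beta>(1) by simp
      have "pairing RM n0 (\<lambda>i. ?c1 i \<oplus> ?c2 i) \<epsilon> = pairing RM n0 ?c1 \<epsilon> \<oplus> pairing RM n0 ?c2 \<epsilon>"
        using RM.pairing_add_left[of n0 ?c1 ?c2 \<epsilon>] \<epsilon> eb by simp
      also have "\<dots> = \<epsilon> j \<oplus> \<ominus> (\<epsilon> j \<otimes> \<beta>) \<otimes> \<epsilon> j0"
        using RM.pairing_unit[OF j, of \<one> \<epsilon>] RM.pairing_unit[OF j0(1) eb, of \<epsilon>] \<epsilon> \<epsilon>j by simp
      also have "\<dots> = \<epsilon> j \<otimes> (\<beta> \<otimes> \<epsilon> j0 \<oplus> \<gamma>) \<oplus> \<ominus> (\<epsilon> j \<otimes> \<beta>) \<otimes> \<epsilon> j0"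
        using \<beta>(3)[symmetric] \<epsilon>j by simp
      also have "\<dots> = \<epsilon> j \<otimes> \<gamma>"
        using \<beta>(1) \<gamma>R \<epsilon>j \<epsilon>0 by (simp add: R.r_distr R.l_minus R.m_assoc R.a_ac R.r_neg R.r_neg1 R.r_neg2)
      finally have "pairing RM n0 (\<lambda>i. ?c1 i \<oplus> ?c2 i) \<epsilon> \<in> \<mm>" using \<beta>(2) \<epsilon>j m.I_l_closed by simp
      then have "pairing M n0 (\<lambda>i. ?c1 i \<oplus> ?c2 i) \<theta> \<in> ?X" using eb by (intro K3) auto
      moreover have "pairing M n0 (\<lambda>i. ?c1 i \<oplus> ?c2 i) \<theta> = \<theta> j \<oplus>\<^bsub>M\<^esub> \<ominus>\<^bsub>M\<^esub> (\<epsilon> j \<odot>\<^bsub>M\<^esub> u)"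
      proof -
        have "pairing M n0 (\<lambda>i. ?c1 i \<oplus> ?c2 i) \<theta> = pairing M n0 ?c1 \<theta> \<oplus>\<^bsub>M\<^esub> pairing M n0 ?c2 \<theta>"
          using pairing_add_left[of n0 ?c1 ?c2 \<theta>] \<theta>c eb by simp
        then show ?thesis
          using pairing_unit[OF j, of \<one> \<theta>] pairing_unit[OF j0(1) eb, of \<theta>] \<theta>c j j0(1) \<epsilon>j \<beta>(1)
          by (simp add: u_def smult_l_minus smult_assoc1)
      qed
      ultimately obtain b where b: "b \<in> carrier M" "\<theta> j \<oplus>\<^bsub>M\<^esub> \<ominus>\<^bsub>M\<^esub> (\<epsilon> j \<odot>\<^bsub>M\<^esub> u) = x \<odot>\<^bsub>M\<^esub> b"
        by (auto simp: multiples_def)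
      have "\<epsilon> j \<odot>\<^bsub>M\<^esub> u \<oplus>\<^bsub>M\<^esub> x \<odot>\<^bsub>M\<^esub> b = \<theta> j"
        unfolding b(2)[symmetric] using \<theta>c[OF j] \<epsilon>j uc by (simp add: M.a_ac M.r_neg M.r_neg1 M.r_neg2)
      then show ?thesis using b(1) by (intro bexI[of _ b]) simp_all
    qed
    then obtain b where b: "\<And>j. j < n0 \<Longrightarrow> b j \<in> carrier M" "\<And>j. j < n0 \<Longrightarrow> \<theta> j = \<epsilon> j \<odot>\<^bsub>M\<^esub> u \<oplus>\<^bsub>M\<^esub> x \<odot>\<^bsub>M\<^esub> b j"
      by metis
    define d where "d = (\<lambda>k\<in>{..<n1}. pairing M n0 (\<lambda>j. D0 j k) b)"
    have dk: "pairing M n0 (\<lambda>j. D0 j k) b \<in> carrier M" if "k < n1" for k using D0 that b(1) by (intro pairing_closed) auto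
    have dH: "d \<in> carrier H" unfolding d_def H_def using dk by (intro power_module_memI)
    have dB: "d \<in> B" unfolding B_iff using dH b(1) by (intro conjI exI[of _ b]) (auto simp: d_def)
    have "h = g u \<oplus>\<^bsub>H\<^esub> d"
    proof (rule power_module_eqI[of _ M n1])
      fix k assume k: "k < n1"
      let ?a = "\<lambda>i. if i = k then \<one> else \<zero>"
      have "x \<odot>\<^bsub>M\<^esub> h k = x \<odot>\<^bsub>M\<^esub> pairing M n1 ?a h" using pairing_unit[OF k, of \<one> h] hk k by simp
      also have "\<dots> = pairing M n0 (\<lambda>j. D0 j k) \<theta>"
        using RMunit[OF k, of \<one>] D0 k by (intro K2) auto
      also have "\<dots> = pairing M n0 (\<lambda>j. D0 j k) (\<lambda>j. \<epsilon> j \<odot>\<^bsub>M\<^esub> u \<oplus>\<^bsub>M\<^esub> x \<odot>\<^bsub>M\<^esub> b j)"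
        using b D0 k \<theta>c by (intro pairing_cong) auto
      also have "\<dots> = pairing M n0 (\<lambda>j. D0 j k) (\<lambda>j. \<epsilon> j \<odot>\<^bsub>M\<^esub> u) \<oplus>\<^bsub>M\<^esub> pairing M n0 (\<lambda>j. D0 j k) (\<lambda>j. x \<odot>\<^bsub>M\<^esub> b j)"
        using D0 k \<epsilon> uc b(1) xR by (intro pairing_add_right) auto
      also have "\<dots> = w k \<odot>\<^bsub>M\<^esub> u \<oplus>\<^bsub>M\<^esub> x \<odot>\<^bsub>M\<^esub> pairing M n0 (\<lambda>j. D0 j k) b"
        unfolding w_def using D0 k \<epsilon> uc b(1) xR by (simp add: scalar_vector pairing_smult_right)
      also have "\<dots> = x \<odot>\<^bsub>M\<^esub> (g u k \<oplus>\<^bsub>M\<^esub> pairing M n0 (\<lambda>j. D0 j k) b)"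
        using gk[OF uU k] dk[OF k] xR by (simp add: smult_r_distr)
      finally have "h k = g u k \<oplus>\<^bsub>M\<^esub> pairing M n0 (\<lambda>j. D0 j k) b"
        using hk[OF k] gk(1)[OF uU k] dk[OF k] by - (rule cancel; auto)
      then show "h k = (g u \<oplus>\<^bsub>H\<^esub> d) k" using k by (simp add: H_def power_module_apply d_def)
    qed (use hH gH[OF uU] dH H.M.a_closed[OF gH[OF uU] dH] H_def in auto)
    with uU dB show ?thesis by blast
  qed

  show BZ: "B \<subseteq> Z"
  proof
    fix h assume h: "h \<in> B"
    then obtain b where hH: "h \<in> carrier H" and b: "\<And>j. j < n0 \<Longrightarrow> b j \<in> carrier M"
      "\<And>k. k < n1 \<Longrightarrow> h k = pairing M n0 (\<lambda>j. D0 j k) b" unfolding B_iff by blast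
    have "pairing M n1 (\<lambda>k. D1 k l) h = \<zero>\<^bsub>M\<^esub>" if l: "l < n2" for l
    proof -
      let ?u = "\<lambda>i. if i = l then \<one> else \<zero>"
      have D1l: "pairing RM n2 (D1 k) ?u = D1 k l" if "k < n1" for k
        using RMunit[OF l, of \<one> "D1 k"] D1 l that by simp
      have "pairing M n1 (\<lambda>k. D1 k l) h = pairing M n1 (\<lambda>k. D1 k l) (\<lambda>k. pairing M n0 (\<lambda>j. D0 j k) b)"
        using b(2) D1 l Hc[OF hH] by (intro pairing_cong) auto
      also have "\<dots> = pairing M n0 (\<lambda>j. pairing RM n1 (D0 j) (\<lambda>k. D1 k l)) b"
        using D0 D1 l b(1) by (intro swap[symmetric]) auto
      also have "\<dots> = pairing M n0 (\<lambda>j. \<zero>) b"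
      proof (rule pairing_cong)
        fix j assume j: "j < n0"
        have "pairing RM n1 (D0 j) (\<lambda>k. D1 k l) = pairing RM n1 (D0 j) (\<lambda>k. pairing RM n2 (D1 k) ?u)"
          using D0[OF j] D1 l D1l by (intro RM.pairing_cong) auto
        then show "pairing RM n1 (D0 j) (\<lambda>k. D1 k l) = \<zero>" using complex1[of ?u j] j by simp
        then show "pairing RM n1 (D0 j) (\<lambda>k. D1 k l) \<in> carrier R" by simp
      qed (use b(1) in auto)
      also have "\<dots> = \<zero>\<^bsub>M\<^esub>" using b(1) by (rule pairing_zero_left)
      finally show ?thesis .
    qed
    then show "h \<in> Z" unfolding Z_iff using hH by blast
  qed
  have scal: "\<exists>s\<in>carrier R. \<forall>u\<in>?U. \<exists>d\<in>B. r \<odot>\<^bsub>H\<^esub> g u = g (s \<odot>\<^bsub>M\<^esub> u) \<oplus>\<^bsub>H\<^esub> d" if r: "r \<in> carrier R" for r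
    using r g_smult gH submodule.zero_closed[OF B]
    by (intro bexI[of _ r] ballI bexI[of _ "\<zero>\<^bsub>H\<^esub>"]) auto
  have scal': "\<exists>s\<in>carrier R. \<forall>u\<in>?U. \<exists>d\<in>B. g (r \<odot>\<^bsub>M\<^esub> u) = s \<odot>\<^bsub>H\<^esub> g u \<oplus>\<^bsub>H\<^esub> d" if r: "r \<in> carrier R" for r
    using r g_smult gH submodule.zero_closed[OF B]
    by (intro bexI[of _ r] ballI bexI[of _ "\<zero>\<^bsub>H\<^esub>"]) auto
  show "rel_length R H B Z = rel_length R M ?X ?U"
  proof (rule antisym)
    show "rel_length R H B Z \<le> rel_length R M ?X ?U"
      by (rule rel_length_transfer_ge[OF X U B Z BZ gZ g_add g_ker XU g_surj scal'])
    show "rel_length R M ?X ?U \<le> rel_length R H B Z"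
      by (rule rel_length_transfer_le[OF X U XU B Z gZ g_add g_ker BZ scal])
  qed
  show "r \<odot>\<^bsub>H\<^esub> z \<in> B" if r: "r \<in> \<mm>" and z: "z \<in> Z" for r z
  proof -
    obtain u d where u: "u \<in> ?U" "d \<in> B" "z = g u \<oplus>\<^bsub>H\<^esub> d" using g_surj[OF z] by blast
    have rR: "r \<in> carrier R" using r mR by blast
    have ruX: "r \<odot>\<^bsub>M\<^esub> u \<in> ?X" using u(1) r by (simp add: socle_mod_def)
    have "r \<odot>\<^bsub>H\<^esub> z = g (r \<odot>\<^bsub>M\<^esub> u) \<oplus>\<^bsub>H\<^esub> r \<odot>\<^bsub>H\<^esub> d"
      using u rR gH[OF u(1)] g_smult[OF u(1) rR] submodule.subset[OF B] by (auto simp: H.smult_r_distr)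
    moreover have "g (r \<odot>\<^bsub>M\<^esub> u) \<in> B" using g_ker[of "r \<odot>\<^bsub>M\<^esub> u"] ruX XU by blast
    ultimately show ?thesis
      using submodule.m_closed[OF B] submodule.smult_closed[OF B rR u(2)] by simp
  qed
qed

lemma ring_module_minus: "x \<ominus>\<^bsub>ring_module R\<^esub> y = x \<ominus>\<^bsub>R\<^esub> y"
  by (simp add: a_minus_def a_inv_def m_inv_def ring_module_def)

lemma (in module) pairing_in_submodule:
  assumes N: "submodule R N M" and "\<And>k. k < n \<Longrightarrow> a k \<in> carrier R" "\<And>k. k < n \<Longrightarrow> v k \<in> N"
  shows "pairing M n a v \<in> N"
  using assms(2,3)
proof (induction n)
  case 0
  then show ?case using submodule.zero_closed[OF N] by (simp add: pairing_0)
next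
  case (Suc n)
  then show ?case
    using submodule.subset[OF N] submodule.m_closed[OF N] submodule.smult_closed[OF N]
    by (subst pairing_Suc) auto
qed

text \<open>The definition of \<open>Ext\<close> fixes an arbitrary free resolution of the residue field; lifting its
  augmentation to \<open>R\<close> puts it into the form of the previous theorem.\<close>

theorem (in cring) bass_number_1:
  assumes noeth: "noetherian_ring R" and m: "maximalideal \<mm> R" "max_ideal R = \<mm>"
    and M: "module R M" and x: "x \<in> \<mm>"
    and reg: "\<And>c. c \<in> carrier M \<Longrightarrow> x \<odot>\<^bsub>M\<^esub> c = \<zero>\<^bsub>M\<^esub> \<Longrightarrow> c = \<zero>\<^bsub>M\<^esub>"
    and len: "rel_length R M (multiples M x) (socle_mod M \<mm> x) = enat l"
  shows "bass_number R 1 M = l"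
proof -
  let ?RM = "ring_module R"
  let ?F = "power_module ?RM"
  interpret RM: module R ?RM by (rule ring_module_module)
  interpret M: module R M by fact
  interpret m: maximalideal \<mm> R by fact
  define k where "k = residue_field_module R"
  have k_quot: "k = quot_module (?RM\<lparr>carrier := carrier R\<rparr>) \<mm>"
    by (simp add: k_def residue_field_module_def ring_module_def m(2))
  have mS: "submodule R \<mm> ?RM" using submodule_ring_module_iff m.ideal_axioms by simp
  have RS: "submodule R (carrier R) ?RM" using submodule_ring_module_iff oneideal by simp
  have mR: "\<mm> \<subseteq> carrier R" using m.Icarr by blast
  interpret k: module R k unfolding k_quot by (rule quot_module_module[OF mS RS mR])
  define \<pi> where "\<pi> r = \<mm> +>\<^bsub>?RM\<^esub> r" for r
  have carrk: "carrier k = \<pi> ` carrier R" unfolding k_quot \<pi>_def by (rule quot_module_carrier)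
  have zerok: "\<zero>\<^bsub>k\<^esub> = \<mm>" unfolding k_quot by (simp add: quot_module_simps)
  have \<pi>_smult: "r \<odot>\<^bsub>k\<^esub> \<pi> s = \<pi> (r \<otimes> s)" if "r \<in> carrier R" "s \<in> carrier R" for r s
    unfolding k_quot \<pi>_def using quot_module_smult[OF mS, of r s "carrier R"] that by simp
  have \<pi>_add: "\<pi> r \<oplus>\<^bsub>k\<^esub> \<pi> s = \<pi> (r \<oplus> s)" if "r \<in> carrier R" "s \<in> carrier R" for r s
    unfolding k_quot \<pi>_def using quot_module_add[OF mS, of r s "carrier R"] that by simp
  have \<pi>: "\<pi> \<in> module_hom R ?RM k" using carrk by (auto simp: module_hom_def \<pi>_add \<pi>_smult)
  have \<pi>_zero: "\<pi> r = \<zero>\<^bsub>k\<^esub> \<longleftrightarrow> r \<in> \<mm>" if r: "r \<in> carrier R" for r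
  proof -
    have "\<pi> r = \<pi> \<zero> \<longleftrightarrow> r \<ominus>\<^bsub>?RM\<^esub> \<zero> \<in> \<mm>" unfolding \<pi>_def using coset_eq_iff[OF mS, of r \<zero>] r by simp
    moreover have "r \<ominus>\<^bsub>?RM\<^esub> \<zero> = r" using r by (subst ring_module_minus) (simp add: a_minus_def)
    moreover have "\<pi> \<zero> = \<mm>" unfolding \<pi>_def using submodule_coset_zero[OF mS] by simp
    ultimately show ?thesis using zerok by simp
  qed
  have "carrier k = (\<lambda>r. r \<odot>\<^bsub>k\<^esub> \<pi> \<one>) ` carrier R"
    unfolding carrk
  proof (rule image_cong)
    fix r assume r: "r \<in> carrier R"
    show "\<pi> r = r \<odot>\<^bsub>k\<^esub> \<pi> \<one>" unfolding \<pi>_smult[OF r one_closed] using r by simp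
  qed simp
  then have "\<exists>n e D. free_resolution R k n e D"
    using free_resolution_exists[OF noeth k.module_axioms, of "\<pi> \<one>"] carrk one_closed by blast
  then have "\<exists>t. (case t of (n, e, D) \<Rightarrow> free_resolution R k n e D)" by auto
  then have some: "case (SOME (n, e, D). free_resolution R k n e D) of (n, e, D) \<Rightarrow> free_resolution R k n e D"
    by (rule someI_ex)
  obtain n e D where t: "(SOME (n, e, D). free_resolution R k n e D) = (n, e, D)" using prod_cases3 by blast
  have res: "free_resolution R k n e D" using some unfolding t by simp
  note fr = res[unfolded free_resolution_def Let_def pairing_def[symmetric]]
  have e: "e j \<in> carrier k" if "j < n 0" for j using fr that by simp
  have Dc: "D i j l \<in> carrier R" if "j < n i" "l < n (Suc i)" for i j l using fr that by simp
  have aug_surj: "(\<lambda>c. pairing k (n 0) c e) ` carrier (?F (n 0)) = carrier k" using fr by simp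
  have ker0: "{c \<in> carrier (?F (n 0)). pairing k (n 0) c e = \<zero>\<^bsub>k\<^esub>}
      = matrix_map ?RM (n 0) (n 1) (D 0) ` carrier (?F (n 1))" using fr by simp
  have ker1: "{c \<in> carrier (?F (n 1)). matrix_map ?RM (n 0) (n 1) (D 0) c = \<zero>\<^bsub>?F (n 0)\<^esub>}
      = matrix_map ?RM (n 1) (n 2) (D 1) ` carrier (?F (n 2))"
    using fr by (simp add: numeral_2_eq_2)
  have "\<forall>j. \<exists>r. j < n 0 \<longrightarrow> r \<in> carrier R \<and> e j = \<pi> r" using e carrk by blast
  then have "\<exists>\<epsilon>. \<forall>j. j < n 0 \<longrightarrow> \<epsilon> j \<in> carrier R \<and> e j = \<pi> (\<epsilon> j)" by (rule choice)
  then obtain \<epsilon> where \<epsilon>: "\<And>j. j < n 0 \<Longrightarrow> \<epsilon> j \<in> carrier R" "\<And>j. j < n 0 \<Longrightarrow> e j = \<pi> (\<epsilon> j)" by blast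
  have RMcl: "pairing ?RM p a v \<in> carrier R" if "\<And>j. j < p \<Longrightarrow> a j \<in> carrier R" "\<And>j. j < p \<Longrightarrow> v j \<in> carrier R" for p a v
    using RM.pairing_closed[of p a v] that by simp
  have aug: "pairing k (n 0) c e = \<pi> (pairing ?RM (n 0) c \<epsilon>)" if c: "\<And>j. j < n 0 \<Longrightarrow> c j \<in> carrier R" for c
  proof -
    have "pairing k (n 0) c e = pairing k (n 0) c (\<lambda>j. \<pi> (\<epsilon> j))"
      using c e \<epsilon>(2) by (intro k.pairing_cong) auto
    then show ?thesis using pairing_hom[OF RM.module_axioms k.module_axioms \<pi>, of "n 0" c \<epsilon>] c \<epsilon>(1) by simp
  qed
  have aug_zero: "pairing k (n 0) c e = \<zero>\<^bsub>k\<^esub> \<longleftrightarrow> pairing ?RM (n 0) c \<epsilon> \<in> \<mm>"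
    if c: "\<And>j. j < n 0 \<Longrightarrow> c j \<in> carrier R" for c
    using aug[OF c] \<pi>_zero RMcl[OF c \<epsilon>(1)] by simp
  have Fc: "c j \<in> carrier R" if "c \<in> carrier (?F p)" "j < p" for c p j
    using power_module_memD[OF that] by simp
  have Fr: "restrict c {..<p} \<in> carrier (?F p)" if "\<And>j. j < p \<Longrightarrow> c j \<in> carrier R" for c p
    using that by (intro power_module_memI) simp
  have restr: "pairing ?RM p a (restrict v {..<p}) = pairing ?RM p a v"
    if "\<And>j. j < p \<Longrightarrow> a j \<in> carrier R" "\<And>j. j < p \<Longrightarrow> v j \<in> carrier R" for p a v
    using that by (intro RM.pairing_cong) auto
  have restl: "pairing ?RM p (restrict a {..<p}) v = pairing ?RM p a v"
    if "\<And>j. j < p \<Longrightarrow> a j \<in> carrier R" "\<And>j. j < p \<Longrightarrow> v j \<in> carrier R" for p a v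
    using that by (intro RM.pairing_cong) auto
  have mm: "matrix_map ?RM q p A c j = pairing ?RM p (A j) c" if "j < q" for q p A c j
    using that by (simp add: matrix_map_pairing)
  have unit: "\<exists>j<n 0. \<epsilon> j \<notin> \<mm>"
  proof (rule ccontr)
    assume "\<not> ?thesis"
    then have all: "\<And>j. j < n 0 \<Longrightarrow> \<epsilon> j \<in> \<mm>" by blast
    have "\<pi> \<one> \<in> (\<lambda>c. pairing k (n 0) c e) ` carrier (?F (n 0))" unfolding aug_surj carrk by blast
    then obtain c where c: "c \<in> carrier (?F (n 0))" "\<pi> \<one> = pairing k (n 0) c e" by blast
    have "pairing ?RM (n 0) c \<epsilon> \<in> \<mm>" using RM.pairing_in_submodule[OF mS Fc[OF c(1)] all] by simp
    then have "\<pi> \<one> = \<zero>\<^bsub>k\<^esub>" using aug_zero[OF Fc[OF c(1)]] c(2) by simp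
    then have "\<one> \<in> \<mm>" using \<pi>_zero by simp
    then show False using m.one_imp_carrier m.I_notcarr by simp
  qed
  have exact0: "\<exists>a. (\<forall>i<n 1. a i \<in> carrier R) \<and> (\<forall>j<n 0. c j = pairing ?RM (n 1) (D 0 j) a)"
    if c: "\<And>j. j < n 0 \<Longrightarrow> c j \<in> carrier R" "pairing ?RM (n 0) c \<epsilon> \<in> \<mm>" for c
  proof -
    let ?c = "restrict c {..<n 0}"
    have "pairing ?RM (n 0) ?c \<epsilon> \<in> \<mm>" using c restl[OF c(1) \<epsilon>(1)] by simp
    then have "?c \<in> {c \<in> carrier (?F (n 0)). pairing k (n 0) c e = \<zero>\<^bsub>k\<^esub>}"
      using Fr[OF c(1)] aug_zero[of ?c] c(1) by simp
    then obtain a where a: "a \<in> carrier (?F (n 1))" "?c = matrix_map ?RM (n 0) (n 1) (D 0) a" unfolding ker0 by blast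
    have "c j = pairing ?RM (n 1) (D 0 j) a" if "j < n 0" for j
      using fun_cong[OF a(2), of j] that by (simp add: mm)
    then show ?thesis using Fc[OF a(1)] by blast
  qed
  have complex0: "pairing ?RM (n 0) (\<lambda>j. pairing ?RM (n 1) (D 0 j) a) \<epsilon> \<in> \<mm>"
    if a: "\<And>i. i < n 1 \<Longrightarrow> a i \<in> carrier R" for a
  proof -
    let ?a = "restrict a {..<n 1}" and ?c = "matrix_map ?RM (n 0) (n 1) (D 0) (restrict a {..<n 1})"
    have "?c \<in> {c \<in> carrier (?F (n 0)). pairing k (n 0) c e = \<zero>\<^bsub>k\<^esub>}" unfolding ker0 by (rule imageI[OF Fr[OF a]])
    then have c: "?c \<in> carrier (?F (n 0))" "pairing k (n 0) ?c e = \<zero>\<^bsub>k\<^esub>" by (simp_all only: mem_Collect_eq)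
    have "pairing ?RM (n 0) ?c \<epsilon> \<in> \<mm>" using aug_zero[OF Fc[OF c(1)]] c(2) by (simp only: simp_thms)
    moreover have "pairing ?RM (n 0) ?c \<epsilon> = pairing ?RM (n 0) (\<lambda>j. pairing ?RM (n 1) (D 0 j) a) \<epsilon>"
    proof (rule RM.pairing_cong)
      fix j assume j: "j < n 0"
      have Dj: "\<And>i. i < n 1 \<Longrightarrow> D 0 j i \<in> carrier R" using Dc[of j 0] j by simp
      show "?c j = pairing ?RM (n 1) (D 0 j) a" using restr[OF Dj a] j by (simp add: mm)
      then show "?c j \<in> carrier R" using RMcl[OF Dj a] by simp
    qed (use \<epsilon> in auto)
    ultimately show ?thesis by (simp only:)
  qed
  have exact1: "\<exists>b. (\<forall>l<n 2. b l \<in> carrier R) \<and> (\<forall>i<n 1. a i = pairing ?RM (n 2) (D 1 i) b)"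
    if a: "\<And>i. i < n 1 \<Longrightarrow> a i \<in> carrier R" "\<And>j. j < n 0 \<Longrightarrow> pairing ?RM (n 1) (D 0 j) a = \<zero>" for a
  proof -
    let ?a = "restrict a {..<n 1}"
    have "matrix_map ?RM (n 0) (n 1) (D 0) ?a = \<zero>\<^bsub>?F (n 0)\<^esub>"
      unfolding matrix_map_pairing power_module_simps
    proof (rule restrict_ext)
      fix j assume "j \<in> {..<n 0}"
      then have j: "j < n 0" by simp
      have Dj: "\<And>i. i < n 1 \<Longrightarrow> D 0 j i \<in> carrier R" using Dc[of j 0] j by simp
      show "pairing ?RM (n 1) (D 0 j) ?a = \<zero>\<^bsub>?RM\<^esub>" using restr[OF Dj a(1)] a(2)[OF j] by simp
    qed
    then have "?a \<in> {c \<in> carrier (?F (n 1)). matrix_map ?RM (n 0) (n 1) (D 0) c = \<zero>\<^bsub>?F (n 0)\<^esub>}"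
      using Fr[OF a(1)] by simp
    then obtain b where b: "b \<in> carrier (?F (n 2))" "?a = matrix_map ?RM (n 1) (n 2) (D 1) b" unfolding ker1 by blast
    have "a i = pairing ?RM (n 2) (D 1 i) b" if "i < n 1" for i
      using fun_cong[OF b(2), of i] that by (simp add: mm)
    then show ?thesis using Fc[OF b(1)] by blast
  qed
  have complex1: "pairing ?RM (n 1) (D 0 j) (\<lambda>i. pairing ?RM (n 2) (D 1 i) b) = \<zero>"
    if b: "\<And>l. l < n 2 \<Longrightarrow> b l \<in> carrier R" and j: "j < n 0" for b j
  proof -
    let ?c = "matrix_map ?RM (n 1) (n 2) (D 1) (restrict b {..<n 2})"
    have Dj: "\<And>i. i < n 1 \<Longrightarrow> D 0 j i \<in> carrier R" using Dc[of j 0] j by simp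
    have "?c \<in> {c \<in> carrier (?F (n 1)). matrix_map ?RM (n 0) (n 1) (D 0) c = \<zero>\<^bsub>?F (n 0)\<^esub>}"
      unfolding ker1 by (rule imageI[OF Fr[OF b]])
    then have "matrix_map ?RM (n 0) (n 1) (D 0) ?c j = \<zero>" using j by (simp add: power_module_simps)
    then have "pairing ?RM (n 1) (D 0 j) ?c = \<zero>" using j by (simp add: mm)
    moreover have "pairing ?RM (n 1) (D 0 j) ?c = pairing ?RM (n 1) (D 0 j) (\<lambda>i. pairing ?RM (n 2) (D 1 i) b)"
    proof (rule RM.pairing_cong)
      fix i assume i: "i < n 1"
      have Di: "\<And>l. l < n 2 \<Longrightarrow> D 1 i l \<in> carrier R" using Dc[of i 1] i by (simp add: numeral_2_eq_2)
      show "?c i = pairing ?RM (n 2) (D 1 i) b" using restr[OF Di b] i by (simp add: mm)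
      then show "?c i \<in> carrier ?RM" using RMcl[OF Di b] by simp
    qed (use Dj in auto)
    ultimately show ?thesis by simp
  qed
  have D1c: "D 1 j l \<in> carrier R" if "j < n 1" "l < n 2" for j l
    using Dc[of j 1 l] that by (simp add: numeral_2_eq_2)
  have D0c: "D 0 j l \<in> carrier R" if "j < n 0" "l < n 1" for j l
    using Dc[of j 0 l] that by simp
  note ext = M.ext1_length[OF m(1) x reg \<epsilon>(1) D0c D1c unit exact0 complex0 exact1 complex1]
  have Ext: "Ext_module R 1 k M = quot_module
      ((power_module M (n 1))\<lparr>carrier := {c \<in> carrier (power_module M (n 1)).
          matrix_map M (n 2) (n 1) (\<lambda>l i. D 1 i l) c = \<zero>\<^bsub>power_module M (n 2)\<^esub>}\<rparr>)
      (matrix_map M (n 1) (n 0) (\<lambda>i j. D 0 j i) ` carrier (power_module M (n 0)))"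
    unfolding Ext_module_def t by (simp add: numeral_2_eq_2)
  show ?thesis
    unfolding bass_number_def k_def[symmetric] Ext
    by (rule residue_dim_eq_rel_length[OF m ext(2,1,3,5) trans[OF ext(4) len]])
qed

section \<open>One-dimensional local rings\<close>

lemma (in noetherian_ring) maximal_ideal_in_family:
  assumes "\<F> \<noteq> {}" "\<And>J. J \<in> \<F> \<Longrightarrow> ideal J R"
  obtains P where "P \<in> \<F>" "\<forall>J\<in>\<F>. P \<subseteq> J \<longrightarrow> J = P"
proof -
  have "\<exists>P\<in>\<F>. \<forall>J\<in>\<F>. P \<subseteq> J \<longrightarrow> J = P"
  proof (rule subset_Zorn_nonempty[OF assms(1)])
    fix C assume C: "C \<noteq> {}" "subset.chain \<F> C"
    then have "C \<subseteq> \<F>" by (simp add: subset_chain_def)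
    then have "subset.chain {J. ideal J R} C" using C(2) assms(2) by (simp add: subset_chain_def subset_iff)
    then have "\<Union>C \<in> C" using ideal_chain_is_trivial C(1) by simp
    then show "\<Union>C \<in> \<F>" using \<open>C \<subseteq> \<F>\<close> by (rule rev_subsetD)
  qed
  then show ?thesis using that by (elim bexE) simp
qed

lemma (in noetherian_ring) proper_ideal_in_maximal:
  assumes "ideal J R" "J \<noteq> carrier R"
  shows "\<exists>\<mm>. maximalideal \<mm> R \<and> J \<subseteq> \<mm>"
proof -
  let ?F = "{K. ideal K R \<and> J \<subseteq> K \<and> K \<noteq> carrier R}"
  have F: "?F \<noteq> {}" "\<And>K. K \<in> ?F \<Longrightarrow> ideal K R" using assms by auto
  obtain \<mm> where m: "\<mm> \<in> ?F" "\<forall>K\<in>?F. \<mm> \<subseteq> K \<longrightarrow> K = \<mm>"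
    by (rule maximal_ideal_in_family[OF F])
  have "maximalideal \<mm> R"
  proof (rule maximalidealI)
    show "ideal \<mm> R" "carrier R \<noteq> \<mm>" using m(1) by auto
    fix K assume K: "ideal K R" "\<mm> \<subseteq> K" "K \<subseteq> carrier R"
    show "K = \<mm> \<or> K = carrier R"
    proof (cases "K = carrier R")
      case False
      then have "K \<in> ?F" using K m(1) by auto
      then show ?thesis using bspec[OF m(2), of K] K(2) by simp
    qed simp
  qed
  with m show ?thesis by blast
qed

definition ideal_quot :: "('a, 'r) ring_scheme \<Rightarrow> 'a set \<Rightarrow> 'a \<Rightarrow> 'a set" where
  "ideal_quot R J z = {r \<in> carrier R. r \<otimes>\<^bsub>R\<^esub> z \<in> J}"

lemma (in cring) idealI_comm:
  assumes "J \<subseteq> carrier R" "\<zero> \<in> J" "\<And>x y. x \<in> J \<Longrightarrow> y \<in> J \<Longrightarrow> x \<oplus> y \<in> J"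
    "\<And>r x. r \<in> carrier R \<Longrightarrow> x \<in> J \<Longrightarrow> r \<otimes> x \<in> J"
  shows "ideal J R"
  unfolding submodule_ring_module_iff[symmetric]
  by (rule submodule_criterion) (use assms ring_module_module in auto)

lemma (in cring) ideal_closed:
  assumes "ideal J R"
  shows "J \<subseteq> carrier R" "\<zero> \<in> J" "x \<in> J \<Longrightarrow> y \<in> J \<Longrightarrow> x \<oplus> y \<in> J"
    "r \<in> carrier R \<Longrightarrow> x \<in> J \<Longrightarrow> r \<otimes> x \<in> J" "r \<in> carrier R \<Longrightarrow> x \<in> J \<Longrightarrow> x \<otimes> r \<in> J"
proof -
  interpret ideal J R by fact
  show "J \<subseteq> carrier R" "\<zero> \<in> J" "x \<in> J \<Longrightarrow> y \<in> J \<Longrightarrow> x \<oplus> y \<in> J"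
    "r \<in> carrier R \<Longrightarrow> x \<in> J \<Longrightarrow> r \<otimes> x \<in> J" "r \<in> carrier R \<Longrightarrow> x \<in> J \<Longrightarrow> x \<otimes> r \<in> J"
    using Icarr I_l_closed I_r_closed by auto
qed

lemma (in cring) ideal_quot_ideal:
  assumes J: "ideal J R" and z: "z \<in> carrier R"
  shows "ideal (ideal_quot R J z) R"
proof (rule idealI_comm)
  show "ideal_quot R J z \<subseteq> carrier R" by (auto simp: ideal_quot_def)
  show "\<zero> \<in> ideal_quot R J z" using z ideal_closed(2)[OF J] by (simp add: ideal_quot_def)
next
  fix x y assume "x \<in> ideal_quot R J z" "y \<in> ideal_quot R J z"
  then show "x \<oplus> y \<in> ideal_quot R J z"
    using z ideal_closed(3)[OF J, of "x \<otimes> z" "y \<otimes> z"] by (simp add: ideal_quot_def l_distr)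
next
  fix r x assume "r \<in> carrier R" "x \<in> ideal_quot R J z"
  then show "r \<otimes> x \<in> ideal_quot R J z"
    using z ideal_closed(4)[OF J, of r "x \<otimes> z"] by (simp add: ideal_quot_def m_assoc)
qed

lemma (in cring) regular_elements_closed:
  "c \<in> regular_elements R \<Longrightarrow> c \<in> carrier R"
  by (simp add: regular_elements_def)

lemma (in cring) regular_cancel:
  assumes "c \<in> regular_elements R" "x \<in> carrier R" "y \<in> carrier R" "c \<otimes> x = c \<otimes> y"
  shows "x = y"
proof -
  have c: "c \<in> carrier R" using assms(1) by (rule regular_elements_closed)
  have "c \<otimes> (x \<ominus> y) = \<zero>"
    using assms(2-4) c by (simp add: a_minus_def r_distr r_minus r_neg)
  then have "x \<ominus> y = \<zero>" using assms(1-3) by (simp add: regular_elements_def)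
  then show ?thesis using assms(2,3) eq_of_minus_eq_zero by blast
qed

lemma (in cring) regular_elements_mult:
  assumes "c \<in> regular_elements R" "d \<in> regular_elements R"
  shows "c \<otimes> d \<in> regular_elements R"
proof -
  have c: "c \<in> carrier R" "d \<in> carrier R" using assms regular_elements_closed by auto
  have "x = \<zero>" if x: "x \<in> carrier R" "c \<otimes> d \<otimes> x = \<zero>" for x
  proof -
    have "c \<otimes> (d \<otimes> x) = \<zero>" using x c by (simp add: m_assoc)
    moreover have "d \<otimes> x \<in> carrier R" using x c by simp
    ultimately have "d \<otimes> x = \<zero>" using assms(1) unfolding regular_elements_def by blast
    then show "x = \<zero>" using assms(2) x unfolding regular_elements_def by blast
  qed
  then show ?thesis using c by (simp add: regular_elements_def)
qed

lemma (in cring) regular_elements_pow: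
  assumes "c \<in> regular_elements R"
  shows "c [^] (n::nat) \<in> regular_elements R"
proof (induction n)
  case 0
  then show ?case by (simp add: regular_elements_def)
next
  case (Suc n)
  then show ?case using regular_elements_mult assms by simp
qed

text \<open>The products \<open>s c\<^sup>n\<close> with \<open>s \<notin> P\<close> form a multiplicatively closed set, which avoids zero because \<open>c\<close> is
  regular. An ideal maximal among those avoiding it is a prime contained in \<open>P\<close>, and it does not
  contain \<open>c\<close>.\<close>

lemma (in cring) smaller_prime:
  assumes noeth: "noetherian_ring R" and P: "primeideal P R" and c: "c \<in> regular_elements R" "c \<in> P"
  shows "\<exists>P'. primeideal P' R \<and> P' \<subset> P"
proof -
  interpret P: primeideal P R by fact
  have cR: "c \<in> carrier R" using c(1) by (rule regular_elements_closed)
  define D where "D = {s \<otimes> c [^] (n::nat) | s n. s \<in> carrier R \<and> s \<notin> P}"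
  have one: "\<one> \<notin> P" using P.one_imp_carrier P.I_notcarr by blast
  have DI: "s \<otimes> c [^] (n::nat) \<in> D" if "s \<in> carrier R" "s \<notin> P" for s n using that by (auto simp: D_def)
  have D_mult: "d \<otimes> e \<in> D" if de: "d \<in> D" "e \<in> D" for d e
  proof -
    obtain s n t k where *: "d = s \<otimes> c [^] (n::nat)" "e = t \<otimes> c [^] (k::nat)" "s \<in> carrier R" "s \<notin> P" "t \<in> carrier R" "t \<notin> P"
      using de unfolding D_def by blast
    then have "d \<otimes> e = (s \<otimes> t) \<otimes> c [^] (n + k)"
      using cR by (simp add: nat_pow_mult[symmetric] m_ac del: nat_pow_mult)
    moreover have "s \<otimes> t \<notin> P" using * P.I_prime by blast
    ultimately show ?thesis using * DI by simp
  qed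
  let ?F = "{K. ideal K R \<and> K \<inter> D = {}}"
  have "{\<zero>} \<in> ?F"
  proof -
    have "\<zero> \<notin> D"
    proof
      assume "\<zero> \<in> D"
      then obtain s n where s: "\<zero> = s \<otimes> c [^] (n::nat)" "s \<in> carrier R" "s \<notin> P" by (auto simp: D_def)
      then have "c [^] n \<otimes> s = \<zero>" using cR by (simp add: m_comm)
      then have "s = \<zero>" using regular_elements_pow[OF c(1), of n] s(2) by (simp add: regular_elements_def)
      with s(3) show False by simp
    qed
    then show ?thesis using zeroideal by simp
  qed
  then have F: "?F \<noteq> {}" "\<And>K. K \<in> ?F \<Longrightarrow> ideal K R" by auto
  obtain P' where P': "P' \<in> ?F" "\<forall>K\<in>?F. P' \<subseteq> K \<longrightarrow> K = P'"
    by (rule noetherian_ring.maximal_ideal_in_family[OF noeth F])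
  have P'i: "ideal P' R" using P' by blast
  note P'c = ideal_closed[OF P'i]
  have meet: "\<exists>p\<in>P'. \<exists>r\<in>carrier R. p \<oplus> r \<otimes> a \<in> D" if a: "a \<in> carrier R" "a \<notin> P'" for a
  proof (rule ccontr)
    assume neg: "\<not> ?thesis"
    let ?K = "{p \<oplus> r \<otimes> a | p r. p \<in> P' \<and> r \<in> carrier R}"
    have K: "ideal ?K R"
    proof (rule idealI_comm)
      show "?K \<subseteq> carrier R" using P'c(1) a by auto
      have "\<zero> = \<zero> \<oplus> \<zero> \<otimes> a" using a by simp
      then show "\<zero> \<in> ?K" using P'c(2) by blast
    next
      fix x y assume "x \<in> ?K" "y \<in> ?K"
      then obtain p r p' r' where *: "x = p \<oplus> r \<otimes> a" "y = p' \<oplus> r' \<otimes> a" "p \<in> P'" "p' \<in> P'" "r \<in> carrier R" "r' \<in> carrier R"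
        by blast
      moreover from this have "p \<in> carrier R" "p' \<in> carrier R" using P'c(1) by auto
      ultimately have "x \<oplus> y = (p \<oplus> p') \<oplus> (r \<oplus> r') \<otimes> a" using a by (simp add: l_distr a_ac)
      then show "x \<oplus> y \<in> ?K" using * P'c(3) by blast
    next
      fix s x assume s: "s \<in> carrier R" and "x \<in> ?K"
      then obtain p r where *: "x = p \<oplus> r \<otimes> a" "p \<in> P'" "r \<in> carrier R" by blast
      moreover from this have "p \<in> carrier R" using P'c(1) by auto
      ultimately have "s \<otimes> x = s \<otimes> p \<oplus> (s \<otimes> r) \<otimes> a" using a s by (simp add: r_distr m_assoc)
      then show "s \<otimes> x \<in> ?K" using * s P'c(4) by blast
    qed
    have "?K \<inter> D = {}" using neg by blast
    with K have KF: "?K \<in> ?F" by (intro CollectI conjI)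
    have "P' \<subseteq> ?K"
    proof
      fix p assume p: "p \<in> P'"
      then have "p = p \<oplus> \<zero> \<otimes> a" using P'c(1) a by auto
      then show "p \<in> ?K" using p by blast
    qed
    then have "?K = P'" by (rule bspec[OF P'(2) KF, THEN mp])
    moreover have "\<zero> \<oplus> \<one> \<otimes> a \<in> ?K" using P'c(2) by blast
    ultimately show False using a by simp
  qed
  have "primeideal P' R"
  proof (rule primeidealI)
    show "ideal P' R" by fact
    show "cring R" by (rule is_cring)
    have "\<one> \<in> D" using DI[of \<one> 0] one by simp
    then show "carrier R \<noteq> P'" using P'(1) by blast
  next
    fix a b assume ab: "a \<in> carrier R" "b \<in> carrier R" "a \<otimes> b \<in> P'"
    show "a \<in> P' \<or> b \<in> P'"
    proof (rule ccontr)
      assume neg: "\<not> (a \<in> P' \<or> b \<in> P')"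
      obtain p r where pr: "p \<in> P'" "r \<in> carrier R" "p \<oplus> r \<otimes> a \<in> D" using meet[OF ab(1)] neg by blast
      obtain q s where qs: "q \<in> P'" "s \<in> carrier R" "q \<oplus> s \<otimes> b \<in> D" using meet[OF ab(2)] neg by blast
      have carr: "p \<in> carrier R" "q \<in> carrier R" using pr qs P'c(1) by auto
      have "(p \<oplus> r \<otimes> a) \<otimes> (q \<oplus> s \<otimes> b) = p \<otimes> (q \<oplus> s \<otimes> b) \<oplus> ((r \<otimes> a) \<otimes> q \<oplus> (r \<otimes> s) \<otimes> (a \<otimes> b))"
        using carr ab pr qs by (simp add: l_distr r_distr m_ac a_ac)
      also have "\<dots> \<in> P'"
      proof (rule P'c(3))
        show "p \<otimes> (q \<oplus> s \<otimes> b) \<in> P'" using P'c(5)[OF _ pr(1)] carr ab qs by simp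
        have "(r \<otimes> a) \<otimes> q \<in> P'" using P'c(4)[OF _ qs(1)] pr(2) ab by simp
        moreover have "(r \<otimes> s) \<otimes> (a \<otimes> b) \<in> P'" using P'c(4)[OF _ ab(3)] pr(2) qs(2) by simp
        ultimately show "(r \<otimes> a) \<otimes> q \<oplus> (r \<otimes> s) \<otimes> (a \<otimes> b) \<in> P'" by (rule P'c(3))
      qed
      finally show False using D_mult[OF pr(3) qs(3)] P'(1) by blast
    qed
  qed
  moreover have "P' \<subseteq> P"
  proof
    fix x assume x: "x \<in> P'"
    show "x \<in> P"
    proof (rule ccontr)
      assume "x \<notin> P"
      then have "x \<in> D" using DI[of x 0] x P'c(1) by auto
      then show False using x P'(1) by blast
    qed
  qed
  moreover have "c \<notin> P'"
  proof -
    have "c \<in> D" using DI[of \<one> 1] one cR by simp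
    then show ?thesis using P'(1) by blast
  qed
  ultimately show ?thesis using c(2) by blast
qed

lemma (in cring) rel_length_maximalideal:
  assumes m: "maximalideal \<mm> R"
  shows "rel_length R (ring_module R) \<mm> (carrier R) = 1"
proof -
  let ?M = "ring_module R"
  interpret RM: module R ?M by (rule ring_module_module)
  have mi: "ideal \<mm> R" using m by (rule maximalideal.axioms(1))
  have "\<one> \<notin> \<mm>" using maximalideal.I_notcarr[OF m] ideal.one_imp_carrier[OF mi] by blast
  then have "rel_length R ?M \<mm> (submodule_add ?M \<mm> (cyclic_submodule R ?M \<one>)) = 1"
    using mi ideal_closed[OF mi]
    by (intro RM.rel_length_simple_step[OF m]) (auto simp: submodule_ring_module_iff)
  moreover have "submodule_add ?M \<mm> (cyclic_submodule R ?M \<one>) = carrier R"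
  proof
    show "submodule_add ?M \<mm> (cyclic_submodule R ?M \<one>) \<subseteq> carrier R"
      using ideal_closed(1)[OF mi] unfolding submodule_add_def cyclic_submodule_def by auto
    show "carrier R \<subseteq> submodule_add ?M \<mm> (cyclic_submodule R ?M \<one>)"
    proof
      fix r assume r: "r \<in> carrier R"
      then have "r = \<zero> \<oplus>\<^bsub>?M\<^esub> r \<odot>\<^bsub>?M\<^esub> \<one>" by simp
      then show "r \<in> submodule_add ?M \<mm> (cyclic_submodule R ?M \<one>)"
        using r ideal_closed(2)[OF mi] unfolding submodule_add_def cyclic_submodule_def by blast
    qed
  qed
  ultimately show ?thesis by simp
qed

locale one_dim_local = cring R for R (structure) +
  fixes \<mm>
  assumes noeth: "noetherian_ring R"
    and max: "maximalideal \<mm> R" and max_unique: "\<And>J. maximalideal J R \<Longrightarrow> J = \<mm>"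
    and dim: "krull_dim R = 1"
begin

abbreviation "RM \<equiv> ring_module R"

abbreviation "len \<equiv> rel_length R (ring_module R)"

sublocale RM: module R "ring_module R" by (rule ring_module_module)

lemma max_ideal_eq: "max_ideal R = \<mm>"
  unfolding max_ideal_def by (rule the_equality, rule max, rule max_unique)

lemma m_ideal: "ideal \<mm> R" using max by (rule maximalideal.axioms(1))

lemma proper_subset_m:
  assumes "ideal J R" "J \<noteq> carrier R"
  shows "J \<subseteq> \<mm>"
proof -
  obtain \<mm>' where "maximalideal \<mm>' R" "J \<subseteq> \<mm>'"
    using noetherian_ring.proper_ideal_in_maximal[OF noeth assms] by blast
  then show ?thesis using max_unique[of \<mm>'] by simp
qed

text \<open>A maximal one among the ideals \<open>J : z\<close> with \<open>z \<notin> J\<close> is prime (an associated prime of \<open>R / J\<close>). It contains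
  the regular element \<open>c\<close>, so there is a smaller prime below it, and in dimension one this
  forces it to be \<open>\<mm>\<close>.\<close>

lemma socle_element:
  assumes J: "ideal J R" "J \<noteq> carrier R" and c: "c \<in> regular_elements R" "c \<in> J"
  shows "\<exists>z\<in>carrier R. z \<notin> J \<and> (\<forall>a\<in>\<mm>. a \<otimes> z \<in> J)"
proof -
  note Jc = ideal_closed[OF J(1)]
  have one: "\<one> \<notin> J" using J ideal.one_imp_carrier by blast
  let ?F = "ideal_quot R J ` (carrier R - J)"
  have F: "?F \<noteq> {}" "\<And>K. K \<in> ?F \<Longrightarrow> ideal K R" using one ideal_quot_ideal[OF J(1)] by auto
  obtain Q where Q: "Q \<in> ?F" "\<forall>K\<in>?F. Q \<subseteq> K \<longrightarrow> K = Q"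
    by (rule noetherian_ring.maximal_ideal_in_family[OF noeth F])
  then obtain z where z: "z \<in> carrier R" "z \<notin> J" "Q = ideal_quot R J z" by blast
  have zmax: "ideal_quot R J y = ideal_quot R J z"
    if "y \<in> carrier R" "y \<notin> J" "ideal_quot R J z \<subseteq> ideal_quot R J y" for y
    using bspec[OF Q(2), of "ideal_quot R J y"] that z(3) by simp
  let ?P = "ideal_quot R J z"
  have Pi: "ideal ?P R" using ideal_quot_ideal[OF J(1) z(1)] .
  have "\<one> \<notin> ?P" using z by (simp add: ideal_quot_def)
  then have Pn: "carrier R \<noteq> ?P" by blast
  have P: "primeideal ?P R"
  proof (rule primeidealI[OF Pi is_cring Pn])
    fix a b assume ab: "a \<in> carrier R" "b \<in> carrier R" "a \<otimes> b \<in> ?P"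
    show "a \<in> ?P \<or> b \<in> ?P"
    proof (cases "b \<in> ?P")
      case False
      then have bz: "b \<otimes> z \<in> carrier R" "b \<otimes> z \<notin> J" using ab z by (auto simp: ideal_quot_def)
      have "?P \<subseteq> ideal_quot R J (b \<otimes> z)"
      proof
        fix r assume r: "r \<in> ?P"
        then have "r \<otimes> (b \<otimes> z) = b \<otimes> (r \<otimes> z)" using ab z by (simp add: ideal_quot_def m_ac)
        then show "r \<in> ideal_quot R J (b \<otimes> z)" using r ab Jc(4) by (simp add: ideal_quot_def)
      qed
      then have "ideal_quot R J (b \<otimes> z) = ?P" using zmax bz by blast
      moreover have "a \<in> ideal_quot R J (b \<otimes> z)" using ab z by (simp add: ideal_quot_def m_assoc)
      ultimately show ?thesis by blast
    qed simp
  qed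
  have cP: "c \<in> ?P" using c Jc(5) z regular_elements_closed by (simp add: ideal_quot_def)
  have "?P = \<mm>"
  proof (rule ccontr)
    assume ne: "?P \<noteq> \<mm>"
    have "?P \<subset> \<mm>" using proper_subset_m[OF Pi] Pn ne by blast
    moreover obtain P' where P': "primeideal P' R" "P' \<subset> ?P" using smaller_prime[OF noeth P c(1) cP] by blast
    moreover have mp: "primeideal \<mm> R" using maximalideal_prime[OF max] .
    ultimately have "\<exists>Q. (\<forall>i\<le>2. primeideal (Q i) R) \<and> (\<forall>i<2. Q i \<subset> Q (Suc i))"
      using P by (intro exI[of _ "\<lambda>i::nat. if i = 0 then P' else if i = 1 then ?P else \<mm>"]) (auto simp: less_2_cases_iff)
    then have "enat 2 \<le> krull_dim R" unfolding krull_dim_def by (intro Sup_upper) blast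
    then show False using dim by (simp add: one_enat_def)
  qed
  then have "a \<otimes> z \<in> J" if "a \<in> \<mm>" for a using that by (auto simp: ideal_quot_def)
  with z show ?thesis by blast
qed

lemma submodule_iff: "submodule R J RM \<longleftrightarrow> ideal J R"
  by (rule submodule_ring_module_iff)

lemma socle_step:
  assumes J: "ideal J R" "J \<noteq> carrier R" and c: "c \<in> regular_elements R" "c \<in> J"
  shows "\<exists>z\<in>carrier R. z \<notin> J \<and> (\<forall>a\<in>\<mm>. a \<otimes> z \<in> J) \<and>
    ideal {j \<oplus> r \<otimes> z | j r. j \<in> J \<and> r \<in> carrier R} R \<and> J \<subset> {j \<oplus> r \<otimes> z | j r. j \<in> J \<and> r \<in> carrier R} \<and>
    len J {j \<oplus> r \<otimes> z | j r. j \<in> J \<and> r \<in> carrier R} = 1"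
proof -
  obtain z where z: "z \<in> carrier R" "z \<notin> J" "\<And>a. a \<in> \<mm> \<Longrightarrow> a \<otimes> z \<in> J"
    using socle_element[OF assms] by blast
  let ?J = "submodule_add RM J (cyclic_submodule R RM z)"
  have eq: "{j \<oplus> r \<otimes> z | j r. j \<in> J \<and> r \<in> carrier R} = ?J"
    unfolding submodule_add_def cyclic_submodule_def by auto
  have Js: "submodule R J RM" using J submodule_iff by simp
  have Z: "submodule R (cyclic_submodule R RM z) RM" using RM.cyclic_submodule_submodule z by simp
  have "len J ?J = 1" using RM.rel_length_simple_step[OF max Js, of z] z by simp
  moreover have "ideal ?J R" using submodule_add_submodule[OF Js Z] submodule_iff by simp
  moreover have "J \<subset> ?J"
  proof -
    have "z \<in> ?J" using RM.self_in_cyclic_submodule[of z] z submodule_add_upper[OF Z Js] submodule_add_commute[OF Js Z]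
      by auto
    then show ?thesis using submodule_add_upper[OF Js Z] z by blast
  qed
  ultimately show ?thesis unfolding eq[symmetric] using z by blast
qed

lemma noetherian_induct:
  assumes "ideal J R"
    and "\<And>J. ideal J R \<Longrightarrow> (\<And>K. ideal K R \<Longrightarrow> J \<subset> K \<Longrightarrow> Q K) \<Longrightarrow> Q J"
  shows "Q J"
proof (rule ccontr)
  assume "\<not> Q J"
  then have F: "{K. ideal K R \<and> \<not> Q K} \<noteq> {}" "\<And>K. K \<in> {K. ideal K R \<and> \<not> Q K} \<Longrightarrow> ideal K R"
    using assms(1) by auto
  obtain K where K: "K \<in> {K. ideal K R \<and> \<not> Q K}" "\<forall>L\<in>{K. ideal K R \<and> \<not> Q K}. K \<subseteq> L \<longrightarrow> L = K"
    by (rule noetherian_ring.maximal_ideal_in_family[OF noeth F])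
  have "Q K"
  proof (rule assms(2))
    show "ideal K R" using K(1) by simp
    fix L assume L: "ideal L R" "K \<subset> L"
    show "Q L"
    proof (rule ccontr)
      assume "\<not> Q L"
      then have "L = K" using bspec[OF K(2), of L] L by auto
      then show False using L(2) by simp
    qed
  qed
  then show False using K(1) by simp
qed

lemma carrier_ideal: "ideal (carrier R) R" by (rule oneideal)

lemma len_add:
  assumes "ideal A R" "ideal B R" "ideal C R" "A \<subseteq> B" "B \<subseteq> C"
  shows "len A C = len A B + len B C"
  using rel_length_additive[of R A RM B C] assms submodule_iff by simp

lemma len_refl: "ideal A R \<Longrightarrow> len A A = 0"
  using rel_length_refl submodule_iff by blast

lemma len_m: "len \<mm> (carrier R) = 1"
  by (rule rel_length_maximalideal[OF max])

text \<open>Noetherian induction along the simple steps: an ideal containing a regular element has finite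
  colength in dimension one.\<close>

lemma finite_colength:
  assumes c: "c \<in> regular_elements R" and J: "ideal J R" "c \<in> J"
  shows "len J (carrier R) \<noteq> \<infinity>"
proof -
  have "c \<in> J \<longrightarrow> len J (carrier R) \<noteq> \<infinity>"
  proof (rule noetherian_induct[OF J(1)], rule impI)
    fix J assume J: "ideal J R" "c \<in> J"
      and IH: "\<And>K. ideal K R \<Longrightarrow> J \<subset> K \<Longrightarrow> c \<in> K \<longrightarrow> len K (carrier R) \<noteq> \<infinity>"
    show "len J (carrier R) \<noteq> \<infinity>"
    proof (cases "J = carrier R")
      case True
      then show ?thesis using len_refl[OF J(1)] by simp
    next
      case False
      obtain J' where J': "ideal J' R" "J \<subset> J'" "len J J' = 1"
        using socle_step[OF J(1) False c J(2)] by blast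
      have "len J (carrier R) = 1 + len J' (carrier R)"
        using len_add[OF J(1) J'(1) carrier_ideal] J' ideal_closed(1)[OF J'(1)] by (simp add: psubset_imp_subset)
      moreover have "len J' (carrier R) \<noteq> \<infinity>" using IH[OF J'(1,2)] J' J(2) by blast
      ultimately show ?thesis by (cases "len J' (carrier R)") (auto simp: one_enat_def)
    qed
  qed
  then show ?thesis using J(2) by simp
qed

lemma len_finite:
  assumes c: "c \<in> regular_elements R" and J: "ideal J R" "c \<in> J" and K: "ideal K R" "J \<subseteq> K"
  shows "\<exists>n. len J K = enat n"
proof -
  have "len J (carrier R) = len J K + len K (carrier R)"
    using len_add[OF J(1) K(1) carrier_ideal] K ideal_closed(1) by simp
  then show ?thesis using finite_colength[OF c J] by (cases "len J K") auto
qed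

definition scale :: "'a \<Rightarrow> 'a set \<Rightarrow> 'a set" where
  "scale c A = (\<lambda>r. c \<otimes> r) ` A"

lemma scale_ideal:
  assumes "c \<in> carrier R" "ideal A R"
  shows "ideal (scale c A) R"
proof (rule idealI_comm)
  note Ac = ideal_closed[OF assms(2)]
  show "scale c A \<subseteq> carrier R" using Ac(1) assms(1) by (auto simp: scale_def)
  have "\<zero> = c \<otimes> \<zero>" using assms(1) by simp
  then show "\<zero> \<in> scale c A" using Ac(2) unfolding scale_def by blast
next
  note Ac = ideal_closed[OF assms(2)]
  fix x y assume "x \<in> scale c A" "y \<in> scale c A"
  then obtain u v where uv: "x = c \<otimes> u" "y = c \<otimes> v" "u \<in> A" "v \<in> A" by (auto simp: scale_def)
  then have "x \<oplus> y = c \<otimes> (u \<oplus> v)" using Ac(1) assms(1) by (simp add: r_distr subset_iff)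
  then show "x \<oplus> y \<in> scale c A" using Ac(3) uv unfolding scale_def by blast
next
  note Ac = ideal_closed[OF assms(2)]
  fix r x assume r: "r \<in> carrier R" and "x \<in> scale c A"
  then obtain u where u: "x = c \<otimes> u" "u \<in> A" by (auto simp: scale_def)
  then have "r \<otimes> x = c \<otimes> (r \<otimes> u)" using Ac(1) assms(1) r by (simp add: m_lcomm subset_iff)
  then show "r \<otimes> x \<in> scale c A" using Ac(4) u r unfolding scale_def by blast
qed

lemma scale_mem_iff:
  assumes "c \<in> regular_elements R" "A \<subseteq> carrier R" "x \<in> carrier R"
  shows "c \<otimes> x \<in> scale c A \<longleftrightarrow> x \<in> A"
proof
  assume "c \<otimes> x \<in> scale c A"
  then obtain y where y: "y \<in> A" "c \<otimes> x = c \<otimes> y" by (auto simp: scale_def)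
  then have "x = y" using regular_cancel[OF assms(1,3)] assms(2) by blast
  then show "x \<in> A" using y by simp
next
  assume "x \<in> A"
  then show "c \<otimes> x \<in> scale c A" unfolding scale_def by (rule imageI)
qed

lemma scale_mono: "A \<subseteq> B \<Longrightarrow> scale c A \<subseteq> scale c B"
  by (auto simp: scale_def)

lemma len_mult_le:
  assumes z: "z \<in> carrier R" and N: "ideal N R" and V: "ideal V R" and NV: "N \<subseteq> V"
    and N': "ideal N' R" and V': "ideal V' R" and N'V': "N' \<subseteq> V'"
    and img: "\<And>x. x \<in> V \<Longrightarrow> z \<otimes> x \<in> V'" and ker: "\<And>x. x \<in> V \<Longrightarrow> z \<otimes> x \<in> N' \<longleftrightarrow> x \<in> N"
  shows "len N V \<le> len N' V'"
proof (rule rel_length_transfer_le[where g="\<lambda>x. z \<otimes> x", OF _ _ NV _ _ img _ ker N'V'])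
  have Vc: "x \<in> carrier R" if "x \<in> V" for x using that ideal_closed(1)[OF V] by blast
  show "submodule R N RM" "submodule R V RM" "submodule R N' RM" "submodule R V' RM"
    using N V N' V' submodule_iff by simp_all
  show "z \<otimes> (x \<oplus>\<^bsub>RM\<^esub> y) = z \<otimes> x \<oplus>\<^bsub>RM\<^esub> z \<otimes> y" if "x \<in> V" "y \<in> V" for x y
    using Vc that z by (simp add: r_distr)
  fix r assume r: "r \<in> carrier R"
  have "r \<odot>\<^bsub>RM\<^esub> (z \<otimes> x) = z \<otimes> (r \<odot>\<^bsub>RM\<^esub> x) \<oplus>\<^bsub>RM\<^esub> \<zero>" if "x \<in> V" for x
    using Vc[OF that] z r by (simp add: m_lcomm)
  then show "\<exists>s\<in>carrier R. \<forall>x\<in>V. \<exists>d\<in>N'. r \<odot>\<^bsub>RM\<^esub> (z \<otimes> x) = z \<otimes> (s \<odot>\<^bsub>RM\<^esub> x) \<oplus>\<^bsub>RM\<^esub> d"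
    using r ideal_closed(2)[OF N'] by blast
qed

lemma len_mult_ge:
  assumes z: "z \<in> carrier R" and N: "ideal N R" and V: "ideal V R" and NV: "N \<subseteq> V"
    and N': "ideal N' R" and V': "ideal V' R" and N'V': "N' \<subseteq> V'"
    and img: "\<And>x. x \<in> V \<Longrightarrow> z \<otimes> x \<in> V'" and ker: "\<And>x. x \<in> V \<Longrightarrow> z \<otimes> x \<in> N' \<longleftrightarrow> x \<in> N"
    and surj: "\<And>y. y \<in> V' \<Longrightarrow> \<exists>x\<in>V. y = z \<otimes> x"
  shows "len N' V' \<le> len N V"
proof (rule rel_length_transfer_ge[where g="\<lambda>x. z \<otimes> x", OF _ _ _ _ N'V' img _ ker NV])
  have Vc: "x \<in> carrier R" if "x \<in> V" for x using that ideal_closed(1)[OF V] by blast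
  show "submodule R N RM" "submodule R V RM" "submodule R N' RM" "submodule R V' RM"
    using N V N' V' submodule_iff by simp_all
  show "z \<otimes> (x \<oplus>\<^bsub>RM\<^esub> y) = z \<otimes> x \<oplus>\<^bsub>RM\<^esub> z \<otimes> y" if "x \<in> V" "y \<in> V" for x y
    using Vc that z by (simp add: r_distr)
  show "\<exists>x\<in>V. \<exists>d\<in>N'. y = z \<otimes> x \<oplus>\<^bsub>RM\<^esub> d" if y: "y \<in> V'" for y
  proof -
    obtain x where x: "x \<in> V" "y = z \<otimes> x" using surj[OF y] by blast
    then have "y = z \<otimes> x \<oplus>\<^bsub>RM\<^esub> \<zero>" using Vc z by simp
    then show ?thesis using x(1) ideal_closed(2)[OF N'] by blast
  qed
  fix r assume r: "r \<in> carrier R"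
  have "z \<otimes> (r \<odot>\<^bsub>RM\<^esub> x) = r \<odot>\<^bsub>RM\<^esub> (z \<otimes> x) \<oplus>\<^bsub>RM\<^esub> \<zero>" if "x \<in> V" for x
    using Vc[OF that] z r by (simp add: m_lcomm)
  then show "\<exists>s\<in>carrier R. \<forall>x\<in>V. \<exists>d\<in>N'. z \<otimes> (r \<odot>\<^bsub>RM\<^esub> x) = s \<odot>\<^bsub>RM\<^esub> (z \<otimes> x) \<oplus>\<^bsub>RM\<^esub> d"
    using r ideal_closed(2)[OF N'] by blast
qed

lemma len_scale:
  assumes c: "c \<in> regular_elements R" and A: "ideal A R" and B: "ideal B R" and AB: "A \<subseteq> B"
  shows "len (scale c A) (scale c B) = len A B"
proof (rule antisym)
  have cR: "c \<in> carrier R" using c by (rule regular_elements_closed)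
  note S = scale_ideal[OF cR A] scale_ideal[OF cR B] scale_mono[OF AB]
  have Bc: "x \<in> carrier R" if "x \<in> B" for x using that ideal_closed(1)[OF B] by blast
  have img: "c \<otimes> x \<in> scale c B" if "x \<in> B" for x using that by (simp add: scale_def)
  have ker: "c \<otimes> x \<in> scale c A \<longleftrightarrow> x \<in> A" if "x \<in> B" for x
    using scale_mem_iff[OF c ideal_closed(1)[OF A] Bc[OF that]] .
  show "len A B \<le> len (scale c A) (scale c B)"
    by (rule len_mult_le[OF cR A B AB S img ker])
  show "len (scale c A) (scale c B) \<le> len A B"
    by (rule len_mult_ge[OF cR A B AB S img ker]) (auto simp: scale_def)
qed

end

section \<open>Canonical duality and the type\<close>

lemma (in cring) transporter_ideal:
  assumes I: "ideal I R" and K: "ideal K R" and B: "B \<subseteq> carrier R"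
  shows "ideal {i \<in> I. \<forall>j\<in>B. j \<otimes> i \<in> K} R"
proof (rule idealI_comm)
  note Ic = ideal_closed[OF I] and Kc = ideal_closed[OF K]
  show "{i \<in> I. \<forall>j\<in>B. j \<otimes> i \<in> K} \<subseteq> carrier R" using Ic(1) by blast
  show "\<zero> \<in> {i \<in> I. \<forall>j\<in>B. j \<otimes> i \<in> K}" using B Ic(2) Kc(2) by (auto simp: subset_iff)
next
  note Ic = ideal_closed[OF I] and Kc = ideal_closed[OF K]
  fix x y assume x: "x \<in> {i \<in> I. \<forall>j\<in>B. j \<otimes> i \<in> K}" and y: "y \<in> {i \<in> I. \<forall>j\<in>B. j \<otimes> i \<in> K}"
  have "j \<otimes> (x \<oplus> y) \<in> K" if j: "j \<in> B" for j
  proof -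
    have "j \<otimes> (x \<oplus> y) = j \<otimes> x \<oplus> j \<otimes> y" using j B x y Ic(1) by (simp add: r_distr subset_iff)
    then show ?thesis using x y j Kc(3) by simp
  qed
  then show "x \<oplus> y \<in> {i \<in> I. \<forall>j\<in>B. j \<otimes> i \<in> K}" using x y Ic(3) by simp
next
  note Ic = ideal_closed[OF I] and Kc = ideal_closed[OF K]
  fix r x assume r: "r \<in> carrier R" and x: "x \<in> {i \<in> I. \<forall>j\<in>B. j \<otimes> i \<in> K}"
  have "j \<otimes> (r \<otimes> x) \<in> K" if j: "j \<in> B" for j
  proof -
    have "j \<otimes> (r \<otimes> x) = r \<otimes> (j \<otimes> x)" using j B x r Ic(1) by (simp add: m_lcomm subset_iff)
    then show ?thesis using x j r Kc(4) by simp
  qed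
  then show "r \<otimes> x \<in> {i \<in> I. \<forall>j\<in>B. j \<otimes> i \<in> K}" using x r Ic(4) by simp
qed

text \<open>An almost Gorenstein ring as seen inside \<open>R\<close>: the ideal \<open>I\<close> plays the role of \<open>c \<omega>\<close> and \<open>c\<close> that of \<open>c \<cdot> 1\<close>.
  The condition \<open>\<mm> \<omega> = \<mm>\<close> reads \<open>\<mm> I \<subseteq> c \<mm>\<close>, and \<open>type1\<close> says that the socle of \<open>I / c I\<close> is simple.\<close>

locale almost_gorenstein_ideal = one_dim_local +
  fixes I and c
  assumes I_ideal: "ideal I R" and I_proper: "I \<noteq> carrier R"
    and c_regular: "c \<in> regular_elements R" and c_I: "c \<in> I"
    and m_I: "\<And>r i. r \<in> \<mm> \<Longrightarrow> i \<in> I \<Longrightarrow> \<exists>s\<in>\<mm>. r \<otimes> i = c \<otimes> s"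
    and type1: "len (scale c I) {i \<in> I. \<forall>r\<in>\<mm>. r \<otimes> i \<in> scale c I} = 1"
begin

text \<open>The preimage in \<open>I\<close> of the socle of \<open>I / c I\<close>.\<close>

definition U where "U = {i \<in> I. \<forall>r\<in>\<mm>. r \<otimes> i \<in> scale c I}"

text \<open>Dividing by \<open>c\<close> identifies \<open>I\<close> with \<open>\<omega>\<close>; then \<open>dual J\<close> corresponds to \<open>{y \<in> \<omega>. y J \<subseteq> c \<omega>}\<close>, whose
  quotient by \<open>c \<omega>\<close> is the canonical dual \<open>Hom(R / J, \<omega> / c \<omega>)\<close>.\<close>

definition dual where "dual J = {i \<in> I. \<forall>j\<in>J. i \<otimes> j \<in> scale c I}"

lemma c_carr: "c \<in> carrier R" using c_regular by (rule regular_elements_closed)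

lemma I_carr: "i \<in> I \<Longrightarrow> i \<in> carrier R" using ideal_closed(1)[OF I_ideal] by blast

lemma m_carr: "i \<in> \<mm> \<Longrightarrow> i \<in> carrier R" using ideal_closed(1)[OF m_ideal] by blast

lemma c_cancel: "x \<in> carrier R \<Longrightarrow> y \<in> carrier R \<Longrightarrow> c \<otimes> x = c \<otimes> y \<Longrightarrow> x = y"
  by (rule regular_cancel[OF c_regular])

lemma I_sub_m: "I \<subseteq> \<mm>" using proper_subset_m[OF I_ideal I_proper] .

lemma cI_ideal: "ideal (scale c I) R" by (rule scale_ideal[OF c_carr I_ideal])

lemma cI_sub_I: "scale c I \<subseteq> I"
  unfolding scale_def using ideal_closed(4)[OF I_ideal c_carr] by blast

lemma U_ideal: "ideal U R"
  unfolding U_def using transporter_ideal[OF I_ideal cI_ideal ideal_closed(1)[OF m_ideal]] .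

lemma dual_ideal: assumes "ideal J R" shows "ideal (dual J) R"
proof -
  have Jc: "J \<subseteq> carrier R" using ideal_closed(1)[OF assms] .
  have "dual J = {i \<in> I. \<forall>j\<in>J. j \<otimes> i \<in> scale c I}"
  proof -
    have "i \<otimes> j = j \<otimes> i" if "i \<in> I" "j \<in> J" for i j using that Jc I_carr m_comm by blast
    then have "(\<forall>j\<in>J. i \<otimes> j \<in> scale c I) \<longleftrightarrow> (\<forall>j\<in>J. j \<otimes> i \<in> scale c I)" if "i \<in> I" for i
      using that by simp
    then show ?thesis unfolding dual_def by blast
  qed
  then show ?thesis using transporter_ideal[OF I_ideal cI_ideal Jc] by simp
qed

lemma cI_mult:
  assumes "i \<in> I" "r \<in> carrier R"
  shows "c \<otimes> i \<otimes> r \<in> scale c I"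
proof -
  have "c \<otimes> i \<in> scale c I" using assms(1) by (simp add: scale_def)
  then show ?thesis by (rule ideal_closed(5)[OF cI_ideal assms(2)])
qed

lemma cI_sub_dual: assumes "J \<subseteq> carrier R" shows "scale c I \<subseteq> dual J"
proof
  fix i assume i: "i \<in> scale c I"
  have "i \<otimes> j \<in> scale c I" if "j \<in> J" for j
    using ideal_closed(5)[OF cI_ideal _ i] that assms by blast
  then show "i \<in> dual J" using i cI_sub_I by (auto simp: dual_def)
qed

lemma cI_sub_U: "scale c I \<subseteq> U"
proof
  fix i assume i: "i \<in> scale c I"
  have "r \<otimes> i \<in> scale c I" if "r \<in> \<mm>" for r
    using ideal_closed(4)[OF cI_ideal m_carr[OF that] i] .
  then show "i \<in> U" using i cI_sub_I by (auto simp: U_def)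
qed

lemma dual_carrier: "dual (carrier R) = scale c I"
proof
  show "dual (carrier R) \<subseteq> scale c I"
  proof
    fix i assume "i \<in> dual (carrier R)"
    then have "i \<in> I" "i \<otimes> \<one> \<in> scale c I" by (auto simp: dual_def)
    then show "i \<in> scale c I" using I_carr by simp
  qed
qed (rule cI_sub_dual, simp)

text \<open>Enlarging \<open>J\<close> by a simple step \<open>z\<close> shrinks the dual by at most one: multiplication by \<open>z\<close> embeds the
  quotient of the duals into the simple module \<open>U / c I\<close>.\<close>

lemma len_dual_step:
  assumes J: "ideal J R" and z: "z \<in> carrier R" "\<And>a. a \<in> \<mm> \<Longrightarrow> a \<otimes> z \<in> J"
    and J': "ideal J' R" "J' = {j \<oplus> r \<otimes> z | j r. j \<in> J \<and> r \<in> carrier R}" "J \<subseteq> J'"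
  shows "len (dual J') (dual J) \<le> 1"
proof -
  have Jc: "j \<in> carrier R" if "j \<in> J" for j using that ideal_closed(1)[OF J] by blast
  have zJ': "z \<in> J'"
  proof -
    have "\<zero> \<oplus> \<one> \<otimes> z \<in> J'" unfolding J'(2) using ideal_closed(2)[OF J] by blast
    then show ?thesis using z by simp
  qed
  have "len (dual J') (dual J) \<le> len (scale c I) U"
  proof (rule len_mult_le[OF z(1) dual_ideal[OF J'(1)] dual_ideal[OF J] _ cI_ideal U_ideal cI_sub_U])
    show "dual J' \<subseteq> dual J" unfolding dual_def using J'(3) by blast
  next
    fix i assume i: "i \<in> dual J"
    then have iI: "i \<in> I" and iJ: "\<And>j. j \<in> J \<Longrightarrow> i \<otimes> j \<in> scale c I" by (auto simp: dual_def)
    note ic = I_carr[OF iI]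
    have "r \<otimes> (z \<otimes> i) \<in> scale c I" if r: "r \<in> \<mm>" for r
    proof -
      have "r \<otimes> (z \<otimes> i) = i \<otimes> (r \<otimes> z)" using m_carr[OF r] z ic by (simp add: m_ac)
      then show ?thesis using iJ z(2)[OF r] by simp
    qed
    then show "z \<otimes> i \<in> U" unfolding U_def using ideal_closed(4)[OF I_ideal z(1) iI] by simp
    show "z \<otimes> i \<in> scale c I \<longleftrightarrow> i \<in> dual J'"
    proof
      assume zi: "z \<otimes> i \<in> scale c I"
      have "i \<otimes> j \<in> scale c I" if jJ': "j \<in> J'" for j
      proof -
        obtain j0 r where j: "j = j0 \<oplus> r \<otimes> z" "j0 \<in> J" "r \<in> carrier R" using jJ' unfolding J'(2) by blast
        then have "i \<otimes> j = i \<otimes> j0 \<oplus> r \<otimes> (z \<otimes> i)"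
          using ic z(1) Jc by (simp add: r_distr m_ac)
        then show ?thesis
          using iJ[OF j(2)] zi ideal_closed(3,4)[OF cI_ideal] j(3) by simp
      qed
      then show "i \<in> dual J'" unfolding dual_def using iI by simp
    next
      assume "i \<in> dual J'"
      then have "i \<otimes> z \<in> scale c I" using zJ' by (simp add: dual_def)
      then show "z \<otimes> i \<in> scale c I" using ic z by (simp add: m_comm)
    qed
  qed
  then show ?thesis using type1 unfolding U_def by simp
qed

lemma len_dual_le:
  assumes J: "ideal J R" and cJ: "c \<in> J"
  shows "len (scale c I) (dual J) \<le> len J (carrier R)"
proof -
  have "c \<in> J \<longrightarrow> len (scale c I) (dual J) \<le> len J (carrier R)"
  proof (rule noetherian_induct[OF J], rule impI)
    fix J assume J: "ideal J R" and cJ: "c \<in> J"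
      and IH: "\<And>K. ideal K R \<Longrightarrow> J \<subset> K \<Longrightarrow> c \<in> K \<longrightarrow> len (scale c I) (dual K) \<le> len K (carrier R)"
    show "len (scale c I) (dual J) \<le> len J (carrier R)"
    proof (cases "J = carrier R")
      case True
      then show ?thesis using dual_carrier len_refl[OF cI_ideal] by simp
    next
      case False
      obtain z where z: "z \<in> carrier R" "\<forall>a\<in>\<mm>. a \<otimes> z \<in> J"
        "ideal {j \<oplus> r \<otimes> z | j r. j \<in> J \<and> r \<in> carrier R} R"
        "J \<subset> {j \<oplus> r \<otimes> z | j r. j \<in> J \<and> r \<in> carrier R}"
        "len J {j \<oplus> r \<otimes> z | j r. j \<in> J \<and> r \<in> carrier R} = 1"
        using socle_step[OF J False c_regular cJ] by blast
      define J' where "J' = {j \<oplus> r \<otimes> z | j r. j \<in> J \<and> r \<in> carrier R}"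
      note z' = z(3,4,5)[folded J'_def]
      have J'c: "J' \<subseteq> carrier R" using ideal_closed(1)[OF z'(1)] .
      have JJ': "J \<subseteq> J'" using z'(2) by blast
      have "len (scale c I) (dual J) = len (scale c I) (dual J') + len (dual J') (dual J)"
      proof (rule len_add[OF cI_ideal dual_ideal[OF z'(1)] dual_ideal[OF J] cI_sub_dual[OF J'c]])
        show "dual J' \<subseteq> dual J" unfolding dual_def using JJ' by blast
      qed
      also have "\<dots> \<le> len J' (carrier R) + 1"
      proof (rule add_mono)
        show "len (scale c I) (dual J') \<le> len J' (carrier R)" using IH[OF z'(1,2)] JJ' cJ by blast
        show "len (dual J') (dual J) \<le> 1"
          by (rule len_dual_step[OF J z(1) _ z'(1) J'_def JJ']) (use z(2) in blast)
      qed
      also have "\<dots> = len J (carrier R)"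
        using len_add[OF J z'(1) carrier_ideal JJ' J'c] z'(3) by (simp add: add.commute)
      finally show ?thesis .
    qed
  qed
  then show ?thesis using cJ by simp
qed

text \<open>Both lengths are obtained from \<open>R / c I\<close> by removing \<open>R / I\<close>, which is isomorphic to \<open>c R / c I\<close>.\<close>

lemma len_principal_eq: "len (scale c I) I = len (scale c (carrier R)) (carrier R)"
proof -
  have Rc: "ideal (scale c (carrier R)) R" by (rule scale_ideal[OF c_carr carrier_ideal])
  have Ic: "I \<subseteq> carrier R" using ideal_closed(1)[OF I_ideal] .
  have sub: "scale c I \<subseteq> scale c (carrier R)" by (rule scale_mono[OF Ic])
  have "len (scale c I) (carrier R) = len (scale c I) I + len I (carrier R)"
    by (rule len_add[OF cI_ideal I_ideal carrier_ideal cI_sub_I Ic])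
  moreover have "len (scale c I) (carrier R) = len (scale c I) (scale c (carrier R)) + len (scale c (carrier R)) (carrier R)"
    by (rule len_add[OF cI_ideal Rc carrier_ideal sub ideal_closed(1)[OF Rc]])
  moreover have "len (scale c I) (scale c (carrier R)) = len I (carrier R)"
    by (rule len_scale[OF c_regular I_ideal carrier_ideal Ic])
  moreover obtain n where "len I (carrier R) = enat n"
    using len_finite[OF c_regular I_ideal c_I carrier_ideal Ic] by blast
  ultimately show ?thesis
    by (cases "len (scale c I) I"; cases "len (scale c (carrier R)) (carrier R)") auto
qed

text \<open>This is \<open>\<omega> : \<omega> = R\<close>. If \<open>i0\<close> were outside \<open>c R\<close>, the larger ideal \<open>J1 = c R + R i0\<close> would still have the whole
  of \<open>I\<close> as its dual, whence \<open>I / c I\<close> would be no longer than \<open>R / J1\<close> and thus shorter than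
  \<open>R / c R\<close>.\<close>

lemma multiplier_in_ring:
  assumes i: "i0 \<in> I" and mult: "\<And>i. i \<in> I \<Longrightarrow> i0 \<otimes> i \<in> scale c I"
  shows "i0 \<in> scale c (carrier R)"
proof (rule ccontr)
  assume notin: "i0 \<notin> scale c (carrier R)"
  have i0: "i0 \<in> carrier R" using I_carr[OF i] .
  let ?C = "scale c (carrier R)"
  have C: "ideal ?C R" by (rule scale_ideal[OF c_carr carrier_ideal])
  have Cs: "submodule R ?C RM" using C submodule_iff by simp
  have Z: "submodule R (cyclic_submodule R RM i0) RM" using RM.cyclic_submodule_submodule i0 by simp
  define J1 where "J1 = submodule_add RM ?C (cyclic_submodule R RM i0)"
  have J1: "ideal J1 R" unfolding J1_def using submodule_add_submodule[OF Cs Z] submodule_iff by simp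
  have J1_mem: "\<exists>a\<in>carrier R. \<exists>r\<in>carrier R. j = c \<otimes> a \<oplus> r \<otimes> i0" if "j \<in> J1" for j
    using that unfolding J1_def submodule_add_def cyclic_submodule_def scale_def by auto
  have CJ1: "?C \<subseteq> J1" unfolding J1_def by (rule submodule_add_upper[OF Cs Z])
  have "i0 \<in> J1" unfolding J1_def
    using RM.self_in_cyclic_submodule[of i0] i0 submodule_add_upper[OF Z Cs] submodule_add_commute[OF Cs Z] by auto
  then have strict: "?C \<subset> J1" using CJ1 notin by blast
  have J1c: "J1 \<subseteq> carrier R" using ideal_closed(1)[OF J1] .
  have "c \<otimes> \<one> \<in> ?C" by (simp add: scale_def)
  then have cC: "c \<in> ?C" using c_carr by simp
  then have cJ1: "c \<in> J1" using CJ1 by blast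
  have "dual J1 = I"
  proof
    show "dual J1 \<subseteq> I" by (auto simp: dual_def)
    show "I \<subseteq> dual J1"
    proof
      fix i assume i: "i \<in> I"
      note ic = I_carr[OF i]
      have "i \<otimes> j \<in> scale c I" if j: "j \<in> J1" for j
      proof -
        obtain a r where ar: "a \<in> carrier R" "r \<in> carrier R" "j = c \<otimes> a \<oplus> r \<otimes> i0" using J1_mem[OF j] by blast
        have "i \<otimes> j = c \<otimes> i \<otimes> a \<oplus> r \<otimes> (i0 \<otimes> i)"
          unfolding ar(3) using ar ic i0 c_carr by (simp add: r_distr m_ac)
        then show ?thesis
          using cI_mult[OF i ar(1)] mult[OF i] ar(2) ideal_closed(3,4)[OF cI_ideal] by simp
      qed
      then show "i \<in> dual J1" using i by (simp add: dual_def)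
    qed
  qed
  then have "len (scale c I) I \<le> len J1 (carrier R)" using len_dual_le[OF J1 cJ1] by simp
  moreover have "len ?C (carrier R) = len ?C J1 + len J1 (carrier R)"
    by (rule len_add[OF C J1 carrier_ideal CJ1 J1c])
  moreover have "1 \<le> len ?C J1" using rel_length_pos[OF _ _ strict] C J1 submodule_iff by blast
  moreover obtain n where "len J1 (carrier R) = enat n"
    using len_finite[OF c_regular J1 cJ1 carrier_ideal J1c] by blast
  moreover obtain l where "len ?C J1 = enat l"
    using len_finite[OF c_regular C cC J1 CJ1] by blast
  ultimately show False using len_principal_eq by (simp add: one_enat_def)
qed

text \<open>Writing \<open>r u = c i0\<close>, the condition \<open>\<mm> I \<subseteq> c \<mm>\<close> shows that \<open>i0\<close> multiplies \<open>I\<close> into \<open>c I\<close>, so \<open>i0 \<in> c R\<close>.\<close>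

lemma m_U:
  assumes u: "u \<in> U" and r: "r \<in> \<mm>"
  shows "\<exists>v\<in>carrier R. r \<otimes> u = c \<otimes> (c \<otimes> v)"
proof -
  have uI: "u \<in> I" using u by (simp add: U_def)
  note uc = I_carr[OF uI] and rc = m_carr[OF r]
  obtain i0 where i0: "i0 \<in> I" "r \<otimes> u = c \<otimes> i0" using u r by (auto simp: U_def scale_def)
  note i0c = I_carr[OF i0(1)]
  have "i0 \<otimes> i \<in> scale c I" if i: "i \<in> I" for i
  proof -
    note ic = I_carr[OF i]
    obtain s where s: "s \<in> \<mm>" "r \<otimes> i = c \<otimes> s" using m_I[OF r i] by blast
    note sc = m_carr[OF s(1)]
    have "c \<otimes> (i0 \<otimes> i) = (c \<otimes> i0) \<otimes> i" using i0c ic c_carr by (simp add: m_assoc)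
    also have "\<dots> = (r \<otimes> i) \<otimes> u" unfolding i0(2)[symmetric] using rc ic uc by (simp add: m_ac)
    also have "\<dots> = c \<otimes> (s \<otimes> u)" unfolding s(2) using sc uc c_carr by (simp add: m_assoc)
    finally have "i0 \<otimes> i = s \<otimes> u" using i0c ic sc uc by - (rule c_cancel; simp)
    then show ?thesis using u s(1) by (simp add: U_def)
  qed
  then have "i0 \<in> scale c (carrier R)" by (rule multiplier_in_ring[OF i0(1)])
  then show ?thesis using i0(2) by (auto simp: scale_def)
qed

text \<open>Multiplication by \<open>c\<close> maps \<open>c R : \<mm>\<close> onto \<open>U\<close>: an element \<open>u \<in> U\<close> satisfies \<open>c u \<in> c\<^sup>2 R\<close> by the previous lemma,
  so \<open>u = c v\<close>, and then \<open>\<mm> v \<subseteq> c R\<close>. The rest is additivity of length along \<open>c\<^sup>2 R \<subseteq> c I \<subseteq> U\<close> and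
  \<open>c \<mm> \<subseteq> c R \<subseteq> I\<close>, where \<open>U / c I\<close> and \<open>R / \<mm>\<close> both have length one.\<close>

theorem type_eq_generators:
  "len (scale c (carrier R)) {w \<in> carrier R. \<forall>r\<in>\<mm>. r \<otimes> w \<in> scale c (carrier R)} = len (scale c \<mm>) I"
proof -
  let ?C = "scale c (carrier R)"
  let ?W = "{w \<in> carrier R. \<forall>r\<in>\<mm>. r \<otimes> w \<in> ?C}"
  have C: "ideal ?C R" by (rule scale_ideal[OF c_carr carrier_ideal])
  have CC: "ideal (scale c ?C) R" by (rule scale_ideal[OF c_carr C])
  have Cc: "?C \<subseteq> carrier R" using ideal_closed(1)[OF C] .
  have CI: "?C \<subseteq> I" unfolding scale_def using ideal_closed(5)[OF I_ideal _ c_I] by blast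
  have cm: "scale c \<mm> \<subseteq> ?C" by (rule scale_mono[OF ideal_closed(1)[OF m_ideal]])
  have W: "ideal ?W R"
  proof -
    have "?W = socle_mod RM \<mm> c" by (simp add: socle_mod_def multiples_def scale_def)
    then show ?thesis
      using RM.socle_mod_submodule[OF c_carr ideal_closed(1)[OF m_ideal]] submodule_iff by simp
  qed
  have CW: "?C \<subseteq> ?W"
    using Cc ideal_closed(4)[OF C] m_carr by blast
  have CCcI: "scale c ?C \<subseteq> scale c I" by (rule scale_mono[OF CI])
  have CCU: "scale c ?C \<subseteq> U" using CCcI cI_sub_U by blast
  have img: "c \<otimes> w \<in> U" if w: "w \<in> ?W" for w
  proof -
    have wc: "w \<in> carrier R" using w by simp
    have "r \<otimes> (c \<otimes> w) \<in> scale c I" if r: "r \<in> \<mm>" for r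
    proof -
      have "r \<otimes> (c \<otimes> w) = c \<otimes> (r \<otimes> w)" using m_carr[OF r] wc c_carr by (simp add: m_lcomm)
      moreover have "r \<otimes> w \<in> I" using w r CI by blast
      ultimately show ?thesis by (simp add: scale_def)
    qed
    then show ?thesis using ideal_closed(5)[OF I_ideal wc c_I] by (simp add: U_def)
  qed
  have ker: "c \<otimes> w \<in> scale c ?C \<longleftrightarrow> w \<in> ?C" if "w \<in> ?W" for w
    by (rule scale_mem_iff[OF c_regular Cc]) (use that in simp)
  have surj: "\<exists>w\<in>?W. u = c \<otimes> w" if u: "u \<in> U" for u
  proof -
    have uc: "u \<in> carrier R" using u I_carr by (simp add: U_def)
    obtain v where v: "v \<in> carrier R" "c \<otimes> u = c \<otimes> (c \<otimes> v)" using m_U[OF u] c_I I_sub_m by blast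
    have uv: "u = c \<otimes> v" using v uc c_carr by - (rule c_cancel; simp)
    have "r \<otimes> v \<in> ?C" if r: "r \<in> \<mm>" for r
    proof -
      obtain y where y: "y \<in> carrier R" "r \<otimes> u = c \<otimes> (c \<otimes> y)" using m_U[OF u r] by blast
      have "c \<otimes> (r \<otimes> v) = c \<otimes> (c \<otimes> y)"
        using y uv v(1) m_carr[OF r] c_carr by (simp add: m_lcomm)
      then have "r \<otimes> v = c \<otimes> y" using v(1) y(1) m_carr[OF r] c_carr by - (rule c_cancel; simp)
      then show ?thesis using y(1) by (simp add: scale_def)
    qed
    then show ?thesis using uv v(1) by blast
  qed
  have "len ?C ?W = len (scale c ?C) U"
  proof (rule antisym)
    show "len ?C ?W \<le> len (scale c ?C) U" by (rule len_mult_le[OF c_carr C W CW CC U_ideal CCU img ker])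
    show "len (scale c ?C) U \<le> len ?C ?W" by (rule len_mult_ge[OF c_carr C W CW CC U_ideal CCU img ker surj])
  qed
  also have "\<dots> = len (scale c ?C) (scale c I) + len (scale c I) U"
    by (rule len_add[OF CC cI_ideal U_ideal CCcI cI_sub_U])
  also have "\<dots> = len ?C I + len \<mm> (carrier R)"
    using len_scale[OF c_regular C I_ideal CI] type1 len_m by (simp add: U_def)
  also have "\<dots> = len (scale c \<mm>) ?C + len ?C I"
    using len_scale[OF c_regular m_ideal carrier_ideal ideal_closed(1)[OF m_ideal]] by (simp add: add.commute)
  also have "\<dots> = len (scale c \<mm>) I"
    by (rule len_add[OF scale_ideal[OF c_carr m_ideal] C I_ideal cm CI, symmetric])
  finally show ?thesis .
qed

end

section \<open>Powers and products of ideals\<close>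

lemma ideal_power_0: "ideal_power R J 0 = carrier R"
  by (simp add: nat_pow_def ideals_set_def)

lemma ideal_power_Suc: "ideal_power R J (Suc n) = ideal_prod R (ideal_power R J n) J"
  by (simp add: nat_pow_def ideals_set_def)

lemma ideals_set_ops [simp]:
  "\<one>\<^bsub>ideals_set R\<^esub> = carrier R" "A \<otimes>\<^bsub>ideals_set R\<^esub> B = ideal_prod R A B"
  by (simp_all add: ideals_set_def)

lemma ideal_prod_mono:
  assumes "A \<subseteq> A'" "B \<subseteq> B'"
  shows "ideal_prod R A B \<subseteq> ideal_prod R A' B'"
proof
  fix x assume "x \<in> ideal_prod R A B"
  then show "x \<in> ideal_prod R A' B'"
    by induction (use assms in \<open>auto intro: ideal_prod.intros\<close>)
qed

context cring begin

lemma ideal_power_ideal: "ideal J R \<Longrightarrow> ideal (ideal_power R J n) R"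
  by (induction n) (simp_all add: ideal_power_0 ideal_power_Suc oneideal ideal_prod_is_ideal)

lemma ideal_carrier_prod: "ideal J R \<Longrightarrow> ideal_prod R (carrier R) J = J"
  using ideal_prod_one[of J] ideal_prod_commute[OF oneideal, of J] by simp

lemma ideal_power_1: "ideal J R \<Longrightarrow> ideal_power R J (Suc 0) = J"
  by (simp add: ideal_power_Suc ideal_power_0 ideal_carrier_prod)

lemma ideal_power_decreasing: "ideal J R \<Longrightarrow> ideal_power R J (Suc n) \<subseteq> ideal_power R J n"
  using ideal_prod_inter[OF ideal_power_ideal[of J n], of J] by (simp add: ideal_power_Suc)

lemma ideal_power_mult:
  assumes J: "ideal J R" and x: "x \<in> ideal_power R J m" and y: "y \<in> ideal_power R J n"
  shows "x \<otimes> y \<in> ideal_power R J (m + n)"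
proof -
  have "ideal_prod R (ideal_power R J m) (ideal_power R J n) = ideal_power R J (m + n)"
  proof (induction n)
    case 0
    then show ?case using ideal_prod_one[OF ideal_power_ideal[OF J]] by (simp add: ideal_power_0)
  next
    case (Suc n)
    then show ?case
      using ideal_prod_assoc[OF ideal_power_ideal[OF J] ideal_power_ideal[OF J] J, of m n]
      by (simp add: ideal_power_Suc)
  qed
  then show ?thesis using ideal_prod.prod[OF x y, of R] by simp
qed

lemma ideal_finsum:
  assumes J: "ideal J R" and "finite A" "\<And>i. i \<in> A \<Longrightarrow> f i \<in> J"
  shows "finsum R f A \<in> J"
  using assms(2,3)
proof (induction A)
  case empty
  then show ?case using ideal_closed(2)[OF J] by simp
next
  case (insert x A)
  then have "f \<in> A \<rightarrow> carrier R" "f x \<in> carrier R" using ideal_closed(1)[OF J] by auto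
  then show ?case using insert ideal_closed(3)[OF J] by (simp add: finsum_insert)
qed

lemma ideal_minus: "ideal J R \<Longrightarrow> x \<in> J \<Longrightarrow> y \<in> J \<Longrightarrow> x \<ominus> y \<in> J"
  using submodule_minus[of R J "ring_module R" x y] submodule_ring_module_iff[of J]
  by (simp only: ring_module_minus)

lemma ideal_uminus: "ideal J R \<Longrightarrow> x \<in> J \<Longrightarrow> \<ominus> x \<in> J"
  by (simp add: additive_subgroup.a_inv_closed ideal.axioms(1))

end

section \<open>The quotient of the Rees algebra\<close>

locale rees = cring R for R (structure) +
  fixes \<mm> I a b
  assumes max: "maximalideal \<mm> R"
    and proper_sub: "\<And>J. ideal J R \<Longrightarrow> J \<noteq> carrier R \<Longrightarrow> J \<subseteq> \<mm>"
    and I_ideal: "ideal I R" and I_sub_m: "I \<subseteq> \<mm>"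
    and a_carr: "a \<in> carrier R" and b_carr: "b \<in> carrier R"
begin

abbreviation "P \<equiv> UP R"

abbreviation "pmonom \<equiv> up_ring.monom P"

abbreviation "pcoeff \<equiv> up_ring.coeff P"

sublocale UP: UP_cring R "UP R"
  by (intro UP_cring.intro) (rule cring_axioms)

abbreviation "ipow n \<equiv> ideal_power R I n"

definition quad where "quad = pmonom \<one> 2 \<oplus>\<^bsub>P\<^esub> pmonom a 1 \<oplus>\<^bsub>P\<^esub> pmonom b 0"

definition A where "A = rees_algebra R I"

definition K where "K = PIdl\<^bsub>P\<^esub> quad \<inter> carrier A"

definition S where "S = rees_quotient R I a b"

lemma S_eq: "S = A Quot K"
  by (simp add: S_def rees_quotient_def Let_def A_def K_def quad_def)

lemma ipow_ideal: "ideal (ipow n) R" by (rule ideal_power_ideal[OF I_ideal])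

lemma ipow_carr: "x \<in> ipow n \<Longrightarrow> x \<in> carrier R" using ideal_closed(1)[OF ipow_ideal] by blast

lemma I_carr: "x \<in> I \<Longrightarrow> x \<in> carrier R" using ideal_closed(1)[OF I_ideal] by blast

lemma ipow_1: "ipow (Suc 0) = I" by (rule ideal_power_1[OF I_ideal])

lemma A_carrier: "carrier A = {p \<in> carrier P. \<forall>n. pcoeff p n \<in> ipow n}"
  by (simp add: A_def rees_algebra_def)

lemma A_ops: "x \<oplus>\<^bsub>A\<^esub> y = x \<oplus>\<^bsub>P\<^esub> y" "x \<otimes>\<^bsub>A\<^esub> y = x \<otimes>\<^bsub>P\<^esub> y" "\<one>\<^bsub>A\<^esub> = \<one>\<^bsub>P\<^esub>" "\<zero>\<^bsub>A\<^esub> = \<zero>\<^bsub>P\<^esub>"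
  by (simp_all add: A_def rees_algebra_def)

lemma A_P: "p \<in> carrier A \<Longrightarrow> p \<in> carrier P" by (simp add: A_carrier)

lemma A_coeff: "p \<in> carrier A \<Longrightarrow> pcoeff p n \<in> ipow n" by (simp add: A_carrier)

lemma A_cring: "cring A"
proof -
  have "subring (carrier A) P"
  proof (rule UP.P.subringI)
    show "carrier A \<subseteq> carrier P" using A_P by blast
    show "\<one>\<^bsub>P\<^esub> \<in> carrier A"
      using ideal_closed(2)[OF ipow_ideal] by (auto simp: A_carrier ideal_power_0)
  next
    fix p assume "p \<in> carrier A"
    then show "\<ominus>\<^bsub>P\<^esub> p \<in> carrier A" using ideal_uminus[OF ipow_ideal] by (simp add: A_carrier)
  next
    fix p q assume p: "p \<in> carrier A" and q: "q \<in> carrier A"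
    show "p \<oplus>\<^bsub>P\<^esub> q \<in> carrier A" using p q ideal_closed(3)[OF ipow_ideal] by (simp add: A_carrier)
    have "pcoeff (p \<otimes>\<^bsub>P\<^esub> q) n \<in> ipow n" for n
    proof -
      have "pcoeff p i \<otimes> pcoeff q (n - i) \<in> ipow n" if "i \<in> {..n}" for i
        using ideal_power_mult[OF I_ideal A_coeff[OF p, of i] A_coeff[OF q, of "n - i"]] that by simp
      then have "(\<Oplus>i\<in>{..n}. pcoeff p i \<otimes> pcoeff q (n - i)) \<in> ipow n"
        by (rule ideal_finsum[OF ipow_ideal finite_atMost])
      then show ?thesis using A_P[OF p] A_P[OF q] by simp
    qed
    then show "p \<otimes>\<^bsub>P\<^esub> q \<in> carrier A" using A_P[OF p] A_P[OF q] by (simp add: A_carrier)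
  qed
  then have "subcring (carrier A) P" by (rule UP.P.subcringI')
  then have "cring (P\<lparr>carrier := carrier A\<rparr>)" using UP.P.subcring_iff A_P by blast
  moreover have "P\<lparr>carrier := carrier A\<rparr> = A" by (simp add: A_def rees_algebra_def)
  ultimately show ?thesis by simp
qed

sublocale A: cring A by (rule A_cring)

lemma quad_closed: "quad \<in> carrier P"
  using a_carr b_carr by (simp add: quad_def)

lemma K_iff: "k \<in> K \<longleftrightarrow> k \<in> carrier A \<and> (\<exists>g\<in>carrier P. k = g \<otimes>\<^bsub>P\<^esub> quad)"
  by (auto simp: K_def cgenideal_def)

lemma K_ideal: "ideal K A"
proof (rule A.idealI_comm)
  note PI = UP.P.ideal_closed[OF UP.P.cgenideal_ideal[OF quad_closed]]
  show "K \<subseteq> carrier A" by (simp add: K_def)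
  show "\<zero>\<^bsub>A\<^esub> \<in> K" using PI(2) A.zero_closed by (simp add: K_def A_ops)
  show "x \<oplus>\<^bsub>A\<^esub> y \<in> K" if "x \<in> K" "y \<in> K" for x y
    using that PI(3)[of x y] A.a_closed[of x y] by (simp add: K_def A_ops)
  show "r \<otimes>\<^bsub>A\<^esub> x \<in> K" if "r \<in> carrier A" "x \<in> K" for r x
    using that PI(4)[of r x] A_P[of r] A.m_closed[of r x] by (simp add: K_def A_ops)
qed

sublocale K: ideal K A by (rule K_ideal)

sublocale S: cring S unfolding S_eq by (rule K.quotient_is_cring[OF A_cring])

definition lin where "lin r i = pmonom r 0 \<oplus>\<^bsub>P\<^esub> pmonom i 1"

definition \<Phi> where "\<Phi> r i = K +>\<^bsub>A\<^esub> lin r i"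

lemma lin_P: "r \<in> carrier R \<Longrightarrow> i \<in> carrier R \<Longrightarrow> lin r i \<in> carrier P"
  by (simp add: lin_def)

lemma coeff_lin:
  "r \<in> carrier R \<Longrightarrow> i \<in> carrier R \<Longrightarrow> pcoeff (lin r i) n = (if n = 0 then r else if n = 1 then i else \<zero>)"
  by (auto simp: lin_def)

lemma lin_A: "r \<in> carrier R \<Longrightarrow> i \<in> I \<Longrightarrow> lin r i \<in> carrier A"
  using lin_P I_carr ideal_closed(2)[OF ipow_ideal]
  by (auto simp: A_carrier coeff_lin ideal_power_0 ideal_carrier_prod[OF I_ideal])

lemma monom_mult_quad:
  assumes u: "u \<in> carrier R"
  shows "pmonom u n \<otimes>\<^bsub>P\<^esub> quad = pmonom u (n + 2) \<oplus>\<^bsub>P\<^esub> pmonom (u \<otimes> a) (n + 1) \<oplus>\<^bsub>P\<^esub> pmonom (u \<otimes> b) n"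
proof -
  have "pmonom u n \<otimes>\<^bsub>P\<^esub> quad = pmonom u n \<otimes>\<^bsub>P\<^esub> pmonom \<one> 2 \<oplus>\<^bsub>P\<^esub> pmonom u n \<otimes>\<^bsub>P\<^esub> pmonom a 1 \<oplus>\<^bsub>P\<^esub> pmonom u n \<otimes>\<^bsub>P\<^esub> pmonom b 0"
    using u a_carr b_carr by (simp add: quad_def UP.P.r_distr del: UP.monom_mult)
  also have "pmonom u n \<otimes>\<^bsub>P\<^esub> pmonom \<one> 2 = pmonom u (n + 2)"
    using UP.monom_mult[OF u one_closed, of n 2] u by simp
  also have "pmonom u n \<otimes>\<^bsub>P\<^esub> pmonom a 1 = pmonom (u \<otimes> a) (n + 1)"
    using UP.monom_mult[OF u a_carr, of n 1] by simp
  also have "pmonom u n \<otimes>\<^bsub>P\<^esub> pmonom b 0 = pmonom (u \<otimes> b) n"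
    using UP.monom_mult[OF u b_carr, of n 0] by simp
  finally show ?thesis .
qed

lemma coeff_mult_quad:
  assumes g: "g \<in> carrier P"
  shows "pcoeff (g \<otimes>\<^bsub>P\<^esub> quad) (n + 2) = pcoeff g n \<oplus> a \<otimes> pcoeff g (n + 1) \<oplus> b \<otimes> pcoeff g (n + 2)"
proof -
  have "g \<otimes>\<^bsub>P\<^esub> quad = pmonom \<one> 2 \<otimes>\<^bsub>P\<^esub> g \<oplus>\<^bsub>P\<^esub> pmonom a 1 \<otimes>\<^bsub>P\<^esub> g \<oplus>\<^bsub>P\<^esub> pmonom b 0 \<otimes>\<^bsub>P\<^esub> g"
    unfolding UP.P.m_comm[OF g quad_closed] using g a_carr b_carr by (simp add: quad_def UP.P.l_distr)
  moreover have "pcoeff (pmonom \<one> 2 \<otimes>\<^bsub>P\<^esub> g) (n + 2) = pcoeff g n"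
    using UP.coeff_monom_mult[OF one_closed g, of 2 n] UP.coeff_closed[OF g] by (simp del: UP.coeff_mult)
  moreover have "pcoeff (pmonom a 1 \<otimes>\<^bsub>P\<^esub> g) (n + 2) = a \<otimes> pcoeff g (n + 1)"
    using UP.coeff_monom_mult[OF a_carr g, of 1 "n + 1"] by (simp del: UP.coeff_mult)
  moreover have "pcoeff (pmonom b 0 \<otimes>\<^bsub>P\<^esub> g) (n + 2) = b \<otimes> pcoeff g (n + 2)"
    using UP.coeff_monom_mult[OF b_carr g, of 0 "n + 2"] by (simp del: UP.coeff_mult)
  ultimately show ?thesis using g a_carr b_carr by (simp del: UP.coeff_mult)
qed

text \<open>The top coefficient of \<open>g\<close> survives in the product because the quadratic polynomial is monic, so no
  nonzero multiple of it has degree below two.\<close>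

lemma quad_multiple_linear:
  assumes g: "g \<in> carrier P" and van: "\<And>n. pcoeff (g \<otimes>\<^bsub>P\<^esub> quad) (n + 2) = \<zero>"
  shows "g = \<zero>\<^bsub>P\<^esub>"
proof -
  have gc: "pcoeff g n \<in> carrier R" for n using g by simp
  have "\<forall>m\<ge>n. pcoeff g m = \<zero>" if "\<forall>m\<ge>n + k. pcoeff g m = \<zero>" for n k
    using that
  proof (induction k)
    case (Suc k)
    have "pcoeff g (n + k) = \<zero>"
      using van[of "n + k"] Suc.prems a_carr b_carr gc coeff_mult_quad[OF g, of "n + k"] by simp
    then have "\<forall>m\<ge>n + k. pcoeff g m = \<zero>"
      using Suc.prems by (metis add_Suc_right le_antisym not_less_eq_eq)
    then show ?case by (rule Suc.IH)
  qed simp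
  moreover have "\<forall>m\<ge>0 + Suc (deg R g). pcoeff g m = \<zero>" using UP.deg_aboveD[OF _ g] by simp
  ultimately have "pcoeff g m = \<zero>" for m by blast
  then show ?thesis using g by (intro UP.up_eqI) auto
qed

lemma coset_eq_iff_K:
  assumes "p \<in> carrier A" "q \<in> carrier A"
  shows "K +>\<^bsub>A\<^esub> p = K +>\<^bsub>A\<^esub> q \<longleftrightarrow> (\<exists>k\<in>K. p = k \<oplus>\<^bsub>P\<^esub> q)"
proof
  assume "K +>\<^bsub>A\<^esub> p = K +>\<^bsub>A\<^esub> q"
  then have "p \<in> K +>\<^bsub>A\<^esub> q" using K.a_rcos_self[OF assms(1)] by simp
  then show "\<exists>k\<in>K. p = k \<oplus>\<^bsub>P\<^esub> q" by (auto simp: a_r_coset_def' A_ops)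
next
  assume "\<exists>k\<in>K. p = k \<oplus>\<^bsub>P\<^esub> q"
  then have "p \<in> K +>\<^bsub>A\<^esub> q" by (auto simp: a_r_coset_def' A_ops)
  then show "K +>\<^bsub>A\<^esub> p = K +>\<^bsub>A\<^esub> q" using K.a_repr_independence'[OF _ assms(2)] by simp
qed

lemma \<Phi>_inject:
  assumes "r \<in> carrier R" "s \<in> carrier R" "i \<in> I" "j \<in> I"
  shows "\<Phi> r i = \<Phi> s j \<longleftrightarrow> r = s \<and> i = j"
proof
  assume "\<Phi> r i = \<Phi> s j"
  then obtain k where k: "k \<in> K" "lin r i = k \<oplus>\<^bsub>P\<^esub> lin s j"
    using coset_eq_iff_K[OF lin_A lin_A] assms unfolding \<Phi>_def by blast
  note ijc = I_carr[OF assms(3)] I_carr[OF assms(4)]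
  obtain g where g: "g \<in> carrier P" "k = g \<otimes>\<^bsub>P\<^esub> quad" using k K_iff by blast
  have kP: "k \<in> carrier P" using k K_iff A_P by blast
  have eq: "pcoeff (lin r i) n = pcoeff k n \<oplus> pcoeff (lin s j) n" for n
    using k(2) kP lin_P assms ijc by (simp del: UP.coeff_mult)
  have "pcoeff k (n + 2) = \<zero>" for n
    using eq[of "n + 2"] assms ijc kP by (simp add: coeff_lin)
  then have "g = \<zero>\<^bsub>P\<^esub>" using quad_multiple_linear[OF g(1)] g(2) by blast
  then have k0: "pcoeff k n = \<zero>" for n using g quad_closed by simp
  show "r = s \<and> i = j" using eq[of 0] eq[of 1] k0 assms ijc by (simp add: coeff_lin)
qed simp

text \<open>Division with remainder stays inside the Rees algebra: the leading coefficient \<open>u \<in> I\<^sup>n\<^sup>+\<^sup>2\<close> is cancelled by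
  \<open>u t\<^sup>n (t\<^sup>2 + a t + b)\<close>, whose lower coefficients \<open>u a\<close> and \<open>u b\<close> lie in \<open>I\<^sup>n\<^sup>+\<^sup>2\<close> as well.\<close>

lemma reduce_to_linear:
  assumes "p \<in> carrier A" "\<And>m. m > n + 1 \<Longrightarrow> pcoeff p m = \<zero>"
  shows "\<exists>g\<in>carrier P. \<exists>r\<in>carrier R. \<exists>i\<in>I. p = g \<otimes>\<^bsub>P\<^esub> quad \<oplus>\<^bsub>P\<^esub> lin r i"
  using assms
proof (induction n arbitrary: p)
  case 0
  note pP = A_P[OF 0(1)]
  have c: "pcoeff p 0 \<in> carrier R" "pcoeff p 1 \<in> I"
    using A_coeff[OF 0(1), of 1] pP ipow_1 by simp_all
  have "p = \<zero>\<^bsub>P\<^esub> \<otimes>\<^bsub>P\<^esub> quad \<oplus>\<^bsub>P\<^esub> lin (pcoeff p 0) (pcoeff p 1)"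
  proof (rule UP.up_eqI)
    fix m
    show "pcoeff p m = pcoeff (\<zero>\<^bsub>P\<^esub> \<otimes>\<^bsub>P\<^esub> quad \<oplus>\<^bsub>P\<^esub> lin (pcoeff p 0) (pcoeff p 1)) m"
      using 0(2)[of m] pP quad_closed lin_P[OF c(1) I_carr[OF c(2)]] c I_carr
      by (simp add: coeff_lin)
  qed (use pP quad_closed lin_P[OF c(1) I_carr[OF c(2)]] in auto)
  then show ?case using c UP.P.zero_closed by blast
next
  case (Suc n)
  note pP = A_P[OF Suc(2)]
  define u where "u = pcoeff p (n + 2)"
  have ui: "u \<in> ipow (n + 2)" unfolding u_def by (rule A_coeff[OF Suc(2)])
  have uc: "u \<in> carrier R" using ipow_carr[OF ui] .
  have u1: "u \<in> ipow (n + 1)" using ui ideal_power_decreasing[OF I_ideal, of "n + 1"] by auto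
  have u0: "u \<in> ipow n" using u1 ideal_power_decreasing[OF I_ideal, of n] by auto
  define q where "q = pmonom u n \<otimes>\<^bsub>P\<^esub> quad"
  have qP: "q \<in> carrier P" unfolding q_def using uc quad_closed by simp
  have qc: "pcoeff q m = (if m = n + 2 then u else if m = n + 1 then u \<otimes> a else if m = n then u \<otimes> b else \<zero>)" for m
    unfolding q_def monom_mult_quad[OF uc] using uc a_carr b_carr by auto
  have qi: "pcoeff q m \<in> ipow m" for m
    unfolding qc using ui ideal_closed(5)[OF ipow_ideal a_carr u1] ideal_closed(5)[OF ipow_ideal b_carr u0]
      ideal_closed(2)[OF ipow_ideal] by auto
  define p' where "p' = p \<oplus>\<^bsub>P\<^esub> \<ominus>\<^bsub>P\<^esub> q"
  have p'P: "p' \<in> carrier P" unfolding p'_def using pP qP by simp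
  have p'c: "pcoeff p' m = pcoeff p m \<ominus> pcoeff q m" for m
    unfolding p'_def using pP qP by (simp add: a_minus_def)
  have "p' \<in> carrier A"
    unfolding A_carrier using p'P ideal_minus[OF ipow_ideal A_coeff[OF Suc(2)] qi] by (simp add: p'c)
  moreover have "pcoeff p' m = \<zero>" if m: "m > n + 1" for m
  proof (cases "m = n + 2")
    case True
    then show ?thesis unfolding p'c qc using uc by (simp add: u_def a_minus_def r_neg)
  next
    case False
    then show ?thesis unfolding p'c qc using Suc(3)[of m] m by (simp add: a_minus_def)
  qed
  ultimately obtain g r i where gri: "g \<in> carrier P" "r \<in> carrier R" "i \<in> I" "p' = g \<otimes>\<^bsub>P\<^esub> quad \<oplus>\<^bsub>P\<^esub> lin r i"
    using Suc.IH[of p'] by blast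
  note linP = lin_P[OF gri(2) I_carr[OF gri(3)]]
  have "p = p' \<oplus>\<^bsub>P\<^esub> q" unfolding p'_def using pP qP by (simp add: UP.P.a_assoc UP.P.l_neg)
  also have "\<dots> = (g \<oplus>\<^bsub>P\<^esub> pmonom u n) \<otimes>\<^bsub>P\<^esub> quad \<oplus>\<^bsub>P\<^esub> lin r i"
    unfolding gri(4) q_def using gri(1) linP quad_closed uc by (simp add: UP.P.l_distr UP.P.a_ac)
  finally show ?case using gri(1-3) uc by (intro bexI[of _ "g \<oplus>\<^bsub>P\<^esub> pmonom u n"] bexI[of _ r] bexI[of _ i]) auto
qed

lemma S_carrier: "carrier S = {\<Phi> r i | r i. r \<in> carrier R \<and> i \<in> I}"
proof
  show "{\<Phi> r i | r i. r \<in> carrier R \<and> i \<in> I} \<subseteq> carrier S"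
    using lin_A by (auto simp: S_eq quot_ring_simps \<Phi>_def A_RCOSETS_def')
  show "carrier S \<subseteq> {\<Phi> r i | r i. r \<in> carrier R \<and> i \<in> I}"
  proof
    fix x assume "x \<in> carrier S"
    then obtain p where p: "p \<in> carrier A" "x = K +>\<^bsub>A\<^esub> p"
      by (auto simp: S_eq quot_ring_simps A_RCOSETS_def')
    note pP = A_P[OF p(1)]
    have "pcoeff p m = \<zero>" if "m > deg R p + 1" for m using UP.deg_aboveD[OF _ pP, of m] that by simp
    then obtain g r i where gri: "g \<in> carrier P" "r \<in> carrier R" "i \<in> I" "p = g \<otimes>\<^bsub>P\<^esub> quad \<oplus>\<^bsub>P\<^esub> lin r i"
      using reduce_to_linear[OF p(1), of "deg R p"] by blast
    define k where "k = g \<otimes>\<^bsub>P\<^esub> quad"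
    have kP: "k \<in> carrier P" unfolding k_def using gri(1) quad_closed by simp
    note linA = lin_A[OF gri(2,3)] and linP = lin_P[OF gri(2) I_carr[OF gri(3)]]
    have "pcoeff k m \<in> ipow m" for m
    proof -
      have "pcoeff p m = pcoeff k m \<oplus> pcoeff (lin r i) m"
        unfolding gri(4) k_def[symmetric] using kP linP by (simp del: UP.coeff_mult)
      then have "pcoeff k m = pcoeff p m \<ominus> pcoeff (lin r i) m"
        using kP linP UP.coeff_closed[of k m] UP.coeff_closed[of "lin r i" m]
        by (simp add: a_minus_def a_assoc r_neg del: UP.coeff_mult)
      then show ?thesis using ideal_minus[OF ipow_ideal A_coeff[OF p(1)] A_coeff[OF linA]] by simp
    qed
    then have "k \<in> K" unfolding K_iff using kP gri(1) k_def by (auto simp: A_carrier)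
    then have "x = \<Phi> r i"
      unfolding p(2) \<Phi>_def using coset_eq_iff_K[OF p(1) linA] gri(4) k_def by blast
    then show "x \<in> {\<Phi> r i | r i. r \<in> carrier R \<and> i \<in> I}" using gri by blast
  qed
qed

lemma \<Phi>_S: "r \<in> carrier R \<Longrightarrow> i \<in> I \<Longrightarrow> \<Phi> r i \<in> carrier S"
  unfolding S_carrier by blast

lemma \<Phi>_add:
  assumes "r \<in> carrier R" "s \<in> carrier R" "i \<in> I" "j \<in> I"
  shows "\<Phi> r i \<oplus>\<^bsub>S\<^esub> \<Phi> s j = \<Phi> (r \<oplus> s) (i \<oplus> j)"
proof -
  have "lin r i \<oplus>\<^bsub>P\<^esub> lin s j = lin (r \<oplus> s) (i \<oplus> j)"
    using assms I_carr by (intro UP.up_eqI) (auto simp: lin_P coeff_lin)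
  then show ?thesis
    using K.a_rcos_sum[OF lin_A[OF assms(1,3)] lin_A[OF assms(2,4)]]
    by (simp add: S_eq quot_ring_simps \<Phi>_def A_ops)
qed

text \<open>Substitute \<open>t\<^sup>2 = - a t - b\<close> into \<open>(r + i t) (s + j t)\<close>.\<close>

lemma \<Phi>_mult:
  assumes r: "r \<in> carrier R" and s: "s \<in> carrier R" and i: "i \<in> I" and j: "j \<in> I"
  shows "\<Phi> r i \<otimes>\<^bsub>S\<^esub> \<Phi> s j = \<Phi> (r \<otimes> s \<ominus> b \<otimes> (i \<otimes> j)) (r \<otimes> j \<oplus> i \<otimes> s \<ominus> a \<otimes> (i \<otimes> j))"
proof -
  note ic = I_carr[OF i] and jc = I_carr[OF j]
  note Ic = ideal_closed[OF I_ideal]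
  let ?r = "r \<otimes> s \<ominus> b \<otimes> (i \<otimes> j)" and ?i = "r \<otimes> j \<oplus> i \<otimes> s \<ominus> a \<otimes> (i \<otimes> j)"
  have rc: "?r \<in> carrier R" using r s ic jc b_carr by simp
  have iI: "?i \<in> I"
    using ideal_minus[OF I_ideal Ic(3)[OF Ic(4)[OF r j] Ic(5)[OF s i]] Ic(4)[OF a_carr Ic(5)[OF jc i]]] .
  define k where "k = pmonom (i \<otimes> j) 0 \<otimes>\<^bsub>P\<^esub> quad"
  have ijc: "i \<otimes> j \<in> carrier R" using ic jc by simp
  have keq: "k = pmonom (i \<otimes> j) 2 \<oplus>\<^bsub>P\<^esub> pmonom (i \<otimes> j \<otimes> a) 1 \<oplus>\<^bsub>P\<^esub> pmonom (i \<otimes> j \<otimes> b) 0"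
    unfolding k_def monom_mult_quad[OF ijc] by (simp add: numeral_2_eq_2)
  have ij2: "i \<otimes> j \<in> ipow 2"
    using ideal_power_mult[OF I_ideal, of i 1 j 1] i j ipow_1 by (simp add: numeral_2_eq_2)
  have kP: "k \<in> carrier P" unfolding k_def using ijc quad_closed by simp
  have kcoeff: "pcoeff k m = (if m = 2 then i \<otimes> j else if m = 1 then i \<otimes> j \<otimes> a else if m = 0 then i \<otimes> j \<otimes> b else \<zero>)" for m
    unfolding keq using ijc a_carr b_carr by auto
  have "i \<otimes> j \<otimes> a \<in> ipow (Suc 0)" unfolding ipow_1 using Ic(5)[OF a_carr Ic(5)[OF jc i]] .
  then have "pcoeff k m \<in> ipow m" for m
    unfolding kcoeff using ij2 ijc b_carr ideal_closed(2)[OF ipow_ideal] by (auto simp: ideal_power_0)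
  then have kK: "k \<in> K" unfolding K_iff using kP k_def ijc by (auto simp: A_carrier)
  have "lin r i \<otimes>\<^bsub>P\<^esub> lin s j = pmonom r 0 \<otimes>\<^bsub>P\<^esub> pmonom s 0 \<oplus>\<^bsub>P\<^esub> pmonom r 0 \<otimes>\<^bsub>P\<^esub> pmonom j 1
      \<oplus>\<^bsub>P\<^esub> (pmonom i 1 \<otimes>\<^bsub>P\<^esub> pmonom s 0 \<oplus>\<^bsub>P\<^esub> pmonom i 1 \<otimes>\<^bsub>P\<^esub> pmonom j 1)"
    unfolding lin_def using r s ic jc by (simp add: UP.P.l_distr UP.P.r_distr UP.P.a_ac del: UP.monom_mult)
  also have "pmonom r 0 \<otimes>\<^bsub>P\<^esub> pmonom s 0 = pmonom (r \<otimes> s) 0" using UP.monom_mult[OF r s, of 0 0] by simp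
  also have "pmonom r 0 \<otimes>\<^bsub>P\<^esub> pmonom j 1 = pmonom (r \<otimes> j) 1" using UP.monom_mult[OF r jc, of 0 1] by simp
  also have "pmonom i 1 \<otimes>\<^bsub>P\<^esub> pmonom s 0 = pmonom (i \<otimes> s) 1" using UP.monom_mult[OF ic s, of 1 0] by simp
  also have "pmonom i 1 \<otimes>\<^bsub>P\<^esub> pmonom j 1 = pmonom (i \<otimes> j) 2" using UP.monom_mult[OF ic jc, of 1 1] by (simp add: numeral_2_eq_2)
  also have "pmonom (r \<otimes> s) 0 \<oplus>\<^bsub>P\<^esub> pmonom (r \<otimes> j) 1 \<oplus>\<^bsub>P\<^esub> (pmonom (i \<otimes> s) 1 \<oplus>\<^bsub>P\<^esub> pmonom (i \<otimes> j) 2) = k \<oplus>\<^bsub>P\<^esub> lin ?r ?i"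
    (is "?L = _")
  proof (rule UP.up_eqI)
    fix m
    have L: "pcoeff ?L m = (if m = 0 then r \<otimes> s else if m = 1 then r \<otimes> j \<oplus> i \<otimes> s else if m = 2 then i \<otimes> j else \<zero>)"
      using r s ic jc by auto
    have "pcoeff (k \<oplus>\<^bsub>P\<^esub> lin ?r ?i) m = pcoeff k m \<oplus> pcoeff (lin ?r ?i) m"
      using kP lin_P[OF rc I_carr[OF iI]] by simp
    also have "\<dots> = (if m = 2 then i \<otimes> j else if m = 1 then i \<otimes> j \<otimes> a \<oplus> ?i else if m = 0 then i \<otimes> j \<otimes> b \<oplus> ?r else \<zero>)"
      unfolding kcoeff coeff_lin[OF rc I_carr[OF iI]] using ijc by simp
    also have "i \<otimes> j \<otimes> a \<oplus> ?i = r \<otimes> j \<oplus> i \<otimes> s"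
      using r s ic jc a_carr by (simp add: a_minus_def m_comm[of a] a_ac r_neg r_neg1 r_neg2)
    also have "i \<otimes> j \<otimes> b \<oplus> ?r = r \<otimes> s"
      using r s ic jc b_carr by (simp add: a_minus_def m_comm[of b] a_ac r_neg r_neg1 r_neg2)
    finally show "pcoeff ?L m = pcoeff (k \<oplus>\<^bsub>P\<^esub> lin ?r ?i) m" unfolding L by simp
  qed (use r s ic jc kP lin_P[OF rc I_carr[OF iI]] in auto)
  finally have eq: "lin r i \<otimes>\<^bsub>P\<^esub> lin s j = k \<oplus>\<^bsub>P\<^esub> lin ?r ?i" .
  have "\<Phi> r i \<otimes>\<^bsub>S\<^esub> \<Phi> s j = K +>\<^bsub>A\<^esub> (lin r i \<otimes>\<^bsub>A\<^esub> lin s j)"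
    using K.rcoset_mult_add[OF lin_A[OF r i] lin_A[OF s j]] by (simp add: S_eq quot_ring_simps \<Phi>_def)
  also have "\<dots> = \<Phi> ?r ?i"
    unfolding \<Phi>_def
    using coset_eq_iff_K[OF A.m_closed[OF lin_A[OF r i] lin_A[OF s j]] lin_A[OF rc iI]] eq kK
    by (auto simp: A_ops)
  finally show ?thesis .
qed

lemma \<Phi>_one: "\<one>\<^bsub>S\<^esub> = \<Phi> \<one> \<zero>"
proof -
  have "lin \<one> \<zero> = \<one>\<^bsub>P\<^esub>" by (rule UP.up_eqI) (auto simp: lin_P coeff_lin)
  then show ?thesis by (simp add: S_eq quot_ring_simps \<Phi>_def A_ops)
qed

lemma \<Phi>_zero: "\<zero>\<^bsub>S\<^esub> = \<Phi> \<zero> \<zero>"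
proof -
  have z: "\<zero> \<in> I" by (rule ideal_closed(2)[OF I_ideal])
  have "\<Phi> \<zero> \<zero> \<oplus>\<^bsub>S\<^esub> \<Phi> \<zero> \<zero> = \<Phi> \<zero> \<zero>" using \<Phi>_add[of \<zero> \<zero> \<zero> \<zero>] z by simp
  then show ?thesis using \<Phi>_S[OF zero_closed z] by (metis S.add.l_cancel_one' S.r_zero)
qed

end

section \<open>Powers of the maximal ideal of the quotient\<close>

context rees begin

definition pair_set where "pair_set B C = {\<Phi> r i | r i. r \<in> B \<and> i \<in> C}"

text \<open>Shown below to be the maximal ideal, called \<open>\<nn>\<close> in the overview.\<close>

definition nn where "nn = pair_set \<mm> I"

definition mpow where "mpow h = ideal_power R \<mm> h"

definition mI where "mI h = ideal_prod R (mpow h) I"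

lemma m_ideal: "ideal \<mm> R" using max by (rule maximalideal.axioms(1))

lemma m_carr: "x \<in> \<mm> \<Longrightarrow> x \<in> carrier R" using ideal_closed(1)[OF m_ideal] by blast

lemma zero_I: "\<zero> \<in> I" by (rule ideal_closed(2)[OF I_ideal])

lemma mpow_ideal: "ideal (mpow h) R" unfolding mpow_def by (rule ideal_power_ideal[OF m_ideal])

lemma mI_ideal: "ideal (mI h) R" unfolding mI_def by (rule ideal_prod_is_ideal[OF mpow_ideal I_ideal])

lemma mpow_0: "mpow 0 = carrier R" by (simp only: mpow_def ideal_power_0)

lemma mpow_Suc: "mpow (Suc h) = ideal_prod R (mpow h) \<mm>" by (simp only: mpow_def ideal_power_Suc)

lemma mpow_1: "mpow (Suc 0) = \<mm>" unfolding mpow_def by (rule ideal_power_1[OF m_ideal])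

lemma mpow_decreasing: "mpow (Suc h) \<subseteq> mpow h" unfolding mpow_def by (rule ideal_power_decreasing[OF m_ideal])

lemma mI_0: "mI 0 = I" by (simp only: mI_def mpow_0 ideal_carrier_prod[OF I_ideal])

lemma mI_sub_I: "mI h \<subseteq> I"
  unfolding mI_def using ideal_prod_inter[OF mpow_ideal I_ideal] by blast

lemma mI_sub_mpow: "mI h \<subseteq> mpow (Suc h)"
  unfolding mI_def mpow_Suc by (rule ideal_prod_mono[OF order_refl I_sub_m])

lemma mI_Suc: "mI (Suc h) = ideal_prod R (mI h) \<mm>"
proof -
  have "mI (Suc h) = ideal_prod R (mpow h) (ideal_prod R \<mm> I)"
    unfolding mI_def mpow_Suc by (rule ideal_prod_assoc[OF mpow_ideal m_ideal I_ideal])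
  also have "ideal_prod R \<mm> I = ideal_prod R I \<mm>" by (rule ideal_prod_commute[OF m_ideal I_ideal])
  also have "ideal_prod R (mpow h) (ideal_prod R I \<mm>) = ideal_prod R (mI h) \<mm>"
    unfolding mI_def by (rule ideal_prod_assoc[OF mpow_ideal I_ideal m_ideal, symmetric])
  finally show ?thesis .
qed

lemma mI_decreasing: "mI (Suc h) \<subseteq> mI h"
  unfolding mI_Suc using ideal_prod_inter[OF mI_ideal m_ideal] by blast

lemma pair_setI: "r \<in> B \<Longrightarrow> i \<in> C \<Longrightarrow> \<Phi> r i \<in> pair_set B C"
  unfolding pair_set_def by blast

lemma pair_set_iff:
  assumes "B \<subseteq> carrier R" "C \<subseteq> I" "r \<in> carrier R" "i \<in> I"
  shows "\<Phi> r i \<in> pair_set B C \<longleftrightarrow> r \<in> B \<and> i \<in> C"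
proof
  assume "\<Phi> r i \<in> pair_set B C"
  then obtain s j where sj: "s \<in> B" "j \<in> C" "\<Phi> r i = \<Phi> s j" unfolding pair_set_def by blast
  then have "r = s \<and> i = j" using \<Phi>_inject[of r s i j] assms by blast
  then show "r \<in> B \<and> i \<in> C" using sj by simp
qed (simp add: pair_setI)

lemma \<Phi>_split:
  assumes "r \<in> carrier R" "i \<in> I"
  shows "\<Phi> r i = \<Phi> r \<zero> \<oplus>\<^bsub>S\<^esub> \<Phi> \<zero> i"
  using \<Phi>_add[of r \<zero> \<zero> i] assms zero_I I_carr by simp

lemma \<Phi>_mult_base:
  assumes "r \<in> carrier R" "s \<in> carrier R" "j \<in> I"
  shows "\<Phi> r \<zero> \<otimes>\<^bsub>S\<^esub> \<Phi> s j = \<Phi> (r \<otimes> s) (r \<otimes> j)"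
  using \<Phi>_mult[of r s \<zero> j] assms zero_I I_carr[OF assms(3)] a_carr b_carr by (simp add: a_minus_def)

text \<open>In the product \<open>(r + i t) (s + j t)\<close> the term \<open>i j t\<^sup>2\<close> contributes multiples of \<open>i j\<close> to both coordinates, and
  \<open>r j\<close> enters the second one; the two conditions relating \<open>B\<close> and \<open>C\<close> absorb these terms.\<close>

lemma pair_set_ideal:
  assumes B: "ideal B R" and C: "ideal C R" and CI: "C \<subseteq> I"
    and CB: "\<And>i j. i \<in> C \<Longrightarrow> j \<in> I \<Longrightarrow> i \<otimes> j \<in> B" and BC: "\<And>r j. r \<in> B \<Longrightarrow> j \<in> I \<Longrightarrow> r \<otimes> j \<in> C"
  shows "ideal (pair_set B C) S"
proof (rule S.idealI_comm)
  note Bc = ideal_closed[OF B] and Cc = ideal_closed[OF C]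
  show "pair_set B C \<subseteq> carrier S" unfolding pair_set_def S_carrier using Bc(1) CI by blast
  show "\<zero>\<^bsub>S\<^esub> \<in> pair_set B C" unfolding \<Phi>_zero by (rule pair_setI[OF Bc(2) Cc(2)])
next
  note Bc = ideal_closed[OF B] and Cc = ideal_closed[OF C]
  fix x y assume "x \<in> pair_set B C" "y \<in> pair_set B C"
  then obtain r i s j where *: "x = \<Phi> r i" "y = \<Phi> s j" "r \<in> B" "s \<in> B" "i \<in> C" "j \<in> C"
    unfolding pair_set_def by blast
  have "x \<oplus>\<^bsub>S\<^esub> y = \<Phi> (r \<oplus> s) (i \<oplus> j)"
    unfolding *(1,2) using * Bc(1) CI by (intro \<Phi>_add) auto
  then show "x \<oplus>\<^bsub>S\<^esub> y \<in> pair_set B C" using pair_setI[OF Bc(3) Cc(3)] * by simp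
next
  note Bc = ideal_closed[OF B] and Cc = ideal_closed[OF C]
  fix x y assume x: "x \<in> carrier S" and "y \<in> pair_set B C"
  then obtain r i s j where *: "x = \<Phi> s j" "y = \<Phi> r i" "s \<in> carrier R" "j \<in> I" "r \<in> B" "i \<in> C"
    unfolding pair_set_def S_carrier by blast
  have rc: "r \<in> carrier R" and iI: "i \<in> I" using * Bc(1) CI by auto
  note jc = I_carr[OF *(4)] and ic = I_carr[OF iI]
  have ij: "i \<otimes> j \<in> B" using CB[OF *(6,4)] .
  have ji: "j \<otimes> i \<in> B" using ij jc ic by (simp add: m_comm)
  have jiC: "j \<otimes> i \<in> C" by (rule Cc(4)[OF jc *(6)])
  have "s \<otimes> r \<ominus> b \<otimes> (j \<otimes> i) \<in> B"
    by (rule ideal_minus[OF B Bc(4)[OF *(3,5)] Bc(4)[OF b_carr ji]])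
  moreover have "j \<otimes> r \<in> C" using BC[OF *(5,4)] jc rc by (simp add: m_comm)
  then have "s \<otimes> i \<oplus> j \<otimes> r \<ominus> a \<otimes> (j \<otimes> i) \<in> C"
    using ideal_minus[OF C Cc(3)[OF Cc(4)[OF *(3,6)]] Cc(4)[OF a_carr jiC]] by simp
  ultimately have "\<Phi> (s \<otimes> r \<ominus> b \<otimes> (j \<otimes> i)) (s \<otimes> i \<oplus> j \<otimes> r \<ominus> a \<otimes> (j \<otimes> i)) \<in> pair_set B C"
    by (rule pair_setI)
  then show "x \<otimes>\<^bsub>S\<^esub> y \<in> pair_set B C" unfolding *(1,2) \<Phi>_mult[OF *(3) rc *(4) iI] .
qed

lemma nn_ideal: "ideal nn S"
  unfolding nn_def
  using I_sub_m ideal_closed(5)[OF m_ideal] ideal_closed(4)[OF I_ideal] m_carr I_carr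
  by (intro pair_set_ideal m_ideal I_ideal) auto

lemma one_notin_m: "\<one> \<notin> \<mm>"
  using maximalideal.I_notcarr[OF max] ideal.one_imp_carrier[OF m_ideal] by blast

lemma m_prime: "r \<in> carrier R \<Longrightarrow> s \<in> carrier R \<Longrightarrow> r \<otimes> s \<in> \<mm> \<Longrightarrow> r \<in> \<mm> \<or> s \<in> \<mm>"
  using primeideal.I_prime[OF maximalideal_prime[OF max]] .

lemma unit_outside_m:
  assumes "t \<in> carrier R" "t \<notin> \<mm>"
  shows "\<exists>u\<in>carrier R. u \<otimes> t = \<one>"
proof -
  have "PIdl t = carrier R"
    using proper_sub[OF cgenideal_ideal[OF assms(1)]] cgenideal_self[OF assms(1)] assms(2) by blast
  then have "\<one> \<in> PIdl t" by simp
  then show ?thesis unfolding cgenideal_def by auto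
qed

text \<open>An element \<open>r + i t\<close> with \<open>r \<notin> \<mm>\<close> is invertible: times its conjugate it is congruent to \<open>r\<^sup>2\<close> modulo \<open>\<mm>\<close>, hence a
  unit of \<open>R\<close>.\<close>

lemma nn_proper_sub:
  assumes J: "ideal J S" and not: "\<not> J \<subseteq> nn"
  shows "J = carrier S"
proof -
  note Jc = S.ideal_closed[OF J]
  obtain x where x: "x \<in> J" "x \<notin> nn" using not by blast
  then obtain r i where ri: "x = \<Phi> r i" "r \<in> carrier R" "i \<in> I" using Jc(1) unfolding S_carrier by blast
  have rm: "r \<notin> \<mm>" using x ri unfolding nn_def by (auto intro: pair_setI)
  note ic = I_carr[OF ri(3)]
  have im: "i \<in> \<mm>" using ri(3) I_sub_m by blast
  have niI: "\<ominus> i \<in> I" by (rule ideal_uminus[OF I_ideal ri(3)])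
  \<comment> \<open>The conjugate of \<open>r + i t\<close> under \<open>t \<mapsto> - a - t\<close> is \<open>(r - i a) - i t\<close>, and the product of the two is a scalar.\<close>
  let ?r = "r \<ominus> i \<otimes> a"
  have rc: "?r \<in> carrier R" using ri ic a_carr by simp
  define t where "t = r \<otimes> ?r \<ominus> b \<otimes> (i \<otimes> (\<ominus> i))"
  have tc: "t \<in> carrier R" unfolding t_def using ri ic rc b_carr by simp
  have z: "r \<otimes> (\<ominus> i) \<oplus> i \<otimes> ?r \<ominus> a \<otimes> (i \<otimes> (\<ominus> i)) = \<zero>"
  proof -
    have "i \<otimes> ?r = r \<otimes> i \<oplus> \<ominus> (a \<otimes> (i \<otimes> i))"
      using ri ic a_carr by (simp add: a_minus_def r_distr r_minus m_ac)
    moreover have "\<ominus> (a \<otimes> (i \<otimes> (\<ominus> i))) = a \<otimes> (i \<otimes> i)"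
      using ic a_carr by (simp add: r_minus)
    ultimately show ?thesis
      using ri ic a_carr by (simp add: a_minus_def r_minus a_assoc l_neg r_neg r_neg1 r_neg2)
  qed
  have "\<Phi> r i \<otimes>\<^bsub>S\<^esub> \<Phi> ?r (\<ominus> i) = \<Phi> t \<zero>"
    unfolding \<Phi>_mult[OF ri(2) rc ri(3) niI] z t_def ..
  then have tJ: "\<Phi> t \<zero> \<in> J" using Jc(5)[OF \<Phi>_S[OF rc niI] x(1)] ri(1) by simp
  have "t \<notin> \<mm>"
  proof
    assume t: "t \<in> \<mm>"
    have "i \<otimes> a \<in> \<mm>" "b \<otimes> (i \<otimes> (\<ominus> i)) \<in> \<mm>"
      using ideal_closed(5)[OF m_ideal a_carr im] ideal_closed(4)[OF m_ideal b_carr ideal_closed(5)[OF m_ideal _ im]] ic by auto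
    then have "t \<oplus> b \<otimes> (i \<otimes> (\<ominus> i)) \<oplus> r \<otimes> (i \<otimes> a) \<in> \<mm>"
      using ideal_closed(3)[OF m_ideal] ideal_closed(4)[OF m_ideal ri(2)] t by blast
    moreover have "t \<oplus> b \<otimes> (i \<otimes> (\<ominus> i)) \<oplus> r \<otimes> (i \<otimes> a) = r \<otimes> r"
    proof -
      have "t \<oplus> b \<otimes> (i \<otimes> (\<ominus> i)) = r \<otimes> ?r"
        unfolding t_def using ri ic rc b_carr by (simp add: a_minus_def a_assoc l_neg)
      then show ?thesis using ri ic a_carr by (simp add: a_minus_def r_distr r_minus a_assoc l_neg)
    qed
    ultimately have "r \<otimes> r \<in> \<mm>" by simp
    then show False using m_prime[OF ri(2,2)] rm by blast
  qed
  then obtain u where u: "u \<in> carrier R" "u \<otimes> t = \<one>" using unit_outside_m[OF tc] by blast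
  have "\<Phi> u \<zero> \<otimes>\<^bsub>S\<^esub> \<Phi> t \<zero> = \<one>\<^bsub>S\<^esub>"
    unfolding \<Phi>_mult_base[OF u(1) tc zero_I] \<Phi>_one using u by simp
  then have "\<one>\<^bsub>S\<^esub> \<in> J" using Jc(4)[OF \<Phi>_S[OF u(1) zero_I] tJ] by simp
  then show ?thesis by (rule ideal.one_imp_carrier[OF J])
qed

lemma one_notin_nn: "\<one>\<^bsub>S\<^esub> \<notin> nn"
proof
  assume "\<one>\<^bsub>S\<^esub> \<in> nn"
  then have "\<one> \<in> \<mm>"
    unfolding \<Phi>_one nn_def
    using pair_set_iff[OF ideal_closed(1)[OF m_ideal] order_refl one_closed zero_I] by simp
  then show False using one_notin_m by simp
qed

lemma nn_maximal: "maximalideal nn S"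
proof (rule maximalidealI[OF nn_ideal])
  show "carrier S \<noteq> nn" using one_notin_nn S.one_closed by blast
  fix J assume "ideal J S" "nn \<subseteq> J" "J \<subseteq> carrier S"
  then show "J = nn \<or> J = carrier S" using nn_proper_sub[of J] by blast
qed

lemma max_ideal_S: "max_ideal S = nn"
  unfolding max_ideal_def
proof (rule the_equality, rule nn_maximal)
  fix J assume J: "maximalideal J S"
  have Ji: "ideal J S" using J by (rule maximalideal.axioms(1))
  have "J \<noteq> carrier S" using maximalideal.I_notcarr[OF J] by blast
  then have "J \<subseteq> nn" using nn_proper_sub[OF Ji] by blast
  then have "nn = J \<or> nn = carrier S"
    using maximalideal.I_maximal[OF J nn_ideal] S.ideal_closed(1)[OF nn_ideal] by blast
  then show "J = nn" using one_notin_nn S.one_closed by blast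
qed

text \<open>In \<open>(\<mm>\<^sup>h + \<mm>\<^sup>h\<^sup>-\<^sup>1 I t) (\<mm> + I t)\<close> the terms \<open>r s\<close> and \<open>(r j + i s) t\<close> produce the two coordinates; the product \<open>i j t\<^sup>2\<close>
  is absorbed because \<open>I \<subseteq> \<mm>\<close>, so \<open>i j\<close> lies in \<open>\<mm>\<^sup>h I\<close> and in \<open>\<mm>\<^sup>h\<^sup>+\<^sup>1\<close>.\<close>

lemma nn_power: "ideal_power S nn (Suc h) = pair_set (mpow (Suc h)) (mI h)"
proof (induction h)
  case 0
  show ?case using S.ideal_power_1[OF nn_ideal] by (simp only: mpow_1 mI_0 nn_def)
next
  case (Suc h)
  let ?N = "ideal_prod S (pair_set (mpow (Suc h)) (mI h)) nn"
  have pc: "r \<in> carrier R" if "r \<in> mpow k" for r k using that ideal_closed(1)[OF mpow_ideal] by blast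
  have prodI: "x \<otimes>\<^bsub>S\<^esub> y \<in> ?N" if "x \<in> pair_set (mpow (Suc h)) (mI h)" "y \<in> nn" for x y
    using that by (rule ideal_prod.prod)
  have "?N = pair_set (mpow (Suc (Suc h))) (mI (Suc h))"
  proof
    note M = ideal_closed[OF mpow_ideal[of "Suc (Suc h)"]] and MI = ideal_closed[OF mI_ideal[of "Suc h"]]
    show "?N \<subseteq> pair_set (mpow (Suc (Suc h))) (mI (Suc h))"
    proof
      fix x assume "x \<in> ?N"
      then show "x \<in> pair_set (mpow (Suc (Suc h))) (mI (Suc h))"
      proof induction
        case (prod x y)
        then obtain r i s j where *: "x = \<Phi> r i" "y = \<Phi> s j" "r \<in> mpow (Suc h)" "i \<in> mI h" "s \<in> \<mm>" "j \<in> I"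
          unfolding nn_def pair_set_def by blast
        have iI: "i \<in> I" and iM: "i \<in> mpow (Suc h)" and jm: "j \<in> \<mm>" using * mI_sub_I mI_sub_mpow I_sub_m by auto
        have rs: "r \<otimes> s \<in> mpow (Suc (Suc h))"
          unfolding mpow_Suc[of "Suc h"] by (rule ideal_prod.prod[OF *(3,5)])
        have ij: "i \<otimes> j \<in> mpow (Suc (Suc h))"
          unfolding mpow_Suc[of "Suc h"] by (rule ideal_prod.prod[OF iM jm])
        have rj: "r \<otimes> j \<in> mI (Suc h)" unfolding mI_def by (rule ideal_prod.prod[OF *(3,6)])
        have ijI: "i \<otimes> j \<in> mI (Suc h)" unfolding mI_def by (rule ideal_prod.prod[OF iM *(6)])
        have isI: "i \<otimes> s \<in> mI (Suc h)" unfolding mI_Suc by (rule ideal_prod.prod[OF *(4,5)])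
        have "r \<otimes> s \<ominus> b \<otimes> (i \<otimes> j) \<in> mpow (Suc (Suc h))"
          by (rule ideal_minus[OF mpow_ideal rs M(4)[OF b_carr ij]])
        moreover have "r \<otimes> j \<oplus> i \<otimes> s \<ominus> a \<otimes> (i \<otimes> j) \<in> mI (Suc h)"
          by (rule ideal_minus[OF mI_ideal MI(3)[OF rj isI] MI(4)[OF a_carr ijI]])
        ultimately show ?case
          unfolding *(1,2) \<Phi>_mult[OF pc[OF *(3)] m_carr[OF *(5)] iI *(6)] by (rule pair_setI)
      next
        case (sum x y)
        then obtain r i s j where *: "x = \<Phi> r i" "y = \<Phi> s j" "r \<in> mpow (Suc (Suc h))" "i \<in> mI (Suc h)"
          "s \<in> mpow (Suc (Suc h))" "j \<in> mI (Suc h)" unfolding pair_set_def by blast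
        have iI: "i \<in> I" and jI: "j \<in> I" using *(4,6) mI_sub_I by blast+
        show ?case unfolding *(1,2) \<Phi>_add[OF pc[OF *(3)] pc[OF *(5)] iI jI]
          by (rule pair_setI[OF M(3)[OF *(3,5)] MI(3)[OF *(4,6)]])
      qed
    qed
    have one: "\<Phi> r \<zero> \<in> ?N" if "r \<in> ideal_prod R (mpow (Suc h)) \<mm>" for r
      using that
    proof induction
      case (prod x y)
      have "\<Phi> x \<zero> \<in> pair_set (mpow (Suc h)) (mI h)"
        by (rule pair_setI[OF prod(1) ideal_closed(2)[OF mI_ideal]])
      moreover have "\<Phi> y \<zero> \<in> nn" unfolding nn_def by (rule pair_setI[OF prod(2) zero_I])
      ultimately have "\<Phi> x \<zero> \<otimes>\<^bsub>S\<^esub> \<Phi> y \<zero> \<in> ?N" by (rule prodI)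
      then show ?case using \<Phi>_mult_base[OF pc[OF prod(1)] m_carr[OF prod(2)] zero_I] pc[OF prod(1)] by simp
    next
      case (sum x y)
      have c: "x \<in> carrier R" "y \<in> carrier R" using sum(1,2) pc[of _ "Suc (Suc h)"] unfolding mpow_Suc[of "Suc h"] by blast+
      show ?case using ideal_prod.sum[OF sum(3,4)] \<Phi>_add[OF c zero_I zero_I] by simp
    qed
    have two: "\<Phi> \<zero> i \<in> ?N" if "i \<in> ideal_prod R (mpow (Suc h)) I" for i
      using that
    proof induction
      case (prod x j)
      have "\<Phi> x \<zero> \<in> pair_set (mpow (Suc h)) (mI h)"
        by (rule pair_setI[OF prod(1) ideal_closed(2)[OF mI_ideal]])
      moreover have "\<Phi> \<zero> j \<in> nn"
        unfolding nn_def by (rule pair_setI[OF ideal_closed(2)[OF m_ideal] prod(2)])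
      ultimately have "\<Phi> x \<zero> \<otimes>\<^bsub>S\<^esub> \<Phi> \<zero> j \<in> ?N" by (rule prodI)
      then show ?case using \<Phi>_mult_base[OF pc[OF prod(1)] zero_closed prod(2)] pc[OF prod(1)] by simp
    next
      case (sum x y)
      have c: "x \<in> I" "y \<in> I" using sum(1,2) mI_sub_I[of "Suc h"] unfolding mI_def by blast+
      show ?case using ideal_prod.sum[OF sum(3,4)] \<Phi>_add[OF zero_closed zero_closed c] by simp
    qed
    show "pair_set (mpow (Suc (Suc h))) (mI (Suc h)) \<subseteq> ?N"
    proof
      fix x assume "x \<in> pair_set (mpow (Suc (Suc h))) (mI (Suc h))"
      then obtain r i where ri: "x = \<Phi> r i" "r \<in> mpow (Suc (Suc h))" "i \<in> mI (Suc h)" unfolding pair_set_def by blast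
      have iI: "i \<in> I" using ri(3) mI_sub_I by blast
      have "\<Phi> r \<zero> \<in> ?N" by (rule one) (use ri(2) in \<open>simp only: mpow_Suc[of "Suc h"]\<close>)
      moreover have "\<Phi> \<zero> i \<in> ?N" by (rule two) (use ri(3) in \<open>simp only: mI_def\<close>)
      ultimately show "x \<in> ?N" unfolding ri(1) \<Phi>_split[OF pc[OF ri(2)] iI] by (rule ideal_prod.sum)
    qed
  qed
  then show ?case by (simp only: ideal_power_Suc[of S nn "Suc h"] Suc.IH)
qed

abbreviation "lenR \<equiv> rel_length R (ring_module R)"
abbreviation "lenS \<equiv> rel_length S (ring_module S)"

text \<open>The inclusion of \<open>I\<close> as the second coordinate is not linear over \<open>R(I)\<^sub>a\<^sub>,\<^sub>b\<close>, but \<open>r + j t\<close> acts on it like \<open>r\<close>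
  up to multiples of \<open>j i\<close>, which the hypothesis on \<open>B\<close> and \<open>C\<close> places in the smaller ideal. So the
  lengths over the two rings agree.\<close>

lemma len_snd:
  assumes B: "ideal B R" and C: "ideal C R" and C': "ideal C' R" and CC': "C \<subseteq> C'" and C'I: "C' \<subseteq> I"
    and id1: "ideal (pair_set B C) S" and id2: "ideal (pair_set B C') S"
    and mult: "\<And>i j. i \<in> C' \<Longrightarrow> j \<in> I \<Longrightarrow> j \<otimes> i \<in> B \<and> j \<otimes> i \<in> C"
  shows "lenS (pair_set B C) (pair_set B C') = lenR C C'"
proof -
  note Bc = ideal_closed[OF B] and Cc = ideal_closed[OF C] and C'c = ideal_closed[OF C']
  have CI: "C \<subseteq> I" using CC' C'I by blast
  have sub: "pair_set B C \<subseteq> pair_set B C'" using CC' unfolding pair_set_def by blast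
  note subs = submodule_ring_module_iff[THEN iffD2, OF C] submodule_ring_module_iff[THEN iffD2, OF C']
    S.submodule_ring_module_iff[THEN iffD2, OF id1] S.submodule_ring_module_iff[THEN iffD2, OF id2]
  have img: "\<Phi> \<zero> i \<in> pair_set B C'" if "i \<in> C'" for i by (rule pair_setI[OF Bc(2) that])
  have add: "\<Phi> \<zero> (i \<oplus>\<^bsub>ring_module R\<^esub> j) = \<Phi> \<zero> i \<oplus>\<^bsub>ring_module S\<^esub> \<Phi> \<zero> j" if "i \<in> C'" "j \<in> C'" for i j
    using \<Phi>_add[OF zero_closed zero_closed, of i j] that C'I by auto
  have ker: "\<Phi> \<zero> i \<in> pair_set B C \<longleftrightarrow> i \<in> C" if "i \<in> C'" for i
    using pair_set_iff[OF Bc(1) CI zero_closed] that C'I Bc(2) by blast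
  have zN: "\<zero>\<^bsub>S\<^esub> \<in> pair_set B C" by (rule S.ideal_closed(2)[OF id1])
  have base: "\<Phi> \<zero> (r \<otimes> i) = \<Phi> r \<zero> \<otimes>\<^bsub>S\<^esub> \<Phi> \<zero> i" if "r \<in> carrier R" "i \<in> C'" for r i
    using \<Phi>_mult_base[OF that(1) zero_closed, of i] that C'I by auto
  show ?thesis
  proof (rule antisym)
    show "lenR C C' \<le> lenS (pair_set B C) (pair_set B C')"
    proof (rule rel_length_transfer_le[where g="\<Phi> \<zero>", OF subs(1,2) CC' subs(3,4) img add ker sub])
      fix s assume "s \<in> carrier S"
      then obtain r j where rj: "r \<in> carrier R" "j \<in> I" "s = \<Phi> r j" unfolding S_carrier by blast
      show "\<exists>r\<in>carrier R. \<forall>x\<in>C'. \<exists>d\<in>pair_set B C. s \<odot>\<^bsub>ring_module S\<^esub> \<Phi> \<zero> x = \<Phi> \<zero> (r \<odot>\<^bsub>ring_module R\<^esub> x) \<oplus>\<^bsub>ring_module S\<^esub> d"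
      proof (intro bexI[OF _ rj(1)] ballI)
        fix i assume i: "i \<in> C'"
        have iI: "i \<in> I" using i C'I by blast
        note ic = I_carr[OF iI] and jc = I_carr[OF rj(2)]
        note ji = mult[OF i rj(2)]
        let ?d = "\<Phi> (\<ominus> (b \<otimes> (j \<otimes> i))) (\<ominus> (a \<otimes> (j \<otimes> i)))"
        have dB: "\<ominus> (b \<otimes> (j \<otimes> i)) \<in> B" using ideal_uminus[OF B Bc(4)[OF b_carr]] ji by blast
        have dC: "\<ominus> (a \<otimes> (j \<otimes> i)) \<in> C" using ideal_uminus[OF C Cc(4)[OF a_carr]] ji by blast
        have dc: "\<ominus> (b \<otimes> (j \<otimes> i)) \<in> carrier R" "\<ominus> (a \<otimes> (j \<otimes> i)) \<in> I" using dB dC Bc(1) CI by auto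
        have riI: "r \<otimes> i \<in> I" by (rule ideal_closed(4)[OF I_ideal rj(1) iI])
        have "s \<otimes>\<^bsub>S\<^esub> \<Phi> \<zero> i = \<Phi> (r \<otimes> \<zero> \<ominus> b \<otimes> (j \<otimes> i)) (r \<otimes> i \<oplus> j \<otimes> \<zero> \<ominus> a \<otimes> (j \<otimes> i))"
          unfolding rj(3) by (rule \<Phi>_mult[OF rj(1) zero_closed rj(2) iI])
        also have "\<dots> = \<Phi> (\<zero> \<oplus> \<ominus> (b \<otimes> (j \<otimes> i))) (r \<otimes> i \<oplus> \<ominus> (a \<otimes> (j \<otimes> i)))"
          using rj(1) ic jc by (simp add: a_minus_def)
        also have "\<dots> = \<Phi> \<zero> (r \<otimes> i) \<oplus>\<^bsub>S\<^esub> ?d" by (rule \<Phi>_add[OF zero_closed dc(1) riI dc(2), symmetric])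
        finally have "s \<odot>\<^bsub>ring_module S\<^esub> \<Phi> \<zero> i = \<Phi> \<zero> (r \<odot>\<^bsub>ring_module R\<^esub> i) \<oplus>\<^bsub>ring_module S\<^esub> ?d" by simp
        moreover have "?d \<in> pair_set B C" by (rule pair_setI[OF dB dC])
        ultimately show "\<exists>d\<in>pair_set B C. s \<odot>\<^bsub>ring_module S\<^esub> \<Phi> \<zero> i = \<Phi> \<zero> (r \<odot>\<^bsub>ring_module R\<^esub> i) \<oplus>\<^bsub>ring_module S\<^esub> d" by blast
      qed
    qed
    show "lenS (pair_set B C) (pair_set B C') \<le> lenR C C'"
    proof (rule rel_length_transfer_ge[where g="\<Phi> \<zero>", OF subs(1,2) subs(3,4) sub img add ker CC'])
      fix y assume "y \<in> pair_set B C'"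
      then obtain r i where ri: "y = \<Phi> r i" "r \<in> B" "i \<in> C'" unfolding pair_set_def by blast
      have iI: "i \<in> I" and rc: "r \<in> carrier R" using ri C'I Bc(1) by auto
      have d: "\<Phi> r \<zero> \<in> pair_set B C" by (rule pair_setI[OF ri(2) Cc(2)])
      have "y = \<Phi> \<zero> i \<oplus>\<^bsub>S\<^esub> \<Phi> r \<zero>"
        using \<Phi>_add[OF zero_closed rc iI zero_I] I_carr[OF iI] rc ri(1) by simp
      then show "\<exists>x\<in>C'. \<exists>d\<in>pair_set B C. y = \<Phi> \<zero> x \<oplus>\<^bsub>ring_module S\<^esub> d" using ri(3) d by auto
    next
      fix r assume r: "r \<in> carrier R"
      have "\<Phi> \<zero> (r \<odot>\<^bsub>ring_module R\<^esub> x) = \<Phi> r \<zero> \<odot>\<^bsub>ring_module S\<^esub> \<Phi> \<zero> x \<oplus>\<^bsub>ring_module S\<^esub> \<zero>\<^bsub>S\<^esub>" if "x \<in> C'" for x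
        using base[OF r that] \<Phi>_S[OF r zero_I] \<Phi>_S[OF zero_closed, of x] that C'I by auto
      then show "\<exists>s\<in>carrier S. \<forall>x\<in>C'. \<exists>d\<in>pair_set B C. \<Phi> \<zero> (r \<odot>\<^bsub>ring_module R\<^esub> x) = s \<odot>\<^bsub>ring_module S\<^esub> \<Phi> \<zero> x \<oplus>\<^bsub>ring_module S\<^esub> d"
        using \<Phi>_S[OF r zero_I] zN by blast
    qed
  qed
qed

text \<open>The same comparison for the first coordinate, where \<open>j t\<close> moves \<open>r\<close> into the second coordinate.\<close>

lemma len_fst:
  assumes B: "ideal B R" and B': "ideal B' R" and BB': "B \<subseteq> B'" and C: "ideal C R" and CI: "C \<subseteq> I"
    and id1: "ideal (pair_set B C) S" and id2: "ideal (pair_set B' C) S"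
    and mult: "\<And>r j. r \<in> B' \<Longrightarrow> j \<in> I \<Longrightarrow> j \<otimes> r \<in> C"
  shows "lenS (pair_set B C) (pair_set B' C) = lenR B B'"
proof -
  note Bc = ideal_closed[OF B] and Cc = ideal_closed[OF C] and B'c = ideal_closed[OF B']
  have sub: "pair_set B C \<subseteq> pair_set B' C" using BB' unfolding pair_set_def by blast
  note subs = submodule_ring_module_iff[THEN iffD2, OF B] submodule_ring_module_iff[THEN iffD2, OF B']
    S.submodule_ring_module_iff[THEN iffD2, OF id1] S.submodule_ring_module_iff[THEN iffD2, OF id2]
  have B'_carr: "r \<in> carrier R" if "r \<in> B'" for r using that B'c(1) by blast
  let ?g = "\<lambda>r. \<Phi> r \<zero>"
  have img: "?g r \<in> pair_set B' C" if "r \<in> B'" for r by (rule pair_setI[OF that Cc(2)])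
  have add: "?g (r \<oplus>\<^bsub>ring_module R\<^esub> s) = ?g r \<oplus>\<^bsub>ring_module S\<^esub> ?g s" if "r \<in> B'" "s \<in> B'" for r s
    using \<Phi>_add[OF B'_carr[OF that(1)] B'_carr[OF that(2)] zero_I zero_I] by simp
  have ker: "?g r \<in> pair_set B C \<longleftrightarrow> r \<in> B" if "r \<in> B'" for r
    using pair_set_iff[OF Bc(1) CI B'_carr[OF that] zero_I] Cc(2) by blast
  have zN: "\<zero>\<^bsub>S\<^esub> \<in> pair_set B C" by (rule S.ideal_closed(2)[OF id1])
  show ?thesis
  proof (rule antisym)
    show "lenR B B' \<le> lenS (pair_set B C) (pair_set B' C)"
    proof (rule rel_length_transfer_le[where g="?g", OF subs(1,2) BB' subs(3,4) img add ker sub])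
      fix s assume "s \<in> carrier S"
      then obtain t j where rj: "t \<in> carrier R" "j \<in> I" "s = \<Phi> t j" unfolding S_carrier by blast
      show "\<exists>r\<in>carrier R. \<forall>x\<in>B'. \<exists>d\<in>pair_set B C. s \<odot>\<^bsub>ring_module S\<^esub> \<Phi> x \<zero> = \<Phi> (r \<odot>\<^bsub>ring_module R\<^esub> x) \<zero> \<oplus>\<^bsub>ring_module S\<^esub> d"
      proof (intro bexI[OF _ rj(1)] ballI)
        fix r assume r: "r \<in> B'"
        note rc = B'_carr[OF r] and jc = I_carr[OF rj(2)]
        have jr: "j \<otimes> r \<in> C" by (rule mult[OF r rj(2)])
        then have jrI: "j \<otimes> r \<in> I" using CI by blast
        have "s \<otimes>\<^bsub>S\<^esub> \<Phi> r \<zero> = \<Phi> (t \<otimes> r \<ominus> b \<otimes> (j \<otimes> \<zero>)) (t \<otimes> \<zero> \<oplus> j \<otimes> r \<ominus> a \<otimes> (j \<otimes> \<zero>))"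
          unfolding rj(3) by (rule \<Phi>_mult[OF rj(1) rc rj(2) zero_I])
        also have "\<dots> = \<Phi> (t \<otimes> r \<oplus> \<zero>) (\<zero> \<oplus> j \<otimes> r)"
          using rj(1) rc jc a_carr b_carr by (simp add: a_minus_def)
        also have "\<dots> = \<Phi> (t \<otimes> r) \<zero> \<oplus>\<^bsub>S\<^esub> \<Phi> \<zero> (j \<otimes> r)"
          by (rule \<Phi>_add[symmetric]) (use rj(1) rc zero_I jrI in auto)
        finally have "s \<odot>\<^bsub>ring_module S\<^esub> \<Phi> r \<zero> = \<Phi> (t \<odot>\<^bsub>ring_module R\<^esub> r) \<zero> \<oplus>\<^bsub>ring_module S\<^esub> \<Phi> \<zero> (j \<otimes> r)" by simp
        moreover have "\<Phi> \<zero> (j \<otimes> r) \<in> pair_set B C" by (rule pair_setI[OF Bc(2) jr])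
        ultimately show "\<exists>d\<in>pair_set B C. s \<odot>\<^bsub>ring_module S\<^esub> \<Phi> r \<zero> = \<Phi> (t \<odot>\<^bsub>ring_module R\<^esub> r) \<zero> \<oplus>\<^bsub>ring_module S\<^esub> d" by blast
      qed
    qed
    show "lenS (pair_set B C) (pair_set B' C) \<le> lenR B B'"
    proof (rule rel_length_transfer_ge[where g="?g", OF subs(1,2) subs(3,4) sub img add ker BB'])
      fix y assume "y \<in> pair_set B' C"
      then obtain r i where ri: "y = \<Phi> r i" "r \<in> B'" "i \<in> C" unfolding pair_set_def by blast
      have iI: "i \<in> I" using ri CI by auto
      have "\<Phi> \<zero> i \<in> pair_set B C" by (rule pair_setI[OF Bc(2) ri(3)])
      moreover have "y = \<Phi> r \<zero> \<oplus>\<^bsub>ring_module S\<^esub> \<Phi> \<zero> i" using \<Phi>_split[OF B'_carr[OF ri(2)] iI] ri(1) by simp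
      ultimately show "\<exists>x\<in>B'. \<exists>d\<in>pair_set B C. y = \<Phi> x \<zero> \<oplus>\<^bsub>ring_module S\<^esub> d" using ri(2) by blast
    next
      fix r assume r: "r \<in> carrier R"
      have "\<Phi> (r \<odot>\<^bsub>ring_module R\<^esub> x) \<zero> = \<Phi> r \<zero> \<odot>\<^bsub>ring_module S\<^esub> \<Phi> x \<zero> \<oplus>\<^bsub>ring_module S\<^esub> \<zero>\<^bsub>S\<^esub>" if "x \<in> B'" for x
        using \<Phi>_mult_base[OF r B'_carr[OF that] zero_I] \<Phi>_S[OF m_closed[OF r B'_carr[OF that]] zero_I] r by simp
      then show "\<exists>s\<in>carrier S. \<forall>x\<in>B'. \<exists>d\<in>pair_set B C. \<Phi> (r \<odot>\<^bsub>ring_module R\<^esub> x) \<zero> = s \<odot>\<^bsub>ring_module S\<^esub> \<Phi> x \<zero> \<oplus>\<^bsub>ring_module S\<^esub> d"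
        using \<Phi>_S[OF r zero_I] zN by blast
    qed
  qed
qed

text \<open>The intermediate ideal has first coordinate in \<open>\<mm>\<^sup>h\<^sup>+\<^sup>2\<close> and second coordinate in \<open>\<mm>\<^sup>h I\<close>, so that only one
  coordinate changes at a time.\<close>

theorem len_nn_power:
  "lenS (ideal_power S nn (Suc (Suc h))) (ideal_power S nn (Suc h))
    = lenR (mpow (Suc (Suc h))) (mpow (Suc h)) + lenR (mI (Suc h)) (mI h)"
proof -
  let ?N = "pair_set (mpow (Suc (Suc h))) (mI (Suc h))" and ?X = "pair_set (mpow (Suc (Suc h))) (mI h)"
    and ?V = "pair_set (mpow (Suc h)) (mI h)"
  have N: "ideal ?N S" unfolding nn_power[symmetric] by (rule S.ideal_power_ideal[OF nn_ideal])
  have V: "ideal ?V S" unfolding nn_power[symmetric] by (rule S.ideal_power_ideal[OF nn_ideal])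
  have c: "i \<in> carrier R" if "i \<in> mpow k" for i k using that ideal_closed(1)[OF mpow_ideal] by blast
  have ij: "i \<otimes> j \<in> mpow (Suc (Suc h))" "i \<otimes> j \<in> mI (Suc h)" if "i \<in> mI h" "j \<in> I" for i j
  proof -
    have i: "i \<in> mpow (Suc h)" using that mI_sub_mpow by blast
    show "i \<otimes> j \<in> mI (Suc h)" unfolding mI_def by (rule ideal_prod.prod[OF i that(2)])
    then show "i \<otimes> j \<in> mpow (Suc (Suc h))" using mI_sub_mpow by blast
  qed
  have rj: "r \<otimes> j \<in> mI h" if "r \<in> mpow (Suc h)" "j \<in> I" for r j
  proof -
    have "r \<in> mpow h" using that mpow_decreasing by blast
    then show ?thesis unfolding mI_def using that(2) by (rule ideal_prod.prod)
  qed
  have X: "ideal ?X S"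
    by (rule pair_set_ideal[OF mpow_ideal mI_ideal mI_sub_I ij(1) rj])
      (use mpow_decreasing in auto)
  have "lenS ?N ?V = lenS ?N ?X + lenS ?X ?V"
  proof (rule rel_length_additive)
    show "submodule S ?N (ring_module S)" "submodule S ?X (ring_module S)" "submodule S ?V (ring_module S)"
      using N X V S.submodule_ring_module_iff by blast+
    show "?N \<subseteq> ?X" using mI_decreasing unfolding pair_set_def by blast
    show "?X \<subseteq> ?V" using mpow_decreasing unfolding pair_set_def by blast
  qed
  moreover have "lenS ?N ?X = lenR (mI (Suc h)) (mI h)"
  proof (rule len_snd[OF mpow_ideal mI_ideal mI_ideal mI_decreasing mI_sub_I N X])
    fix i j assume i: "i \<in> mI h" and j: "j \<in> I"
    have "j \<otimes> i = i \<otimes> j" using I_carr[OF j] I_carr[of i] i mI_sub_I m_comm by blast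
    then show "j \<otimes> i \<in> mpow (Suc (Suc h)) \<and> j \<otimes> i \<in> mI (Suc h)" using ij[OF i j] by simp
  qed
  moreover have "lenS ?X ?V = lenR (mpow (Suc (Suc h))) (mpow (Suc h))"
  proof (rule len_fst[OF mpow_ideal mpow_ideal mpow_decreasing mI_ideal mI_sub_I X V])
    fix r j assume r: "r \<in> mpow (Suc h)" and j: "j \<in> I"
    have "j \<otimes> r = r \<otimes> j" using I_carr[OF j] c[OF r] m_comm by blast
    then show "j \<otimes> r \<in> mI h" using rj[OF r j] by simp
  qed
  ultimately show ?thesis unfolding nn_power by (simp add: add.commute)
qed

end

section \<open>The Hilbert function\<close>

lemma (in cring) residue_dim_ideals:
  assumes m: "maximalideal \<mm> R" "max_ideal R = \<mm>" and J: "ideal J R" and l: "rel_length R (ring_module R) (ideal_prod R J \<mm>) J = enat n"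
  shows "residue_dim R (quot_module ((ring_module R)\<lparr>carrier := J\<rparr>) (ideal_prod R J \<mm>)) = n"
proof (rule residue_dim_eq_rel_length[OF m _ _ _ _ l])
  have mi: "ideal \<mm> R" using m(1) by (rule maximalideal.axioms(1))
  show "submodule R (ideal_prod R J \<mm>) (ring_module R)" "submodule R J (ring_module R)"
    using submodule_ring_module_iff J ideal_prod_is_ideal[OF J mi] by simp_all
  show "ideal_prod R J \<mm> \<subseteq> J" using ideal_prod_inter[OF J mi] by blast
  fix x v assume xv: "x \<in> \<mm>" "v \<in> J"
  have "x \<otimes> v = v \<otimes> x" using xv ideal_closed(1)[OF J] ideal_closed(1)[OF mi] m_comm by blast
  then show "x \<odot>\<^bsub>ring_module R\<^esub> v \<in> ideal_prod R J \<mm>" using ideal_prod.prod[OF xv(2,1)] by simp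
qed

lemma (in cring) hilbert_function_eq_rel_length:
  assumes m: "maximalideal \<mm> R" "max_ideal R = \<mm>"
    and l: "rel_length R (ring_module R) (ideal_power R \<mm> (Suc h)) (ideal_power R \<mm> h) = enat n"
  shows "hilbert_function R h = n"
proof -
  have "ideal (ideal_power R \<mm> h) R" by (rule ideal_power_ideal[OF maximalideal.axioms(1)[OF m(1)]])
  then show ?thesis
    using residue_dim_ideals[OF m] l unfolding hilbert_function_def m(2) ideal_power_Suc by blast
qed

context one_dim_local begin

lemma prod_scale:
  assumes c: "c \<in> carrier R" and J: "ideal J R" and K: "ideal K R"
  shows "ideal_prod R J (scale c K) = scale c (ideal_prod R J K)"
proof
  have Jc: "x \<in> carrier R" if "x \<in> J" for x using that ideal_closed(1)[OF J] by blast
  have Kc: "x \<in> carrier R" if "x \<in> K" for x using that ideal_closed(1)[OF K] by blast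
  have JK: "ideal (ideal_prod R J K) R" by (rule ideal_prod_is_ideal[OF J K])
  have comm: "x \<otimes> (c \<otimes> k) = c \<otimes> (x \<otimes> k)" if "x \<in> J" "k \<in> K" for x k
    using Jc[OF that(1)] Kc[OF that(2)] c by (simp add: m_lcomm)
  show "ideal_prod R J (scale c K) \<subseteq> scale c (ideal_prod R J K)"
  proof
    fix x assume "x \<in> ideal_prod R J (scale c K)"
    then show "x \<in> scale c (ideal_prod R J K)"
    proof induction
      case (prod x y)
      then obtain k where k: "k \<in> K" "y = c \<otimes> k" by (auto simp: scale_def)
      then show ?case using comm[OF prod(1) k(1)] ideal_prod.prod[OF prod(1) k(1), of R] by (simp add: scale_def)
    next
      case (sum x y)
      then show ?case using ideal_closed(3)[OF scale_ideal[OF c JK]] by blast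
    qed
  qed
  have "c \<otimes> z \<in> ideal_prod R J (scale c K)" if "z \<in> ideal_prod R J K" for z
    using that
  proof induction
    case (prod x k)
    have "x \<otimes> (c \<otimes> k) \<in> ideal_prod R J (scale c K)"
      by (rule ideal_prod.prod[OF prod(1)]) (use prod(2) in \<open>simp add: scale_def\<close>)
    then show ?case using comm[OF prod] by simp
  next
    case (sum x y)
    have "x \<in> carrier R" "y \<in> carrier R" using sum(1,2) ideal_closed(1)[OF JK] by auto
    then show ?case using ideal_prod.sum[OF sum(3,4)] c by (simp add: r_distr)
  qed
  then show "scale c (ideal_prod R J K) \<subseteq> ideal_prod R J (scale c K)" by (auto simp: scale_def)
qed

end

context almost_gorenstein_ideal begin

lemma m_prod_I: "ideal_prod R \<mm> I = scale c \<mm>"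
proof
  show "ideal_prod R \<mm> I \<subseteq> scale c \<mm>"
  proof
    fix x assume "x \<in> ideal_prod R \<mm> I"
    then show "x \<in> scale c \<mm>"
    proof induction
      case (prod r i)
      then show ?case using m_I[OF prod] by (auto simp: scale_def)
    next
      case (sum x y)
      then show ?case using ideal_closed(3)[OF scale_ideal[OF c_carr m_ideal]] by blast
    qed
  qed
  have "c \<otimes> s \<in> ideal_prod R \<mm> I" if s: "s \<in> \<mm>" for s
    using ideal_prod.prod[OF s c_I, of R] m_comm[OF c_carr m_carr[OF s]] by simp
  then show "scale c \<mm> \<subseteq> ideal_prod R \<mm> I" by (auto simp: scale_def)
qed

lemma m_power_prod_I: "ideal_prod R (ideal_power R \<mm> (Suc h)) I = scale c (ideal_power R \<mm> (Suc h))"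
proof -
  note ph = ideal_power_ideal[OF m_ideal, of h]
  have "ideal_prod R (ideal_power R \<mm> (Suc h)) I = ideal_prod R (ideal_power R \<mm> h) (ideal_prod R \<mm> I)"
    unfolding ideal_power_Suc by (rule ideal_prod_assoc[OF ph m_ideal I_ideal])
  also have "\<dots> = scale c (ideal_power R \<mm> (Suc h))"
    unfolding m_prod_I ideal_power_Suc by (rule prod_scale[OF c_carr ph m_ideal])
  finally show ?thesis .
qed

text \<open>A power of \<open>c\<close> is a regular element of \<open>\<mm>\<^sup>h\<^sup>+\<^sup>1\<close>.\<close>

lemma len_power_finite: "\<exists>n. len (ideal_power R \<mm> (Suc h)) (ideal_power R \<mm> h) = enat n"
proof (rule len_finite)
  show "c [^] Suc h \<in> regular_elements R" by (rule regular_elements_pow[OF c_regular])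
  have cm: "c \<in> \<mm>" using c_I I_sub_m by blast
  have "c [^] n \<in> ideal_power R \<mm> n" for n :: nat
  proof (induction n)
    case 0
    show ?case by (simp add: ideal_power_0)
  next
    case (Suc n)
    show ?case unfolding ideal_power_Suc nat_pow_Suc by (rule ideal_prod.prod[OF Suc cm])
  qed
  then show "c [^] Suc h \<in> ideal_power R \<mm> (Suc h)" .
  show "ideal (ideal_power R \<mm> (Suc h)) R" "ideal (ideal_power R \<mm> h) R"
    by (rule ideal_power_ideal[OF m_ideal])+
  show "ideal_power R \<mm> (Suc h) \<subseteq> ideal_power R \<mm> h" by (rule ideal_power_decreasing[OF m_ideal])
qed

lemma len_power_eq: "len (ideal_power R \<mm> (Suc h)) (ideal_power R \<mm> h) = enat (hilbert_function R h)"
proof -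
  obtain n where n: "len (ideal_power R \<mm> (Suc h)) (ideal_power R \<mm> h) = enat n"
    using len_power_finite by blast
  then show ?thesis using hilbert_function_eq_rel_length[OF max max_ideal_eq n] by simp
qed

lemma embedding_dim_eq: "embedding_dim R = hilbert_function R 1"
  using ideal_power_1[OF m_ideal] ideal_power_Suc[of R \<mm> "Suc 0"]
  by (simp add: embedding_dim_def hilbert_function_def max_ideal_eq)

text \<open>By theorem \<open>bass_number_1\<close> for the regular element \<open>c\<close>, the Bass number is the length of
  \<open>(c R : \<mm>) / c R\<close>.\<close>

lemma len_generators: "len (scale c \<mm>) I = enat (bass_number R 1 RM)"
proof -
  let ?C = "scale c (carrier R)"
  have X: "multiples RM c = ?C" and Y: "socle_mod RM \<mm> c = {w \<in> carrier R. \<forall>r\<in>\<mm>. r \<otimes> w \<in> ?C}"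
    by (simp_all add: socle_mod_def multiples_def scale_def)
  note mc = ideal_closed(1)[OF m_ideal]
  have XY: "multiples RM c \<subseteq> socle_mod RM \<mm> c" by (rule RM.multiples_subset_socle_mod[OF c_carr mc])
  have X_ideal: "ideal (multiples RM c) R" "ideal (socle_mod RM \<mm> c) R"
    using RM.multiples_submodule[OF c_carr] RM.socle_mod_submodule[OF c_carr mc] submodule_iff by simp_all
  have "c \<otimes> \<one> \<in> multiples RM c" unfolding X scale_def by blast
  then have "c \<in> multiples RM c" using c_carr by simp
  then obtain n where n: "len (multiples RM c) (socle_mod RM \<mm> c) = enat n"
    using len_finite[OF c_regular X_ideal(1) _ X_ideal(2) XY] by blast
  have "bass_number R 1 RM = n"
  proof (rule bass_number_1[OF noeth max max_ideal_eq ring_module_module _ _ n])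
    show "c \<in> \<mm>" using c_I I_sub_m by blast
    show "x = \<zero>\<^bsub>RM\<^esub>" if "x \<in> carrier RM" "c \<odot>\<^bsub>RM\<^esub> x = \<zero>\<^bsub>RM\<^esub>" for x
      using that c_regular by (simp add: regular_elements_def)
  qed
  then show ?thesis using n type_eq_generators unfolding X Y by simp
qed

theorem hilbert_function_rees_quotient:
  assumes "a \<in> carrier R" "b \<in> carrier R"
  shows "hilbert_function (rees_quotient R I a b) 0 = 1 \<and>
    hilbert_function (rees_quotient R I a b) 1 = embedding_dim R + bass_number R 1 RM \<and>
    (\<forall>h\<ge>2. hilbert_function (rees_quotient R I a b) h = hilbert_function R h + hilbert_function R (h - 1))"
proof -
  interpret rees: rees R \<mm> I a b
    by (rule rees.intro[OF is_cring rees_axioms.intro[OF max proper_subset_m I_ideal I_sub_m assms]])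
  note S = rees.S_def[symmetric]
  have hS: "hilbert_function (rees_quotient R I a b) h = n"
    if "rees.lenS (ideal_power rees.S rees.nn (Suc h)) (ideal_power rees.S rees.nn h) = enat n" for h n
    using rees.S.hilbert_function_eq_rel_length[OF rees.nn_maximal rees.max_ideal_S that] by (simp add: rees.S_def)
  have h0: "rees.lenS (ideal_power rees.S rees.nn (Suc 0)) (ideal_power rees.S rees.nn 0) = enat 1"
    using rees.S.rel_length_maximalideal[OF rees.nn_maximal]
    by (simp only: rees.S.ideal_power_1[OF rees.nn_ideal] ideal_power_0 one_enat_def)
  have h1: "rees.lenS (ideal_power rees.S rees.nn (Suc (Suc 0))) (ideal_power rees.S rees.nn (Suc 0))
    = enat (embedding_dim R + bass_number R 1 RM)"
  proof -
    have mI: "rees.mI (Suc 0) = scale c \<mm>" 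
      by (simp only: rees.mI_def rees.mpow_1 m_prod_I)
    show ?thesis
      unfolding rees.len_nn_power[of 0] rees.mI_0 mI len_generators embedding_dim_eq One_nat_def
      by (simp only: rees.mpow_def len_power_eq plus_enat_simps)
  qed
  have h2: "rees.lenS (ideal_power rees.S rees.nn (Suc (Suc (Suc h)))) (ideal_power rees.S rees.nn (Suc (Suc h)))
    = enat (hilbert_function R (Suc (Suc h)) + hilbert_function R (Suc h))" for h
  proof -
    have "len (scale c (ideal_power R \<mm> (Suc (Suc h)))) (scale c (ideal_power R \<mm> (Suc h)))
      = len (ideal_power R \<mm> (Suc (Suc h))) (ideal_power R \<mm> (Suc h))"
      by (rule len_scale[OF c_regular ideal_power_ideal[OF m_ideal] ideal_power_ideal[OF m_ideal]
          ideal_power_decreasing[OF m_ideal]])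
    then show ?thesis
      using rees.len_nn_power[of "Suc h"] by (simp only: rees.mpow_def rees.mI_def m_power_prod_I len_power_eq plus_enat_simps)
  qed
  have "hilbert_function (rees_quotient R I a b) h = hilbert_function R h + hilbert_function R (h - 1)" if h: "h \<ge> 2" for h
  proof -
    obtain k where k: "h = Suc (Suc k)" using le_Suc_ex[OF h] by (auto simp: numeral_2_eq_2)
    show ?thesis unfolding k diff_Suc_1 by (rule hS[OF h2])
  qed
  then show ?thesis using hS[OF h0] hS[OF h1] unfolding One_nat_def by blast
qed

end

section \<open>Canonical ideals\<close>

lemma (in cring) one_regular: "\<one> \<in> regular_elements R"
  by (simp add: regular_elements_def)

lemma (in cring) embed_inject:
  assumes r: "r \<in> carrier R" and s: "s \<in> carrier R" and eq: "embed R r = embed R s"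
  shows "r = s"
proof -
  have "(s, \<one>) \<in> embed R s"
    using s one_regular by (simp add: embed_def fraction_def fraction_rel_def)
  then have "(s, \<one>) \<in> embed R r" using eq by simp
  then show ?thesis using r s by (simp add: embed_def fraction_def fraction_rel_def)
qed

text \<open>The product of total fractions is visibly symmetric on representatives, while \<open>1 x = x\<close> is part of the
  module axioms.\<close>

lemma (in cring) embed_eq_smult:
  assumes F: "module R (fractions_module R)" and r: "r \<in> carrier R" "embed R r \<in> carrier (fractions_module R)"
  shows "r \<odot>\<^bsub>fractions_module R\<^esub> embed R \<one> = embed R r"
proof -
  have carr: "fst p \<in> carrier R \<and> snd p \<in> carrier R" if "p \<in> embed R x" for p x
    using that by (auto simp: embed_def fraction_def fraction_rel_def regular_elements_def)
  let ?q = "\<lambda>p p'. fraction R (fst p \<otimes> fst p') (snd p \<otimes> snd p')"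
  have smult: "x \<odot>\<^bsub>fractions_module R\<^esub> embed R y = (\<Union>p\<in>embed R x. \<Union>p'\<in>embed R y. ?q p p')" for x y
    by (simp add: fractions_module_def total_fractions_def Let_def case_prod_beta)
  have comm: "?q p p' = ?q p' p" if "p \<in> embed R x" "p' \<in> embed R y" for p p' x y
    using carr[OF that(1)] carr[OF that(2)] by (simp only: m_comm)
  have "(\<Union>p\<in>embed R r. \<Union>p'\<in>embed R \<one>. ?q p p') = (\<Union>p\<in>embed R r. \<Union>p'\<in>embed R \<one>. ?q p' p)"
    by (rule SUP_cong[OF refl SUP_cong[OF refl comm]])
  also have "\<dots> = (\<Union>p'\<in>embed R \<one>. \<Union>p\<in>embed R r. ?q p' p)" by (rule SUP_commute)
  finally have "r \<odot>\<^bsub>fractions_module R\<^esub> embed R \<one> = \<one> \<odot>\<^bsub>fractions_module R\<^esub> embed R r"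
    unfolding smult .
  also have "\<dots> = embed R r" by (rule module.smult_one[OF F r(2)])
  finally show ?thesis .
qed

text \<open>The preimage \<open>c\<close> of \<open>1\<close> under \<open>f : I \<cong> \<omega>\<close> satisfies \<open>f (c r) = r\<close>. Injectivity of \<open>R \<rightarrow> \<omega>\<close> makes it regular, and
  \<open>f (r i) \<in> \<mm> \<omega> = \<mm>\<close> gives \<open>r i \<in> c \<mm>\<close>.\<close>

lemma (in cring) canonical_ideal_generator:
  assumes \<omega>: "submodule R \<omega> (fractions_module R)" "embed R ` carrier R \<subseteq> \<omega>"
    and \<mm>: "\<mm> \<subseteq> carrier R" "ideal_prod (total_fractions R) (embed R ` \<mm>) \<omega> = embed R ` \<mm>"
    and I: "ideal I R"
    and f: "f \<in> module_hom R ((ring_module R)\<lparr>carrier := I\<rparr>) ((fractions_module R)\<lparr>carrier := \<omega>\<rparr>)"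
      "bij_betw f I \<omega>"
  obtains c where "c \<in> I" "c \<in> regular_elements R"
    "\<And>r i. r \<in> \<mm> \<Longrightarrow> i \<in> I \<Longrightarrow> \<exists>s\<in>\<mm>. r \<otimes> i = c \<otimes> s"
proof -
  let ?F = "fractions_module R"
  have F: "module R ?F" using \<omega>(1) by (rule submodule.module)
  note Ic = ideal_closed[OF I]
  have smult: "f (r \<otimes> i) = r \<odot>\<^bsub>?F\<^esub> f i" if "r \<in> carrier R" "i \<in> I" for r i
    using module_hom_smult[OF f(1), of r i] that by simp
  have f_inj: "x = y" if "f x = f y" "x \<in> I" "y \<in> I" for x y
    using f(2) that by (auto simp: bij_betw_def inj_on_def)
  have embed_\<omega>: "embed R r \<in> \<omega>" if "r \<in> carrier R" for r using \<omega>(2) that by blast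
  have embed_carr: "embed R r \<in> carrier ?F" if "r \<in> carrier R" for r
    using embed_\<omega>[OF that] submodule.subset[OF \<omega>(1)] by blast
  obtain c where c: "c \<in> I" "f c = embed R \<one>"
    using f(2) embed_\<omega>[OF one_closed] unfolding bij_betw_def by (metis imageE)
  have cR: "c \<in> carrier R" using c(1) Ic(1) by blast
  have f_mult: "f (c \<otimes> r) = embed R r" if r: "r \<in> carrier R" for r
  proof -
    have "f (c \<otimes> r) = f (r \<otimes> c)" using r cR by (simp add: m_comm)
    also have "\<dots> = embed R r" using smult[OF r c(1)] c(2) embed_eq_smult[OF F r embed_carr[OF r]] by simp
    finally show ?thesis .
  qed
  show thesis
  proof (rule that[OF c(1)])
    have "x = \<zero>" if x: "x \<in> carrier R" "c \<otimes> x = \<zero>" for x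
    proof (rule embed_inject[OF x(1) zero_closed])
      have "c \<otimes> x = c \<otimes> \<zero>" using x cR by simp
      then show "embed R x = embed R \<zero>" using f_mult[OF x(1)] f_mult[OF zero_closed] by simp
    qed
    then show "c \<in> regular_elements R" using cR by (simp add: regular_elements_def)
  next
    fix r i assume r: "r \<in> \<mm>" and i: "i \<in> I"
    have rR: "r \<in> carrier R" using r \<mm>(1) by blast
    have fi: "f i \<in> \<omega>" using f(2) i by (auto simp: bij_betw_def)
    have "f (r \<otimes> i) = embed R r \<otimes>\<^bsub>total_fractions R\<^esub> f i"
      using smult[OF rR i] by (simp add: fractions_module_def Let_def)
    also have "\<dots> \<in> ideal_prod (total_fractions R) (embed R ` \<mm>) \<omega>"
      by (rule ideal_prod.prod[OF imageI[OF r] fi])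
    finally obtain s where s: "s \<in> \<mm>" "f (r \<otimes> i) = embed R s" unfolding \<mm>(2) by blast
    have sR: "s \<in> carrier R" using s(1) \<mm>(1) by blast
    have "f (r \<otimes> i) = f (c \<otimes> s)" using s(2) f_mult[OF sR] by simp
    then have "r \<otimes> i = c \<otimes> s" by (rule f_inj[OF _ Ic(4)[OF rR i] Ic(5)[OF sR c(1)]])
    then show "\<exists>s\<in>\<mm>. r \<otimes> i = c \<otimes> s" using s(1) by blast
  qed
qed

text \<open>The isomorphism carries \<open>c I\<close> and its socle to \<open>c \<omega>\<close> and the socle of \<open>\<omega> / c \<omega>\<close>, whose length is the first
  Bass number by theorem \<open>bass_number_1\<close>. Finiteness of the length comes from the regular element
  \<open>c\<^sup>2 \<in> c I\<close>.\<close>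

lemma (in one_dim_local) canonical_ideal_type:
  assumes I: "ideal I R" and cI: "c \<in> I" "c \<in> \<mm>" and c: "c \<in> regular_elements R"
    and C: "module R C" "bass_number R 1 C = 1"
    and f: "f \<in> module_hom R (RM\<lparr>carrier := I\<rparr>) C" "bij_betw f I (carrier C)"
  shows "len (scale c I) {i \<in> I. \<forall>r\<in>\<mm>. r \<otimes> i \<in> scale c I} = 1"
proof -
  let ?U = "{i \<in> I. \<forall>r\<in>\<mm>. r \<otimes> i \<in> scale c I}"
  interpret C: module R C by (rule C(1))
  have cR: "c \<in> carrier R" using c by (rule regular_elements_closed)
  note Ic = ideal_closed[OF I]
  note mc = ideal_closed(1)[OF m_ideal]
  have smult: "f (r \<otimes> i) = r \<odot>\<^bsub>C\<^esub> f i" if "r \<in> carrier R" "i \<in> I" for r i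
    using module_hom_smult[OF f(1), of r i] that by simp
  have add: "f (x \<oplus> y) = f x \<oplus>\<^bsub>C\<^esub> f y" if "x \<in> I" "y \<in> I" for x y
    using module_hom_add[OF f(1), of x y] that by simp
  have f_inj: "x = y" if "f x = f y" "x \<in> I" "y \<in> I" for x y
    using f(2) that by (auto simp: bij_betw_def inj_on_def)
  have f_C: "f i \<in> carrier C" if "i \<in> I" for i using f(2) that by (auto simp: bij_betw_def)
  have f_surj: "\<exists>i\<in>I. x = f i" if "x \<in> carrier C" for x using f(2) that by (auto simp: bij_betw_def)
  have f_zero: "f \<zero> = \<zero>\<^bsub>C\<^esub>"
    using smult[OF zero_closed cI(1)] f_C[OF cI(1)] cR by simp
  have cI_ideal: "ideal (scale c I) R" by (rule scale_ideal[OF cR I])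
  have U_ideal: "ideal ?U R" by (rule transporter_ideal[OF I cI_ideal mc])
  have cI_U: "scale c I \<subseteq> ?U"
    using ideal_closed(4)[OF cI_ideal] Ic(4)[OF cR] mc by (auto simp: scale_def)
  have mem_multiples: "f i \<in> multiples C c \<longleftrightarrow> i \<in> scale c I" if i: "i \<in> I" for i
  proof
    assume "f i \<in> multiples C c"
    then obtain j where j: "j \<in> I" "f i = c \<odot>\<^bsub>C\<^esub> f j" using f_surj unfolding multiples_def by blast
    then have "f i = f (c \<otimes> j)" using smult[OF cR] by simp
    then have "i = c \<otimes> j" by (rule f_inj[OF _ i Ic(4)[OF cR j(1)]])
    then show "i \<in> scale c I" using j(1) by (simp add: scale_def)
  next
    assume "i \<in> scale c I"
    then obtain j where j: "j \<in> I" "i = c \<otimes> j" by (auto simp: scale_def)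
    then show "f i \<in> multiples C c" using smult[OF cR j(1)] f_C[OF j(1)] by (simp add: multiples_def)
  qed
  have mem_socle: "f i \<in> socle_mod C \<mm> c \<longleftrightarrow> i \<in> ?U" if i: "i \<in> I" for i
  proof -
    have "r \<odot>\<^bsub>C\<^esub> f i \<in> multiples C c \<longleftrightarrow> r \<otimes> i \<in> scale c I" if "r \<in> \<mm>" for r
      using mem_multiples[OF Ic(4)[OF subsetD[OF mc that] i]] smult[OF subsetD[OF mc that] i] by simp
    then show ?thesis using i f_C[OF i] by (simp add: socle_mod_def)
  qed
  note X = C.multiples_submodule[OF cR] and Y = C.socle_mod_submodule[OF cR mc]
  note XY = C.multiples_subset_socle_mod[OF cR mc]
  note subs = submodule_iff[THEN iffD2, OF cI_ideal] submodule_iff[THEN iffD2, OF U_ideal]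
  have img: "f i \<in> socle_mod C \<mm> c" if "i \<in> ?U" for i using mem_socle[of i] that by blast
  have add': "f (x \<oplus>\<^bsub>RM\<^esub> y) = f x \<oplus>\<^bsub>C\<^esub> f y" if "x \<in> ?U" "y \<in> ?U" for x y using add that by simp
  have ker: "f i \<in> multiples C c \<longleftrightarrow> i \<in> scale c I" if "i \<in> ?U" for i using mem_multiples that by simp
  have zero: "\<zero>\<^bsub>C\<^esub> \<in> multiples C c" by (rule submodule.zero_closed[OF X])
  have scal: "r \<odot>\<^bsub>C\<^esub> f i = f (r \<otimes> i) \<oplus>\<^bsub>C\<^esub> \<zero>\<^bsub>C\<^esub> \<and> f (r \<otimes> i) = r \<odot>\<^bsub>C\<^esub> f i \<oplus>\<^bsub>C\<^esub> \<zero>\<^bsub>C\<^esub>"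
    if "r \<in> carrier R" "i \<in> ?U" for r i
    using smult[OF that(1)] f_C that by simp
  have len_eq: "len (scale c I) ?U = rel_length R C (multiples C c) (socle_mod C \<mm> c)"
  proof (rule antisym)
    show "len (scale c I) ?U \<le> rel_length R C (multiples C c) (socle_mod C \<mm> c)"
    proof (rule rel_length_transfer_le[where g=f, OF subs cI_U X Y img add' ker XY])
      fix r assume r: "r \<in> carrier R"
      show "\<exists>s\<in>carrier R. \<forall>x\<in>?U. \<exists>d\<in>multiples C c. r \<odot>\<^bsub>C\<^esub> f x = f (s \<odot>\<^bsub>RM\<^esub> x) \<oplus>\<^bsub>C\<^esub> d"
        using r zero scal[OF r] unfolding ring_module_simps by blast
    qed
    show "rel_length R C (multiples C c) (socle_mod C \<mm> c) \<le> len (scale c I) ?U"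
    proof (rule rel_length_transfer_ge[where g=f, OF subs X Y XY img add' ker cI_U])
      fix y assume y: "y \<in> socle_mod C \<mm> c"
      then obtain i where i: "i \<in> I" "y = f i" using f_surj by (auto simp: socle_mod_def)
      then have "i \<in> ?U" using mem_socle[OF i(1)] y by blast
      moreover have "y = f i \<oplus>\<^bsub>C\<^esub> \<zero>\<^bsub>C\<^esub>" using f_C[OF i(1)] i(2) by simp
      ultimately show "\<exists>x\<in>?U. \<exists>d\<in>multiples C c. y = f x \<oplus>\<^bsub>C\<^esub> d" using zero by blast
    next
      fix r assume r: "r \<in> carrier R"
      show "\<exists>s\<in>carrier R. \<forall>x\<in>?U. \<exists>d\<in>multiples C c. f (r \<odot>\<^bsub>RM\<^esub> x) = s \<odot>\<^bsub>C\<^esub> f x \<oplus>\<^bsub>C\<^esub> d"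
        using r zero scal[OF r] unfolding ring_module_simps by blast
    qed
  qed
  have "c \<otimes> c \<in> regular_elements R" using regular_elements_pow[OF c, of "Suc (Suc 0)"] cR by simp
  moreover have "c \<otimes> c \<in> scale c I" using cI(1) by (simp add: scale_def)
  ultimately obtain n where n: "len (scale c I) ?U = enat n"
    using len_finite[OF _ cI_ideal _ U_ideal cI_U] by blast
  have "bass_number R 1 C = n"
  proof (rule bass_number_1[OF noeth max max_ideal_eq C(1) cI(2)])
    show "rel_length R C (multiples C c) (socle_mod C \<mm> c) = enat n" using n len_eq by simp
    fix x assume x: "x \<in> carrier C" "c \<odot>\<^bsub>C\<^esub> x = \<zero>\<^bsub>C\<^esub>"
    obtain i where i: "i \<in> I" "x = f i" using f_surj[OF x(1)] by blast
    have "f (c \<otimes> i) = f \<zero>" using smult[OF cR i(1)] x(2) i(2) f_zero by simp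
    then have "c \<otimes> i = \<zero>" by (rule f_inj[OF _ Ic(4)[OF cR i(1)] Ic(2)])
    then have "i = \<zero>" using c i(1) Ic(1) by (auto simp: regular_elements_def)
    then show "x = \<zero>\<^bsub>C\<^esub>" using i(2) f_zero by simp
  qed
  then show ?thesis using n C(2) by (simp add: one_enat_def)
qed

theorem proposition1p4:
  fixes R :: "('a, 'r) ring_scheme" and \<omega> :: "('a \<times> 'a) set set" and I :: "'a set" and a b :: 'a
  assumes "almost_gorenstein R \<omega>"
    and "canonical_ideal R \<omega> I"
    and "a \<in> carrier R" and "b \<in> carrier R"
  shows "hilbert_function (rees_quotient R I a b) 0 = 1 \<and>
         hilbert_function (rees_quotient R I a b) 1 = embedding_dim R + cm_type R \<and>
         (\<forall>h\<ge>2. hilbert_function (rees_quotient R I a b) h =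
                 hilbert_function R h + hilbert_function R (h - 1))"
proof -
  let ?F = "fractions_module R"
  let ?C = "?F\<lparr>carrier := \<omega>\<rparr>"
  have ag: "local_ring R" "depth R = 1" "krull_dim R = 1" "submodule R \<omega> ?F" "canonical_module R ?C"
    "embed R ` carrier R \<subseteq> \<omega>"
    "ideal_prod (total_fractions R) (embed R ` max_ideal R) \<omega> = embed R ` max_ideal R"
    using assms(1) by (auto simp: almost_gorenstein_def cohen_macaulay_local_def)
  have I: "ideal I R" "I \<noteq> carrier R" "modules_isomorphic R ((ring_module R)\<lparr>carrier := I\<rparr>) ?C"
    using assms(2) by (auto simp: canonical_ideal_def)
  obtain f where f: "f \<in> module_hom R ((ring_module R)\<lparr>carrier := I\<rparr>) ?C" "bij_betw f I \<omega>"
    using I(3) by (auto simp: modules_isomorphic_def)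
  interpret cring R using ag(1) by (simp add: local_ring_def)
  have ex1: "\<exists>!\<mm>. maximalideal \<mm> R" using ag(1) by (simp add: local_ring_def)
  have max: "maximalideal (max_ideal R) R" unfolding max_ideal_def by (rule theI'[OF ex1])
  have max_unique: "J = max_ideal R" if "maximalideal J R" for J using ex1 max that by blast
  interpret one_dim_local R "max_ideal R"
  proof (intro one_dim_local.intro one_dim_local_axioms.intro is_cring max ag(3))
    show "noetherian_ring R" using ag(1) by (simp add: local_ring_def)
  qed (rule max_unique)
  obtain c where c: "c \<in> I" "c \<in> regular_elements R"
    "\<And>r i. r \<in> max_ideal R \<Longrightarrow> i \<in> I \<Longrightarrow> \<exists>s\<in>max_ideal R. r \<otimes>\<^bsub>R\<^esub> i = c \<otimes>\<^bsub>R\<^esub> s"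
    by (rule canonical_ideal_generator[OF ag(4,6) ideal_closed(1)[OF m_ideal] ag(7) I(1) f]) blast
  have cm: "c \<in> max_ideal R" using c(1) proper_subset_m[OF I(1,2)] by blast
  have C: "module R ?C" "bass_number R 1 ?C = 1"
    using ag(3,5) unfolding canonical_module_def by (simp_all add: one_enat_def)
  have type1: "len (scale c I) {i \<in> I. \<forall>r\<in>max_ideal R. r \<otimes>\<^bsub>R\<^esub> i \<in> scale c I} = 1"
    by (rule canonical_ideal_type[OF I(1) c(1) cm c(2) C f(1)]) (use f(2) in simp)
  interpret almost_gorenstein_ideal R "max_ideal R" I c
    by (rule almost_gorenstein_ideal.intro[OF one_dim_local_axioms
          almost_gorenstein_ideal_axioms.intro[OF I(1,2) c(2,1,3) type1]])
  have "cm_type R = bass_number R 1 (ring_module R)"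
    unfolding cm_type_def ag(2) by (simp add: one_enat_def)
  then show ?thesis using hilbert_function_rees_quotient[OF assms(3,4)] by simp
qed

end
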